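(* Let $d\ge1$, $\lambda\ge0$, $x_0\in\mathbb{R}^d$, let $F,G:\mathbb{R}^d\times\mathbb{R}^d\to\mathbb{R}^d$ be globally Lipschitz, with $(G,F)$ monotone and $\alpha$-monotone in its second variable for some $\alpha>0$, and let $T:\mathbb{R}^d\to\mathbb{R}^d$ be affine. Then there exists a solution $U:(0,\infty)\times\mathbb{R}^d\to\mathbb{R}^d$ of the planning problem master equation characterized by $F,G,\lambda,T,x_0$, that is, a solution of $$\partial_tU+(F(x,U)\cdot\nabla_x)U+\lambda\big(U-(DT)^*U(t,Tx)\big)=G(x,U)\ \text{ in }(0,\infty)\times\mathbb{R}^d$$ such that $U(t,\cdot)$ converges to $A_{x_0}$ in the sense of graphs as $t\to0$.
   Context: A map $A$ on a Hilbert space is monotone if $\langle A(x)-A(y),x-y\rangle\ge0$ for all $x,y$. $(G,F)$ denotes the map $(x,p)\mapsto(G(x,p),F(x,p))$ on $\mathbb{R}^{2d}$; it is $\alpha$-monotone in its second variable if $\langle G(x,p)-G(y,q),x-y\rangle+\langle F(x,p)-F(y,q),p-q\rangle\ge\alpha|p-q|^2$ for all $(x,p),(y,q)\in\mathbb{R}^{2d}$. $(F(x,U)\cdot\nabla_x)U$ has $i$-th component $\sum_jF_j(x,U(t,x))\,\partial_{x_j}U^i(t,x)$. $DT$ is the differential of $T$ and $(DT)^*$ its adjoint. $A_{x_0}$ is the multivalued operator on $\mathbb{R}^d$ with domain $\{x_0\}$ and $A_{x_0}(x_0)=\mathbb{R}^d$. A sequence of multivalued operators $(A_n)$ converges to $A$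 in the sense of graphs if, whenever $y_n\in A_n(x_n)$ for all $n$ and $(x_n,y_n)\to(x,y)$, one has $y\in A(x)$. Thus $U(t,\cdot)\to A_{x_0}$ in the sense of graphs as $t\to0$ means: for all sequences $t_n\to0^+$, $x_n\to x$ with $U(t_n,x_n)$ convergent, one has $x=x_0$. Being a solution of the equation means being locally Lipschitz on $(0,\infty)\times\mathbb{R}^d$ and satisfying it almost everywhere. *)

theory Defs
  imports "HOL-Analysis.Analysis"
begin

definition monotone_operator :: "('a::real_inner \<Rightarrow> 'a) \<Rightarrow> bool" where
  "monotone_operator A \<longleftrightarrow> (\<forall>x y. inner (A x - A y) (x - y) \<ge> 0)"

definition strongly_monotone_snd ::
    "real \<Rightarrow> ('a::real_inner \<times> 'a \<Rightarrow> 'a) \<Rightarrow> ('a \<times> 'a \<Rightarrow> 'a) \<Rightarrow> bool" where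
  "strongly_monotone_snd \<alpha> G F \<longleftrightarrow>
     (\<forall>x p y q. inner (G (x, p) - G (y, q)) (x - y) + inner (F (x, p) - F (y, q)) (p - q)
                  \<ge> \<alpha> * (norm (p - q))\<^sup>2)"

definition globally_lipschitz :: "('a::metric_space \<Rightarrow> 'b::metric_space) \<Rightarrow> bool" where
  "globally_lipschitz f \<longleftrightarrow> (\<exists>L. L-lipschitz_on UNIV f)"

(* The library's local_lipschitz is about Lipschitz continuity in the second argument only,
   locally uniformly in the first; here joint Lipschitz continuity is needed. *)
definition locally_lipschitz_on :: "'a::metric_space set \<Rightarrow> ('a \<Rightarrow> 'b::metric_space) \<Rightarrow> bool" where
  "locally_lipschitz_on S f \<longleftrightarrow> (\<forall>z\<in>S. \<exists>e>0. \<exists>L. L-lipschitz_on (ball z e \<inter> S) f)"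

definition affine_map :: "('a::real_vector \<Rightarrow> 'b::real_vector) \<Rightarrow> bool" where
  "affine_map T \<longleftrightarrow> (\<exists>A b. linear A \<and> (\<forall>x. T x = A x + b))"

(* Multivalued operators are set-valued functions; the domain is where the value is nonempty. *)
definition graph_converges ::
    "(nat \<Rightarrow> 'a::topological_space \<Rightarrow> 'b::topological_space set) \<Rightarrow> ('a \<Rightarrow> 'b set) \<Rightarrow> bool" where
  "graph_converges A B \<longleftrightarrow>
     (\<forall>X Y x y. (\<forall>n. Y n \<in> A n (X n)) \<longrightarrow> X \<longlonglongrightarrow> x \<longrightarrow> Y \<longlonglongrightarrow> y \<longrightarrow> y \<in> B x)"

definition point_operator :: "'a \<Rightarrow> 'a \<Rightarrow> 'a set" where
  "point_operator x0 x = (if x = x0 then UNIV else {})"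

(* U need only be meaningful for positive times. *)
definition graph_converges_at_0 ::
    "(real \<Rightarrow> 'a::topological_space \<Rightarrow> 'b::topological_space) \<Rightarrow> ('a \<Rightarrow> 'b set) \<Rightarrow> bool" where
  "graph_converges_at_0 U B \<longleftrightarrow>
     (\<forall>t. (\<forall>n. t n > 0) \<longrightarrow> t \<longlonglongrightarrow> 0 \<longrightarrow> graph_converges (\<lambda>n x. {U (t n) x}) B)"

(* The equation at a single point (t, x), including the existence of the partial derivatives
   occurring in it: Ut is the time derivative, and J $ i $ j is the derivative of the
   i-th component of U in the direction x_j. *)
definition master_equation_at ::
    "((real^'n) \<times> (real^'n) \<Rightarrow> real^'n) \<Rightarrow> ((real^'n) \<times> (real^'n) \<Rightarrow> real^'n) \<Rightarrow> real \<Rightarrow>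
     ((real^'n) \<Rightarrow> (real^'n)) \<Rightarrow> (real \<Rightarrow> real^'n \<Rightarrow> real^'n) \<Rightarrow> real \<Rightarrow> real^'n \<Rightarrow> bool" where
  "master_equation_at F G lam T U t x \<longleftrightarrow>
     (\<exists>Ut (J :: real^'n^'n).
        ((\<lambda>s. U s x) has_vector_derivative Ut) (at t) \<and>
        (\<forall>i j. ((\<lambda>h. U t (x + h *\<^sub>R axis j 1) $ i) has_real_derivative J $ i $ j) (at 0)) \<and>
        Ut + (\<chi> i. \<Sum>j\<in>UNIV. F (x, U t x) $ j * J $ i $ j)
           + lam *\<^sub>R (U t x - adjoint (frechet_derivative T (at x)) (U t (T x)))
         = G (x, U t x))"

definition master_equation_solution ::
    "((real^'n) \<times> (real^'n) \<Rightarrow> real^'n) \<Rightarrow> ((real^'n) \<times> (real^'n) \<Rightarrow> real^'n) \<Rightarrow> real \<Rightarrow>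
     ((real^'n) \<Rightarrow> (real^'n)) \<Rightarrow> (real \<Rightarrow> real^'n \<Rightarrow> real^'n) \<Rightarrow> bool" where
  "master_equation_solution F G lam T U \<longleftrightarrow>
     locally_lipschitz_on ({0<..} \<times> UNIV) (\<lambda>(t, x). U t x) \<and>
     (AE z in lborel. fst z > 0 \<longrightarrow> master_equation_at F G lam T U (fst z) (snd z))"

definition planning_solution ::
    "((real^'n) \<times> (real^'n) \<Rightarrow> real^'n) \<Rightarrow> ((real^'n) \<times> (real^'n) \<Rightarrow> real^'n) \<Rightarrow> real \<Rightarrow>
     ((real^'n) \<Rightarrow> (real^'n)) \<Rightarrow> real^'n \<Rightarrow> (real \<Rightarrow> real^'n \<Rightarrow> real^'n) \<Rightarrow> bool" where
  "planning_solution F G lam T x0 U \<longleftrightarrow>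
     master_equation_solution F G lam T U \<and> graph_converges_at_0 U (point_operator x0)"

end

theory Submission
  imports Defs
begin

text \<open>
  The idea is to run the characteristic system \<open>x' = F(x, u)\<close>,
  \<open>u' = G(x, u) - \<lambda> u + \<lambda> S\<^sup>* U(t, T x)\<close>, where \<open>S\<close> is the linear part of \<open>T\<close>, from the regular monotone
  data \<open>(x - x0) / \<epsilon>\<close>, and to let \<open>\<epsilon> \<rightarrow> 0\<close>.  Along two characteristics the scalar product
  \<open>\<langle>dx, du\<rangle>\<close> satisfies
  \<open>\<langle>dx, du\<rangle>' \<ge> \<alpha> |du|\<^sup>2 - \<lambda> \<langle>dx, du\<rangle> + \<lambda> \<langle>S dx, U(T x) - U(T y)\<rangle>\<close>, and the last term is nonnegative
  because \<open>U(t, \<cdot>)\<close> is monotone.  So monotonicity is preserved, and the gain \<open>\<alpha> |du|\<^sup>2\<close> turns it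
  into the stronger property \<open>\<langle>dx, du\<rangle> \<ge> \<beta> (|du|\<^sup>2 - |dx|\<^sup>2)\<close> with \<open>\<beta>\<close> growing linearly in time up to a fixed
  threshold.  This property bounds the Lipschitz constant of \<open>U(t, \<cdot>)\<close> by \<open>1 + 1/\<beta>\<close>, whatever \<open>\<epsilon>\<close> is.
  Differences of the nonlocal term are absorbed because the same property holds at the points
  \<open>T x\<close> and \<open>T y\<close>.

  Instead of solving the characteristic system, one discretizes it.  The step \<open>euler_step\<close> is a
  symplectic Euler step, explicit in \<open>x\<close> and implicit in \<open>u\<close>, and is arranged so that the identity behind the estimate
  of \<open>\<langle>dx, du\<rangle>\<close> holds without discretization error (\<open>cocoercive_step_vectors\<close>); a step exists by two
  applications of the contraction principle.  Near time 0, following characteristics backwards gives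
  \<open>|x - x0| \<le> K t (H + |U(t, x)|)\<close> (\<open>anchor_step\<close>).  This inequality is the convergence of the graphs to the
  vertical line above \<open>x0\<close>; together with the Lipschitz bound it also keeps \<open>U(t, \<cdot>)\<close> locally bounded,
  uniformly in \<open>\<epsilon>\<close>.

  For the passage to the limit, the equation is encoded by an inequality between finitely many
  values of \<open>U\<close>, namely
  \<open>|U(t + h, x + h F(x, U(t, x))) - U(t, x) - h R(t, x)| = O(h\<^sup>2)\<close> with
  \<open>R = G(x, U) - \<lambda> U + \<lambda> S\<^sup>* U(t, T x)\<close>.  It is stable under pointwise convergence, so
  Tychonoff's theorem provides a limit \<open>U\<close> (\<open>scheme_limit\<close>).  At a point where \<open>U\<close> has a linear
  directional derivative, the inequality says that the derivative in the direction \<open>(1, F(x, U))\<close>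
  is \<open>R\<close>, which is the equation.  Almost every point has this property by Rademacher's
  theorem in the form \<open>rademacher_gateaux\<close>, which is proved first.
\<close>

section \<open>Directional derivatives of Lipschitz functions\<close>

text \<open>The points where \<open>f\<close> has, on arbitrarily small intervals of the line through \<open>x\<close> in direction \<open>v\<close>
  around \<open>x\<close>, slopes below \<open>p\<close> and also slopes above \<open>q\<close>.  Since the intervals need not start or
  end at \<open>x\<close>, both conditions are open for every size of the interval when \<open>f\<close> is continuous, so the
  set is a countable intersection of open sets and no question of measurability arises.\<close>
definition oscillation_set :: "('a::real_normed_vector \<Rightarrow> real) \<Rightarrow> 'a \<Rightarrow> real \<Rightarrow> real \<Rightarrow> 'a set" where
  "oscillation_set f v p q =
     (\<Inter>k. {x. \<exists>a<0. \<exists>b>0. b - a < 1 / real (Suc k) \<and> f (x + b *\<^sub>R v) - f (x + a *\<^sub>R v) < p * (b - a)}) \<inter>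
     (\<Inter>k. {x. \<exists>a<0. \<exists>b>0. b - a < 1 / real (Suc k) \<and> f (x + b *\<^sub>R v) - f (x + a *\<^sub>R v) > q * (b - a)})"

lemma oscillation_set_borel:
  fixes f :: "'a::euclidean_space \<Rightarrow> real"
  assumes "continuous_on UNIV f"
  shows "oscillation_set f v p q \<in> sets borel"
proof -
  have c: "continuous_on UNIV (\<lambda>x. f (x + s *\<^sub>R v))" for s
    by (rule continuous_on_compose2[OF assms]) (auto intro!: continuous_intros)
  have o1: "open {x. f (x + b *\<^sub>R v) - f (x + a *\<^sub>R v) < p * (b - a)}" for a b
    by (intro open_Collect_less continuous_intros c)
  have o2: "open {x. f (x + b *\<^sub>R v) - f (x + a *\<^sub>R v) > q * (b - a)}" for a b
    by (intro open_Collect_less continuous_intros c)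
  have e1: "{x. \<exists>a<0. \<exists>b>0. b - a < 1 / real (Suc k) \<and> f (x + b *\<^sub>R v) - f (x + a *\<^sub>R v) < p * (b - a)}
     = (\<Union>a\<in>{..<0}. \<Union>b\<in>{b. b>0 \<and> b - a < 1 / real (Suc k)}. {x. f (x + b *\<^sub>R v) - f (x + a *\<^sub>R v) < p * (b - a)})" for k
    by auto
  have e2: "{x. \<exists>a<0. \<exists>b>0. b - a < 1 / real (Suc k) \<and> f (x + b *\<^sub>R v) - f (x + a *\<^sub>R v) > q * (b - a)}
     = (\<Union>a\<in>{..<0}. \<Union>b\<in>{b. b>0 \<and> b - a < 1 / real (Suc k)}. {x. f (x + b *\<^sub>R v) - f (x + a *\<^sub>R v) > q * (b - a)})" for k
    by auto
  show ?thesis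
    unfolding oscillation_set_def e1 e2
    by (intro sets.Int sets.countable_INT') (auto intro!: borel_open open_UN o1 o2)
qed

lemma emeasure_interval_measure_ball:
  fixes g :: "real \<Rightarrow> real"
  assumes mono: "\<And>x y. x \<le> y \<Longrightarrow> g x \<le> g y" and cont: "continuous_on UNIV g" and "r > 0"
  shows "emeasure (interval_measure g) (ball a r) = ennreal (g (a + r) - g (a - r))"
proof -
  have "emeasure (interval_measure g) {a - r<..<a + r} = ennreal (g (a + r) - g (a - r))"
  proof -
    have c: "isCont g x" for x
      using cont by (simp add: continuous_on_eq_continuous_at)
    have Icc: "emeasure (interval_measure g) {x .. y} = ennreal (g y - g x)" if "x \<le> y" for x y
      by (rule emeasure_interval_measure_Icc) (use that mono cont in auto)
    have pt: "emeasure (interval_measure g) {x} = 0" for x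
      using Icc[of x x] by simp
    have Ioc: "emeasure (interval_measure g) {a-r<..a+r} = ennreal (g (a+r) - g (a-r))"
      by (rule emeasure_interval_measure_Ioc) (use \<open>r>0\<close> mono c in \<open>auto intro: continuous_at_imp_continuous_at_within\<close>)
    have "{a-r<..a+r} = {a-r<..<a+r} \<union> {a+r}" using \<open>r>0\<close> by auto
    then have "emeasure (interval_measure g) {a-r<..a+r} = emeasure (interval_measure g) ({a-r<..<a+r} \<union> {a+r})"
      by simp
    also have "\<dots> = emeasure (interval_measure g) {a-r<..<a+r}"
      using pt[of "a+r"] by (intro emeasure_Un_null_set) auto
    finally show ?thesis using Ioc by simp
  qed
  then show ?thesis by (simp add: ball_eq_greaterThanLessThan)
qed

text \<open>An inequality between two measures on the balls of a disjoint family passes to the union;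
  balls are encoded as pairs of centre and radius.\<close>
lemma emeasure_disjoint_balls_le:
  fixes \<mu> \<nu> :: "'a::metric_space measure"
  assumes s: "sets \<mu> = sets borel" "sets \<nu> = sets borel" and C: "countable C"
    and disj: "pairwise (\<lambda>i j. disjnt (ball (fst i) (snd i)) (ball (fst j) (snd j))) C"
    and le: "\<And>i. i \<in> C \<Longrightarrow> emeasure \<mu> (ball (fst i) (snd i)) \<le> k * emeasure \<nu> (ball (fst i) (snd i))"
  shows "emeasure \<mu> (\<Union>i\<in>C. ball (fst i) (snd i)) \<le> k * emeasure \<nu> (\<Union>i\<in>C. ball (fst i) (snd i))"
proof -
  have d: "disjoint_family_on (\<lambda>i. ball (fst i) (snd i)) C"
    using disj by (auto simp: disjoint_family_on_def pairwise_def disjnt_def)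
  have "emeasure \<mu> (\<Union>i\<in>C. ball (fst i) (snd i)) = (\<integral>\<^sup>+i. emeasure \<mu> (ball (fst i) (snd i)) \<partial>count_space C)"
    by (rule emeasure_UN_countable) (use s C d in auto)
  also have "\<dots> \<le> (\<integral>\<^sup>+i. k * emeasure \<nu> (ball (fst i) (snd i)) \<partial>count_space C)"
    by (rule nn_integral_mono) (use le in auto)
  also have "\<dots> = k * (\<integral>\<^sup>+i. emeasure \<nu> (ball (fst i) (snd i)) \<partial>count_space C)"
    by (rule nn_integral_cmult) auto
  also have "(\<integral>\<^sup>+i. emeasure \<nu> (ball (fst i) (snd i)) \<partial>count_space C) = emeasure \<nu> (\<Union>i\<in>C. ball (fst i) (snd i))"
    by (rule emeasure_UN_countable[symmetric]) (use s C d in auto)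
  finally show ?thesis .
qed

lemma ball_from_interval:
  fixes x a b :: real
  assumes "a < 0" "b > 0"
  obtains m r where "r > 0" "2 * r = b - a" "ball m r = {x + a<..<x + b}" "m + r = x + b" "m - r = x + a"
  by (rule that[of "(b-a)/2" "x + (a+b)/2"])
     (use assms in \<open>auto simp: ball_eq_greaterThanLessThan field_simps\<close>)

text \<open>Vitali's covering theorem for the intervals that realize a property \<open>P\<close> of their endpoints.\<close>
lemma vitali_slope_cover:
  fixes S O' :: "real set"
  assumes O: "open O'" "S \<subseteq> O'"
    and small: "\<forall>x\<in>S. \<forall>k. \<exists>a<0. \<exists>b>0. b - a < 1 / real (Suc k) \<and> P (x + a) (x + b)"
  obtains C where "countable C" "pairwise (\<lambda>i j. disjnt (ball (fst i) (snd i)) (ball (fst j) (snd j))) C"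
    "\<And>i. i \<in> C \<Longrightarrow> snd i > 0 \<and> ball (fst i) (snd i) \<subseteq> O' \<and> P (fst i - snd i) (fst i + snd i)"
    "negligible (S - (\<Union>i\<in>C. ball (fst i) (snd i)))"
proof -
  define K where "K = {(m, r). r > 0 \<and> ball m r \<subseteq> O' \<and> P (m - r) (m + r)}"
  have K: "\<exists>i. i \<in> K \<and> x \<in> ball (fst i) (snd i) \<and> snd i < d" if xd: "x \<in> S" "d > 0" for x d
  proof -
    obtain e1 where e1: "e1 > 0" "ball x e1 \<subseteq> O'" using O xd by (meson openE subsetD)
    obtain k where k: "1 / real (Suc k) < min e1 d"
      using \<open>d>0\<close> e1 by (metis min_less_iff_conj nat_approx_posE)
    obtain a b where ab: "a < 0" "b > 0" "b - a < 1 / real (Suc k)" "P (x + a) (x + b)" using small xd(1) by blast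
    obtain m r where mr: "r > 0" "2 * r = b - a" "ball m r = {x + a<..<x + b}" "m + r = x + b" "m - r = x + a"
      by (rule ball_from_interval[OF ab(1,2)])
    have "ball m r \<subseteq> ball x e1" unfolding mr(3) using ab k by (auto simp: dist_real_def)
    then have "(m, r) \<in> K" unfolding K_def mem_Collect_eq prod.case mr(4,5) using mr(1) ab(4) e1(2) by blast
    moreover have "x \<in> ball m r" unfolding mr(3) using ab by auto
    moreover have "r < d" using mr ab k by auto
    ultimately show ?thesis by (intro exI[of _ "(m, r)"]) auto
  qed
  obtain C where C: "countable C" "C \<subseteq> K"
    "pairwise (\<lambda>i j. disjnt (ball (fst i) (snd i)) (ball (fst j) (snd j))) C"
    "negligible (S - (\<Union>i\<in>C. ball (fst i) (snd i)))"
    by (rule Vitali_covering_theorem_balls[where S=S and K=K and a=fst and r=snd]) (use K in blast)+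
  show ?thesis
  proof (rule that[OF C(1,3) _ C(4)])
    fix i assume "i \<in> C"
    then have "i \<in> K" using C(2) by blast
    then show "snd i > 0 \<and> ball (fst i) (snd i) \<subseteq> O' \<and> P (fst i - snd i) (fst i + snd i)" by (auto simp: K_def)
  qed
qed

text \<open>Lebesgue's argument.  Cover the set \<open>S\<close> up to a null set by disjoint intervals of slope less
  than \<open>p\<close> inside an open set of measure little more than \<open>|S|\<close>, and then cover it again, inside these
  intervals, by disjoint intervals of slope greater than \<open>q\<close>.  The Stieltjes measure of \<open>g\<close> is at least
  \<open>q |S|\<close> on the second family, at most about \<open>p |S|\<close> on the first, and monotone; so \<open>|S| = 0\<close>.\<close>
lemma oscillation_set_mono_bounded:
  fixes g :: "real \<Rightarrow> real"
  assumes mono: "\<And>x y. x \<le> y \<Longrightarrow> g x \<le> g y" and cont: "continuous_on UNIV g" and pq: "p < q"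
  shows "emeasure lborel (oscillation_set g 1 p q \<inter> ball 0 R) = 0"
proof (cases "p > 0")
  case False
  have "\<not> g (x + b) - g (x + a) < p * (b - a)" if "a < 0" "b > 0" for a b x
  proof -
    have "p * (b - a) \<le> 0" using False that by (simp add: mult_nonpos_nonneg)
    moreover have "g (x+a) \<le> g (x+b)" using that by (intro mono) auto
    ultimately show ?thesis by simp
  qed
  then have "oscillation_set g 1 p q = {}" by (auto simp: oscillation_set_def)
  then show ?thesis by simp
next
  case True
  define S where "S = oscillation_set g 1 p q \<inter> ball 0 R"
  define \<nu> where "\<nu> = interval_measure g"
  have [simp]: "sets \<nu> = sets borel" by (simp add: \<nu>_def)
  have S[measurable]: "S \<in> sets borel" unfolding S_def using oscillation_set_borel[OF cont, of 1 p q] by auto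
  have fin: "emeasure lborel S < \<infinity>"
    by (intro emeasure_bounded_finite) (auto simp: S_def intro: bounded_subset[OF bounded_ball])
  have ball_lb: "emeasure lborel (ball (x::real) r) = ennreal (2*r)" if "r > 0" for x r
    using that by (simp add: ball_eq_greaterThanLessThan)
  have main: "q * measure lborel S \<le> p * (measure lborel S + e)" if "e > 0" for e
  proof -
    obtain O' where O: "open O'" "S \<subseteq> O'" "emeasure lborel (O' - S) < ennreal e"
      using outer_regular_lborel[OF S \<open>e>0\<close>] by metis
    have lo: "\<forall>x\<in>S. \<forall>k. \<exists>a<0. \<exists>b>0. b - a < 1 / real (Suc k) \<and> g (x + b) - g (x + a) < p * ((x + b) - (x + a))"
      by (auto simp: S_def oscillation_set_def)
    obtain C where C: "countable C" "pairwise (\<lambda>i j. disjnt (ball (fst i) (snd i)) (ball (fst j) (snd j))) C"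
      "\<And>i. i \<in> C \<Longrightarrow> snd i > 0 \<and> ball (fst i) (snd i) \<subseteq> O' \<and>
         g (fst i + snd i) - g (fst i - snd i) < p * ((fst i + snd i) - (fst i - snd i))"
      "negligible (S - (\<Union>i\<in>C. ball (fst i) (snd i)))"
      by (rule vitali_slope_cover[where P="\<lambda>u w. g w - g u < p * (w - u)", OF O(1,2) lo]) (rule that; assumption)
    define V where "V = (\<Union>i\<in>C. ball (fst i) (snd i))"
    have Vo: "open V" by (auto simp: V_def)
    have V[measurable]: "V \<in> sets borel" by (rule borel_open[OF Vo])
    have "V \<subseteq> O'" unfolding V_def using C(3) by (intro UN_least) blast
    have hi: "\<forall>x\<in>S \<inter> V. \<forall>k. \<exists>a<0. \<exists>b>0. b - a < 1 / real (Suc k) \<and> g (x + b) - g (x + a) > q * ((x + b) - (x + a))"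
      by (auto simp: S_def oscillation_set_def)
    obtain C' where C': "countable C'" "pairwise (\<lambda>i j. disjnt (ball (fst i) (snd i)) (ball (fst j) (snd j))) C'"
      "\<And>i. i \<in> C' \<Longrightarrow> snd i > 0 \<and> ball (fst i) (snd i) \<subseteq> V \<and>
         g (fst i + snd i) - g (fst i - snd i) > q * ((fst i + snd i) - (fst i - snd i))"
      "negligible (S \<inter> V - (\<Union>i\<in>C'. ball (fst i) (snd i)))"
      by (rule vitali_slope_cover[where P="\<lambda>u w. g w - g u > q * (w - u)", OF Vo Int_lower2 hi]) (rule that; assumption)
    define W where "W = (\<Union>i\<in>C'. ball (fst i) (snd i))"
    have W[measurable]: "W \<in> sets borel" unfolding W_def by (intro borel_open open_UN) auto
    have "W \<subseteq> V" unfolding W_def using C'(3) by (intro UN_least) blast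
    have nul: "emeasure lborel (S - W) = 0"
    proof -
      have "negligible ((S - V) \<union> (S \<inter> V - W))"
        using C(4) C'(4) by (simp add: V_def W_def)
      then have "negligible (S - W)" by (rule negligible_subset) auto
      then show ?thesis using S W by (simp add: negligible_iff_null_sets null_sets_def)
    qed
    have "ennreal q * emeasure lborel S \<le> ennreal q * (emeasure lborel W + emeasure lborel (S - W))"
    proof (intro mult_left_mono)
      have "emeasure lborel S \<le> emeasure lborel (W \<union> (S - W))" by (rule emeasure_mono) auto
      also have "\<dots> \<le> emeasure lborel W + emeasure lborel (S - W)" by (rule emeasure_subadditive) auto
      finally show "emeasure lborel S \<le> emeasure lborel W + emeasure lborel (S - W)" .
    qed auto
    also have "\<dots> = ennreal q * emeasure lborel W" using nul by simp
    also have "\<dots> \<le> emeasure \<nu> W"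
    proof -
      have "emeasure lborel W \<le> ennreal (1/q) * emeasure \<nu> W"
        unfolding W_def
      proof (rule emeasure_disjoint_balls_le[OF _ _ C'(1,2)])
        fix i assume "i \<in> C'"
        have i: "snd i > 0" "g (fst i + snd i) - g (fst i - snd i) > q * (2 * snd i)" using C'(3)[OF \<open>i \<in> C'\<close>] by simp_all
        have "2 * snd i \<le> (1/q) * (g (fst i + snd i) - g (fst i - snd i))"
          using i pq True by (simp add: field_simps)
        then show "emeasure lborel (ball (fst i) (snd i)) \<le> ennreal (1/q) * emeasure \<nu> (ball (fst i) (snd i))"
          unfolding \<nu>_def emeasure_interval_measure_ball[of g, OF mono cont i(1), simplified] ball_lb[OF i(1)]
          using pq True by (subst ennreal_mult'[symmetric]) (auto intro: ennreal_leI)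
      qed auto
      then have "ennreal q * emeasure lborel W \<le> ennreal q * (ennreal (1/q) * emeasure \<nu> W)"
        by (rule mult_left_mono) auto
      also have "\<dots> = emeasure \<nu> W" using pq True by (simp add: mult.assoc[symmetric] ennreal_mult[symmetric])
      finally show ?thesis .
    qed
    also have "\<dots> \<le> emeasure \<nu> V" by (rule emeasure_mono) (use \<open>W \<subseteq> V\<close> in auto)
    also have "\<dots> \<le> ennreal p * emeasure lborel V"
      unfolding V_def
    proof (rule emeasure_disjoint_balls_le[OF _ _ C(1,2)])
      fix i assume "i \<in> C"
      have i: "snd i > 0" "g (fst i + snd i) - g (fst i - snd i) < p * (2 * snd i)" using C(3)[OF \<open>i \<in> C\<close>] by simp_all
      then show "emeasure \<nu> (ball (fst i) (snd i)) \<le> ennreal p * emeasure lborel (ball (fst i) (snd i))"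
        unfolding \<nu>_def emeasure_interval_measure_ball[of g, OF mono cont i(1), simplified] ball_lb[OF i(1)]
        using True by (subst ennreal_mult'[symmetric]) (auto intro: ennreal_leI)
    qed auto
    also have "\<dots> \<le> ennreal p * (emeasure lborel S + ennreal e)"
    proof (intro mult_left_mono)
      have "emeasure lborel V \<le> emeasure lborel (S \<union> (O' - S))" by (rule emeasure_mono) (use \<open>V \<subseteq> O'\<close> O in auto)
      also have "\<dots> \<le> emeasure lborel S + emeasure lborel (O' - S)" by (rule emeasure_subadditive) (use O in auto)
      also have "\<dots> \<le> emeasure lborel S + ennreal e" using O(3) by (intro add_left_mono) auto
      finally show "emeasure lborel V \<le> emeasure lborel S + ennreal e" .
    qed auto
    finally have "ennreal q * emeasure lborel S \<le> ennreal p * (emeasure lborel S + ennreal e)" .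
    moreover have "emeasure lborel S = ennreal (measure lborel S)"
      using fin by (simp add: emeasure_eq_ennreal_measure)
    ultimately show ?thesis
      using True pq \<open>e>0\<close> by (simp add: ennreal_mult[symmetric] ennreal_plus[symmetric] del: ennreal_plus)
  qed
  have "measure lborel S = 0"
  proof (rule ccontr)
    assume "measure lborel S \<noteq> 0"
    then have m: "measure lborel S > 0" by (simp add: zero_less_measure_iff)
    \<comment> \<open>a choice of \<open>e\<close> for which \<open>p e\<close> is half of the gap \<open>(q - p) |S|\<close>\<close>
    have "(q - p) * measure lborel S / (2*p) > 0" using m pq True by simp
    from main[OF this] have "q * measure lborel S \<le> p * measure lborel S + (q - p) * measure lborel S / 2"
      using True by (simp add: field_simps)
    then have "(q - p) * measure lborel S \<le> 0" by (simp add: field_simps)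
    then show False using m pq by (simp add: mult_le_0_iff)
  qed
  then show ?thesis using fin unfolding S_def[symmetric] by (simp add: emeasure_eq_ennreal_measure)
qed

text \<open>Adding \<open>L x\<close> makes an \<open>L\<close>-Lipschitz function monotone and shifts all slopes by \<open>L\<close>.\<close>
lemma oscillation_set_real_null:
  fixes g :: "real \<Rightarrow> real"
  assumes L: "L-lipschitz_on UNIV g" and pq: "p < q"
  shows "oscillation_set g 1 p q \<in> null_sets lborel"
proof -
  define g' where "g' = (\<lambda>x. g x + L * x)"
  have cont: "continuous_on UNIV g" using L by (rule lipschitz_on_continuous_on)
  have cont': "continuous_on UNIV g'" unfolding g'_def by (intro continuous_intros cont)
  have mono: "g' x \<le> g' y" if "x \<le> y" for x y
  proof -
    have "\<bar>g x - g y\<bar> \<le> L * \<bar>x - y\<bar>" using lipschitz_onD[OF L, of x y] by (simp add: dist_real_def)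
    then show ?thesis using that by (auto simp: g'_def algebra_simps)
  qed
  have eq: "oscillation_set g' 1 (p + L) (q + L) = oscillation_set g 1 p q"
  proof -
    have "g' (x + b *\<^sub>R 1) - g' (x + a *\<^sub>R 1) = g (x + b *\<^sub>R 1) - g (x + a *\<^sub>R 1) + L * (b - a)" for x a b
      by (simp add: g'_def algebra_simps)
    moreover have "u + L * d < (p + L) * d \<longleftrightarrow> u < p * d" "u + L * d > (q + L) * d \<longleftrightarrow> u > q * d" for u d
      by (auto simp: algebra_simps)
    ultimately show ?thesis unfolding oscillation_set_def by simp
  qed
  have "(\<Union>n::nat. oscillation_set g 1 p q \<inter> ball 0 (real n)) \<in> null_sets lborel"
  proof (rule null_sets_UN)
    fix n :: nat
    have "emeasure lborel (oscillation_set g 1 p q \<inter> ball 0 (real n)) = 0"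
      using oscillation_set_mono_bounded[of g' "p + L" "q + L" "real n"] mono cont' pq unfolding eq by simp
    then show "oscillation_set g 1 p q \<inter> ball 0 (real n) \<in> null_sets lborel"
      using oscillation_set_borel[OF cont, of 1 p q] by (auto simp: null_sets_def)
  qed
  moreover have "(\<Union>n::nat. oscillation_set g 1 p q \<inter> ball 0 (real n)) = oscillation_set g 1 p q"
    by (auto intro: reals_Archimedean2)
  ultimately show ?thesis by simp
qed

lemma nn_integral_lborel_translate:
  fixes N :: "'a::euclidean_space set"
  assumes [measurable]: "N \<in> sets borel"
  shows "(\<integral>\<^sup>+x. indicator N (x + c) \<partial>lborel) = emeasure lborel N"
proof -
  have "emeasure lborel N = emeasure (distr lborel borel ((+) c)) N" by (simp add: lborel_distr_plus)
  also have "\<dots> = (\<integral>\<^sup>+x. indicator N x \<partial>(distr lborel borel ((+) c)))" by simp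
  also have "\<dots> = (\<integral>\<^sup>+x. indicator N (c + x) \<partial>lborel)" by (subst nn_integral_distr) auto
  finally show ?thesis by (simp add: add.commute)
qed

text \<open>Fubini's theorem along an arbitrary direction \<open>v\<close>.  Translation invariance replaces a
  change of coordinates: integrate \<open>1\<^sub>N(x + s v)\<close> over all \<open>x\<close> and over \<open>s \<in> [0, 1]\<close>.\<close>
lemma null_set_from_lines:
  fixes N :: "'a::euclidean_space set"
  assumes N[measurable]: "N \<in> sets borel"
    and lines: "\<And>x. {s. x + s *\<^sub>R v \<in> N} \<in> null_sets lborel"
  shows "N \<in> null_sets lborel"
proof -
  have [measurable]: "(\<lambda>(s, x). indicator N (x + s *\<^sub>R v) :: ennreal) \<in> borel_measurable (lborel \<Otimes>\<^sub>M lborel)"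
    by measurable
  have [measurable]: "(\<lambda>(s, x). indicator {0..1::real} s * indicator N (x + s *\<^sub>R v) :: ennreal) \<in> borel_measurable (lborel \<Otimes>\<^sub>M lborel)"
    by measurable
  have "emeasure lborel N = (\<integral>\<^sup>+s. indicator {0..1::real} s * emeasure lborel N \<partial>lborel)"
    by (simp add: nn_integral_multc)
  also have "\<dots> = (\<integral>\<^sup>+s. (\<integral>\<^sup>+x. indicator {0..1::real} s * indicator N (x + s *\<^sub>R v) \<partial>lborel) \<partial>lborel)"
    by (intro nn_integral_cong, subst nn_integral_cmult) (auto simp: nn_integral_lborel_translate[OF N])
  also have "\<dots> = (\<integral>\<^sup>+x. (\<integral>\<^sup>+s. indicator {0..1::real} s * indicator N (x + s *\<^sub>R v) \<partial>lborel) \<partial>lborel)"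
    by (rule lborel_pair.Fubini'[symmetric]) measurable
  also have "\<dots> = (\<integral>\<^sup>+(x::'a). 0 \<partial>lborel)"
  proof (intro nn_integral_cong)
    fix x :: 'a
    have "AE s in lborel. \<not> x + s *\<^sub>R v \<in> N" using AE_not_in[OF lines[of x]] by simp
    then have "AE s in lborel. (indicator {0..1::real} s * indicator N (x + s *\<^sub>R v) :: ennreal) = 0" by eventually_elim simp
    then show "(\<integral>\<^sup>+s. indicator {0..1::real} s * indicator N (x + s *\<^sub>R v) \<partial>lborel) = 0"
      by (subst nn_integral_0_iff_AE) auto
  qed
  finally show ?thesis by (auto simp: null_sets_def)
qed

lemma oscillation_set_null:
  fixes f :: "'a::euclidean_space \<Rightarrow> real"
  assumes L: "L-lipschitz_on UNIV f" and pq: "p < q"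
  shows "oscillation_set f v p q \<in> null_sets lborel"
proof (rule null_set_from_lines)
  show "oscillation_set f v p q \<in> sets borel"
    by (rule oscillation_set_borel[OF lipschitz_on_continuous_on[OF L]])
  fix x
  have "{s. x + s *\<^sub>R v \<in> oscillation_set f v p q} = oscillation_set (\<lambda>s. f (x + s *\<^sub>R v)) 1 p q"
    by (auto simp: oscillation_set_def scaleR_add_left add.assoc)
  moreover have "(L * norm v)-lipschitz_on UNIV (\<lambda>s::real. f (x + s *\<^sub>R v))"
  proof (rule lipschitz_onI)
    fix s t :: real
    have "dist (f (x + s *\<^sub>R v)) (f (x + t *\<^sub>R v)) \<le> L * dist (x + s *\<^sub>R v) (x + t *\<^sub>R v)"
      using L by (rule lipschitz_onD) auto
    also have "dist (x + s *\<^sub>R v) (x + t *\<^sub>R v) = norm v * dist s t"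
      by (simp add: dist_norm scaleR_diff_left[symmetric])
    finally show "dist (f (x + s *\<^sub>R v)) (f (x + t *\<^sub>R v)) \<le> L * norm v * dist s t" by simp
  qed (use lipschitz_on_nonneg[OF L] in auto)
  ultimately show "{s. x + s *\<^sub>R v \<in> oscillation_set f v p q} \<in> null_sets lborel"
    using oscillation_set_real_null pq by auto
qed

definition has_directional_derivative :: "('a::real_normed_vector \<Rightarrow> real) \<Rightarrow> 'a \<Rightarrow> 'a \<Rightarrow> real \<Rightarrow> bool" where
  "has_directional_derivative f v x l \<longleftrightarrow> ((\<lambda>h. (f (x + h *\<^sub>R v) - f x) / h) \<longlongrightarrow> l) (at 0)"

text \<open>A small slope of the interval between \<open>x\<close> and \<open>x + h v\<close> persists when the interval is
  enlarged a little so as to contain \<open>x\<close> in its interior.\<close>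
lemma small_slope_interval:
  fixes f :: "'a::real_normed_vector \<Rightarrow> real"
  assumes L: "L-lipschitz_on UNIV f" and h: "h \<noteq> 0" "\<bar>h\<bar> < d" and q: "(f (x + h *\<^sub>R v) - f x) / h < p"
  shows "\<exists>a<0. \<exists>b>0. b - a < d \<and> f (x + b *\<^sub>R v) - f (x + a *\<^sub>R v) < p * (b - a)"
proof -
  define B where "B = L * norm v + \<bar>p\<bar> + 1"
  have B: "B > 0" using lipschitz_on_nonneg[OF L] by (simp add: B_def add_nonneg_pos)
  have lip: "\<bar>f (x + s *\<^sub>R v) - f x\<bar> \<le> L * norm v * \<bar>s\<bar>" for s
    using lipschitz_onD[OF L, of "x + s *\<^sub>R v" x] by (simp add: dist_norm mult.assoc mult.commute[of "norm v"])
  define g where "g = (p - (f (x + h *\<^sub>R v) - f x) / h) * \<bar>h\<bar>"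
  have g: "g > 0" using q h by (simp add: g_def)
  \<comment> \<open>enlarging by \<open>e\<close> changes the two sides by less than the slack \<open>g\<close>\<close>
  define e where "e = min (g / (2 * B)) ((d - \<bar>h\<bar>) / 2)"
  have e: "e > 0" "e \<le> g / (2 * B)" "e \<le> (d - \<bar>h\<bar>) / 2" using g B h unfolding e_def by (simp, intro min.cobounded1, intro min.cobounded2)
  have eB: "e * B < g" using e(2) g B by (simp add: field_simps)
  have eB': "L * norm v * e + \<bar>p\<bar> * e < g" using eB e(1) by (simp add: B_def algebra_simps)
  have pe: "- p * e \<le> \<bar>p\<bar> * e" using e(1) by (intro mult_right_mono) auto
  show ?thesis
  proof (cases "h > 0")
    case True
    have "f (x + h *\<^sub>R v) - f (x + (-e) *\<^sub>R v) \<le> (f (x + h *\<^sub>R v) - f x) + L * norm v * e"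
      using lip[of "-e"] e(1) by simp
    also have "\<dots> = p * h - g + L * norm v * e" using True by (simp add: g_def field_simps)
    also have "\<dots> < p * (h + e)" using eB' pe by (simp add: algebra_simps)
    finally show ?thesis using e h True by (intro exI[of _ "-e"] conjI exI[of _ h]) auto
  next
    case False
    then have hn: "h < 0" using h by simp
    have "f (x + e *\<^sub>R v) - f (x + h *\<^sub>R v) \<le> - (f (x + h *\<^sub>R v) - f x) + L * norm v * e"
      using lip[of "e"] e(1) by simp
    also have "\<dots> = p * (-h) - g + L * norm v * e" using hn by (simp add: g_def field_simps)
    also have "\<dots> < p * (e - h)" using eB' pe by (simp add: algebra_simps)
    finally show ?thesis using e h hn by (intro exI[of _ "h"] conjI exI[of _ e]) auto
  qed
qed

text \<open>If the lower and upper limits of the difference quotient differed, two rational numbers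
  between them would put \<open>x\<close> into an oscillation set.\<close>
lemma has_directional_derivative_off_oscillation:
  fixes f :: "'a::real_normed_vector \<Rightarrow> real"
  assumes L: "L-lipschitz_on UNIV f"
    and off: "\<And>p q. p \<in> \<rat> \<Longrightarrow> q \<in> \<rat> \<Longrightarrow> p < q \<Longrightarrow> x \<notin> oscillation_set f v p q"
  shows "\<exists>l. has_directional_derivative f v x l"
proof -
  define Q where "Q = (\<lambda>h. (f (x + h *\<^sub>R v) - f x) / h)"
  have L0: "L * norm v \<ge> 0" using lipschitz_on_nonneg[OF L] by simp
  have bd: "\<bar>Q h\<bar> \<le> L * norm v" for h
    using lipschitz_onD[OF L, of "x + h *\<^sub>R v" x] L0
    by (cases "h = 0") (auto simp: Q_def dist_norm field_simps)
  let ?lo = "Liminf (at 0) (\<lambda>h. ereal (Q h))" and ?hi = "Limsup (at 0) (\<lambda>h. ereal (Q h))"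
  have le: "?lo \<le> ?hi" by (rule Liminf_le_Limsup) simp
  have "\<not> ?lo < ?hi"
  proof
    assume "?lo < ?hi"
    then obtain p where p: "?lo < ereal (real_of_rat p)" "ereal (real_of_rat p) < ?hi" using ereal_dense3 by blast
    then obtain q where q: "ereal (real_of_rat p) < ereal (real_of_rat q)" "ereal (real_of_rat q) < ?hi" using ereal_dense3 by blast
    have small: "\<exists>h. h \<noteq> 0 \<and> \<bar>h\<bar> < d \<and> Q h < real_of_rat p" if "d > 0" for d
    proof (rule ccontr)
      assume "\<not> ?thesis"
      then have "\<forall>\<^sub>F h in at 0. ereal (real_of_rat p) \<le> ereal (Q h)"
        unfolding eventually_at using \<open>d>0\<close> by (intro exI[of _ d]) (auto simp: dist_real_def not_less)
      then have "ereal (real_of_rat p) \<le> ?lo" by (rule Liminf_bounded)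
      then show False using p by simp
    qed
    have large: "\<exists>h. h \<noteq> 0 \<and> \<bar>h\<bar> < d \<and> Q h > real_of_rat q" if "d > 0" for d
    proof (rule ccontr)
      assume "\<not> ?thesis"
      then have "\<forall>\<^sub>F h in at 0. ereal (real_of_rat q) \<ge> ereal (Q h)"
        unfolding eventually_at using \<open>d>0\<close> by (intro exI[of _ d]) (auto simp: dist_real_def not_less)
      then have "ereal (real_of_rat q) \<ge> ?hi" by (rule Limsup_bounded)
      then show False using q by simp
    qed
    have "\<exists>a<0. \<exists>b>0. b - a < 1 / real (Suc k) \<and> f (x + b *\<^sub>R v) - f (x + a *\<^sub>R v) < real_of_rat p * (b - a)" for k
    proof -
      have "1 / real (Suc k) > 0" by simp
      from small[OF this] obtain h where "h \<noteq> 0" "\<bar>h\<bar> < 1 / real (Suc k)" "Q h < real_of_rat p" by blast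
      then show ?thesis by (intro small_slope_interval[OF L]) (auto simp: Q_def)
    qed
    moreover have "\<exists>a<0. \<exists>b>0. b - a < 1 / real (Suc k) \<and> f (x + b *\<^sub>R v) - f (x + a *\<^sub>R v) > real_of_rat q * (b - a)" for k
    proof -
      have "1 / real (Suc k) > 0" by simp
      from large[OF this] obtain h where h: "h \<noteq> 0" "\<bar>h\<bar> < 1 / real (Suc k)" "Q h > real_of_rat q" by blast
      have L': "L-lipschitz_on UNIV (\<lambda>x. - f x)" using L by simp
      have "(- f (x + h *\<^sub>R v) - - f x) / h = - Q h" by (simp add: Q_def minus_divide_left)
      then have "(- f (x + h *\<^sub>R v) - - f x) / h < - real_of_rat q" using h by simp
      from small_slope_interval[OF L' h(1,2) this] obtain a b where
         "a < 0" "b > 0" "b - a < 1 / real (Suc k)" "- f (x + b *\<^sub>R v) - - f (x + a *\<^sub>R v) < - real_of_rat q * (b - a)" by blast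
      then show ?thesis by (intro exI[of _ a] conjI exI[of _ b]) auto
    qed
    ultimately have "x \<in> oscillation_set f v (real_of_rat p) (real_of_rat q)" by (simp add: oscillation_set_def)
    then show False using off[of "real_of_rat p" "real_of_rat q"] q by simp
  qed
  then have eq: "?hi = ?lo" using le by simp
  then have lim: "((\<lambda>h. ereal (Q h)) \<longlongrightarrow> ?lo) (at 0)" by (intro tendsto_Liminf) auto
  have "ereal (- (L * norm v)) \<le> ?lo" by (rule Liminf_bounded) (use bd in \<open>auto simp: abs_le_iff minus_le_iff\<close>)
  moreover have "?lo \<le> ereal (L * norm v)" unfolding eq[symmetric] by (rule Limsup_bounded) (use bd in \<open>auto simp: abs_le_iff\<close>)
  ultimately obtain l where "?lo = ereal l" by (cases ?lo) auto
  then have "(Q \<longlongrightarrow> l) (at 0)" using lim by simp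
  then show ?thesis unfolding has_directional_derivative_def Q_def by blast
qed

lemma AE_has_directional_derivative:
  fixes f :: "'a::euclidean_space \<Rightarrow> real"
  assumes L: "L-lipschitz_on UNIV f"
  shows "AE x in lborel. \<exists>l. has_directional_derivative f v x l"
proof -
  define N where "N = (\<Union>(p,q)\<in>{(p,q). p \<in> \<rat> \<and> q \<in> \<rat> \<and> p < q}. oscillation_set f v p q)"
  have "countable {(p,q). p \<in> \<rat> \<and> q \<in> \<rat> \<and> p < (q::real)}"
    by (rule countable_subset[of _ "\<rat> \<times> \<rat>"]) (auto intro: countable_SIGMA countable_rat)
  then have N: "N \<in> null_sets lborel" unfolding N_def
    by (rule null_sets_UN') (auto intro: oscillation_set_null[OF L])
  show ?thesis
  proof (rule AE_I'[OF N], rule subsetI, rule ccontr)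
    fix x assume x: "x \<in> {x \<in> space lborel. \<not> (\<exists>l. has_directional_derivative f v x l)}" "x \<notin> N"
    have "x \<notin> oscillation_set f v p q" if "p \<in> \<rat>" "q \<in> \<rat>" "p < q" for p q
      using x(2) that unfolding N_def by blast
    then show False using has_directional_derivative_off_oscillation[OF L, of x v] x(1) by blast
  qed
qed

section \<open>Linearity of the directional derivative almost everywhere\<close>

text \<open>If \<open>g > 0\<close> on a set of positive measure, then also on a compact set of positive measure, and
  continuous functions decreasing to the indicator of that set contradict the hypothesis.\<close>
lemma AE_nonpos_from_continuous_tests:
  fixes g :: "'a::euclidean_space \<Rightarrow> real"
  assumes g[measurable]: "g \<in> borel_measurable borel" and B: "\<And>x. \<bar>g x\<bar> \<le> B"
    and test: "\<And>\<phi> R. continuous_on UNIV \<phi> \<Longrightarrow> (\<And>x. \<phi> x \<in> {0..1}) \<Longrightarrow> (\<And>x. norm x \<ge> R \<Longrightarrow> \<phi> x = 0)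
      \<Longrightarrow> (\<integral>x. \<phi> x * g x \<partial>lborel) = 0"
  shows "AE x in lborel. g x \<le> 0"
proof -
  have "{x. g x > 0} \<inter> ball 0 (real n) \<in> null_sets lborel" for n :: nat
  proof (rule ccontr)
    define E where "E = {x. g x > 0} \<inter> ball 0 (real n)"
    have E[measurable]: "E \<in> sets borel" unfolding E_def by measurable
    assume "{x. g x > 0} \<inter> ball 0 (real n) \<notin> null_sets lborel"
    then have pos: "emeasure lborel E \<noteq> 0" using E by (auto simp: null_sets_def E_def)
    have fin: "emeasure lborel E < \<infinity>"
      by (intro emeasure_bounded_finite) (auto simp: E_def intro: bounded_subset[OF bounded_ball])
    have m: "measure lborel E > 0" using pos fin by (simp add: measure_def enn2real_positive_iff zero_less_iff_neq_zero)
    have El: "E \<in> sets lebesgue" by (simp add: sets_completionI_sets)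
    have bf: "emeasure lborel (ball (0::'a) r) < \<infinity>" for r by (rule emeasure_bounded_finite) simp
    obtain T where T: "closed T" "T \<subseteq> E" "emeasure lebesgue (E - T) < ennreal (measure lborel E)"
      using sets_lebesgue_inner_closed[OF El m] by metis
    have Tb[measurable]: "T \<in> sets borel" using T by auto
    have "emeasure lborel T \<noteq> 0"
    proof
      assume "emeasure lborel T = 0"
      then have "emeasure lborel (E - T) = emeasure lborel E" by (subst emeasure_Diff_null_set) (auto simp: null_sets_def)
      moreover have "emeasure lebesgue (E - T) = emeasure lborel (E - T)" by (simp add: emeasure_completion)
      ultimately show False using T(3) fin by (simp add: emeasure_eq_ennreal_measure)
    qed
    then have ne: "T \<noteq> {}" by auto
    have Tn: "T \<subseteq> ball 0 (real n)" using T by (auto simp: E_def)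
    define \<phi> where "\<phi> = (\<lambda>m x. max 0 (1 - real (Suc m) * infdist x T))"
    have \<phi>c: "continuous_on UNIV (\<phi> m)" for m unfolding \<phi>_def by (intro continuous_intros)
    have [measurable]: "\<phi> m \<in> borel_measurable borel" for m using \<phi>c by (rule borel_measurable_continuous_onI)
    have \<phi>1: "\<phi> m x \<in> {0..1}" for m x by (auto simp: \<phi>_def infdist_nonneg)
    have \<phi>0: "\<phi> m x = 0" if "norm x \<ge> real n + 1" for m x
    proof -
      obtain y where y: "y \<in> T" "infdist x T = dist x y" using infdist_attains_inf[OF T(1) ne] by blast
      have "norm y < real n" using y Tn by auto
      then have "1 \<le> infdist x T" using that norm_triangle_ineq2[of x y] unfolding y(2) dist_norm by linarith
      then have "1 \<le> real (Suc m) * infdist x T" using mult_mono[of 1 "real (Suc m)" 1 "infdist x T"] by simp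
      then show ?thesis by (simp add: \<phi>_def)
    qed
    have z: "(\<integral>x. \<phi> m x * g x \<partial>lborel) = 0" for m
      by (rule test[OF \<phi>c \<phi>1, where R="real n + 1"]) (use \<phi>0 in auto)
    have "(\<lambda>m. \<integral>x. \<phi> m x * g x \<partial>lborel) \<longlonglongrightarrow> (\<integral>x. indicator T x * g x \<partial>lborel)"
    proof (rule integral_dominated_convergence[where w="\<lambda>x. B * indicator (ball 0 (real n + 1)) x"])
      show "integrable lborel (\<lambda>x. B * indicator (ball 0 (real n + 1)) (x::'a))"
        by (intro integrable_mult_right integrable_real_indicator bf) auto
      show "AE x in lborel. (\<lambda>m. \<phi> m x * g x) \<longlonglongrightarrow> indicator T x * g x"
      proof (rule AE_I2, rule tendsto_mult_right)
        fix x
        show "(\<lambda>m. \<phi> m x) \<longlonglongrightarrow> indicator T x"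
        proof (cases "x \<in> T")
          case True
          then show ?thesis by (simp add: \<phi>_def)
        next
          case False
          then have "infdist x T > 0" using T(1) ne by (simp add: infdist_pos_not_in_closed)
          then obtain k where k: "1 / infdist x T < real k" using reals_Archimedean2 by blast
          have "\<phi> m x = 0" if "m \<ge> k" for m
          proof -
            have "1 / infdist x T \<le> real (Suc m)" using k that by linarith
            then show ?thesis using \<open>infdist x T > 0\<close> by (simp add: \<phi>_def field_simps)
          qed
          then have "\<forall>\<^sub>F m in sequentially. \<phi> m x = 0" using eventually_sequentially by blast
          then show ?thesis using False by (simp add: tendsto_eventually)
        qed
      qed
      show "AE x in lborel. norm (\<phi> m x * g x) \<le> B * indicator (ball 0 (real n + 1)) x" for m
      proof (rule AE_I2)
        fix x
        have "\<bar>\<phi> m x\<bar> * \<bar>g x\<bar> \<le> 1 * B" using \<phi>1[of m x] B[of x] by (intro mult_mono) auto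
        then show "norm (\<phi> m x * g x) \<le> B * indicator (ball 0 (real n + 1)) x"
          using \<phi>0[of x m] by (cases "norm x < real n + 1") (auto simp: abs_mult)
      qed
    qed auto
    then have zero: "(\<integral>x. indicator T x * g x \<partial>lborel) = 0" unfolding z by (simp add: LIMSEQ_const_iff)
    have int: "integrable lborel (\<lambda>x. indicator T x * g x)"
    proof (rule Bochner_Integration.integrable_bound[where f="\<lambda>x. B * indicator (ball 0 (real n)) x"])
      show "integrable lborel (\<lambda>x. B * indicator (ball 0 (real n)) (x::'a))"
        by (intro integrable_mult_right integrable_real_indicator bf) auto
      show "AE x in lborel. norm (indicator T x * g x) \<le> norm (B * indicator (ball 0 (real n)) x)"
      proof (rule AE_I2)
        fix x show "norm (indicator T x * g x) \<le> norm (B * indicator (ball 0 (real n)) x)"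
          using B[of x] Tn by (cases "x \<in> T") auto
      qed
    qed auto
    have "AE x in lborel. 0 \<le> indicator T x * g x"
    proof (rule AE_I2)
      fix x show "0 \<le> indicator T x * g x" using T(2) by (cases "x \<in> T") (auto simp: E_def)
    qed
    then have "AE x in lborel. indicator T x * g x = 0"
      using integral_nonneg_eq_0_iff_AE[OF int] zero by blast
    then have "AE x in lborel. x \<notin> T"
      by eventually_elim (use T(2) in \<open>auto simp: E_def split: split_indicator_asm\<close>)
    then have "emeasure lborel T = 0" using AE_iff_measurable[of T lborel "\<lambda>x. x \<notin> T"] by simp
    then show False using \<open>emeasure lborel T \<noteq> 0\<close> by simp
  qed
  then have "(\<Union>n::nat. {x. g x > 0} \<inter> ball 0 (real n)) \<in> null_sets lborel" by (rule null_sets_UN)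
  then show ?thesis
    by (rule AE_I') (auto intro: reals_Archimedean2 simp: not_le)
qed

text \<open>Difference quotients along the sequence \<open>1 / (n + 1)\<close>; a sequence keeps the limit measurable.\<close>
definition forward_quotient :: "('a::real_normed_vector \<Rightarrow> real) \<Rightarrow> 'a \<Rightarrow> nat \<Rightarrow> 'a \<Rightarrow> real" where
  "forward_quotient f v n x = real (Suc n) * (f (x + (1 / real (Suc n)) *\<^sub>R v) - f x)"

definition directional_derivative :: "('a::real_normed_vector \<Rightarrow> real) \<Rightarrow> 'a \<Rightarrow> 'a \<Rightarrow> real" where
  "directional_derivative f v x = lim (\<lambda>n. forward_quotient f v n x)"

lemma forward_quotient_tendsto:
  assumes "has_directional_derivative f v x l"
  shows "(\<lambda>n. forward_quotient f v n x) \<longlonglongrightarrow> l"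
proof -
  have "filterlim (\<lambda>n. 1 / real (Suc n)) (at 0) sequentially"
    unfolding filterlim_at using LIMSEQ_inverse_real_of_nat by (auto simp: inverse_eq_divide)
  then have "(\<lambda>n. (f (x + (1 / real (Suc n)) *\<^sub>R v) - f x) / (1 / real (Suc n))) \<longlonglongrightarrow> l"
    using assms unfolding has_directional_derivative_def by (rule filterlim_compose[rotated])
  then show ?thesis by (simp add: forward_quotient_def mult.commute)
qed

lemma has_directional_derivative_eq:
  assumes "has_directional_derivative f v x l"
  shows "directional_derivative f v x = l"
  unfolding directional_derivative_def using forward_quotient_tendsto[OF assms] by (rule limI)

lemma AE_directional_derivative:
  fixes f :: "'a::euclidean_space \<Rightarrow> real"
  assumes L: "L-lipschitz_on UNIV f"
  shows "AE x in lborel. has_directional_derivative f v x (directional_derivative f v x)"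
  using AE_has_directional_derivative[OF L, of v]
  by eventually_elim (use has_directional_derivative_eq in blast)

lemma forward_quotient_bound:
  assumes L: "L-lipschitz_on UNIV f"
  shows "\<bar>forward_quotient f v n x\<bar> \<le> L * norm v"
proof -
  have "\<bar>f (x + (1 / real (Suc n)) *\<^sub>R v) - f x\<bar> \<le> L * (norm v / real (Suc n))"
    using lipschitz_onD[OF L, of "x + (1 / real (Suc n)) *\<^sub>R v" x] by (simp add: dist_norm)
  then show ?thesis unfolding forward_quotient_def abs_mult by (simp add: field_simps del: of_nat_Suc)
qed

lemma forward_quotient_measurable[measurable]:
  fixes f :: "'a::euclidean_space \<Rightarrow> real"
  assumes "continuous_on UNIV f"
  shows "forward_quotient f v n \<in> borel_measurable borel"
proof (rule borel_measurable_continuous_onI)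
  show "continuous_on UNIV (forward_quotient f v n)"
    unfolding forward_quotient_def
    by (intro continuous_intros assms continuous_on_compose2[OF assms]) auto
qed

lemma directional_derivative_measurable:
  fixes f :: "'a::euclidean_space \<Rightarrow> real"
  assumes "continuous_on UNIV f"
  shows "directional_derivative f v \<in> borel_measurable borel"
  unfolding directional_derivative_def using forward_quotient_measurable[OF assms] by (intro borel_measurable_lim_metric) auto

lemma lborel_integral_translate:
  fixes h :: "'a::euclidean_space \<Rightarrow> real"
  assumes [measurable]: "h \<in> borel_measurable borel"
  shows "(\<integral>x. h (x + c) \<partial>lborel) = (\<integral>x. h x \<partial>lborel)"
proof -
  have "(\<integral>x. h x \<partial>lborel) = (\<integral>x. h x \<partial>(distr lborel borel ((+) c)))" by (simp add: lborel_distr_plus)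
  also have "\<dots> = (\<integral>x. h (c + x) \<partial>lborel)" by (rule integral_distr) auto
  finally show ?thesis by (simp add: add.commute)
qed

lemma integrable_test_mult:
  fixes g :: "'a::euclidean_space \<Rightarrow> real"
  assumes [measurable]: "g \<in> borel_measurable borel" and B: "\<And>x. \<bar>g x\<bar> \<le> B" and \<phi>c: "continuous_on UNIV \<phi>"
    and \<phi>1: "\<And>x. \<phi> x \<in> {0..1::real}" and \<phi>0: "\<And>x. norm x \<ge> R \<Longrightarrow> \<phi> x = 0"
  shows "integrable lborel (\<lambda>x. \<phi> x * g x)"
proof (rule Bochner_Integration.integrable_bound[where f="\<lambda>x. B * indicator (ball 0 R) x"])
  have [measurable]: "\<phi> \<in> borel_measurable borel" using \<phi>c by (rule borel_measurable_continuous_onI)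
  have bf: "emeasure lborel (ball (0::'a) R) < \<infinity>" by (rule emeasure_bounded_finite) simp
  show "integrable lborel (\<lambda>x. B * indicator (ball 0 R) (x::'a))"
    by (intro integrable_mult_right integrable_real_indicator bf) auto
  show "AE x in lborel. norm (\<phi> x * g x) \<le> norm (B * indicator (ball 0 R) x)"
  proof (rule AE_I2)
    fix x
    have "\<bar>\<phi> x\<bar> * \<bar>g x\<bar> \<le> 1 * B" using \<phi>1[of x] B[of x] by (intro mult_mono) auto
    then show "norm (\<phi> x * g x) \<le> norm (B * indicator (ball 0 R) x)"
      using \<phi>0[of x] by (cases "norm x < R") (auto simp: abs_mult)
  qed
  show "(\<lambda>x. \<phi> x * g x) \<in> borel_measurable lborel" by measurable
qed

lemma directional_derivative_bound:
  assumes L: "L-lipschitz_on UNIV f" and "has_directional_derivative f v x l"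
  shows "\<bar>l\<bar> \<le> L * norm v"
proof (rule LIMSEQ_le_const2)
  show "(\<lambda>n. \<bar>forward_quotient f v n x\<bar>) \<longlonglongrightarrow> \<bar>l\<bar>"
    using forward_quotient_tendsto[OF assms(2)] by (rule tendsto_rabs)
  show "\<exists>N. \<forall>n\<ge>N. \<bar>forward_quotient f v n x\<bar> \<le> L * norm v" using forward_quotient_bound[OF L] by blast
qed

text \<open>The quotients may be evaluated at a point that moves to \<open>x\<close>: a substitution shifts the
  displacement to the continuous function \<open>\<phi>\<close>, and dominated convergence applies.\<close>
lemma test_integral_forward_quotient:
  fixes f :: "'a::euclidean_space \<Rightarrow> real"
  assumes L: "L-lipschitz_on UNIV f" and \<phi>c: "continuous_on UNIV \<phi>"
    and \<phi>1: "\<And>x. \<phi> x \<in> {0..1::real}" and \<phi>0: "\<And>x. norm x \<ge> R \<Longrightarrow> \<phi> x = 0"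
  shows "(\<lambda>n. \<integral>x. \<phi> x * forward_quotient f v n (x + (1 / real (Suc n)) *\<^sub>R w) \<partial>lborel)
      \<longlonglongrightarrow> (\<integral>x. \<phi> x * directional_derivative f v x \<partial>lborel)"
proof -
  note fc = lipschitz_on_continuous_on[OF L]
  have [measurable]: "\<phi> \<in> borel_measurable borel" using \<phi>c by (rule borel_measurable_continuous_onI)
  note [measurable] = directional_derivative_measurable[OF fc, of v] forward_quotient_measurable[OF fc, of v]
  define t where "t = (\<lambda>n. 1 / real (Suc n))"
  have t: "0 < t n" "t n \<le> 1" for n by (auto simp: t_def)
  have tl: "t \<longlonglongrightarrow> 0" unfolding t_def using LIMSEQ_inverse_real_of_nat by (simp add: inverse_eq_divide)
  have eq: "(\<integral>x. \<phi> x * forward_quotient f v n (x + t n *\<^sub>R w) \<partial>lborel)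
     = (\<integral>x. \<phi> (x - t n *\<^sub>R w) * forward_quotient f v n x \<partial>lborel)" for n
    using lborel_integral_translate[of "\<lambda>x. \<phi> (x - t n *\<^sub>R w) * forward_quotient f v n x" "t n *\<^sub>R w"] by simp
  have bf: "emeasure lborel (ball (0::'a) r) < \<infinity>" for r by (rule emeasure_bounded_finite) simp
  have "(\<lambda>n. \<integral>x. \<phi> (x - t n *\<^sub>R w) * forward_quotient f v n x \<partial>lborel)
      \<longlonglongrightarrow> (\<integral>x. \<phi> x * directional_derivative f v x \<partial>lborel)"
  proof (rule integral_dominated_convergence[where w="\<lambda>x. (L * norm v) * indicator (ball 0 (R + norm w)) x"])
    show "integrable lborel (\<lambda>x. (L * norm v) * indicator (ball 0 (R + norm w)) (x::'a))"
      by (intro integrable_mult_right integrable_real_indicator bf) auto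
    show "AE x in lborel. (\<lambda>n. \<phi> (x - t n *\<^sub>R w) * forward_quotient f v n x) \<longlonglongrightarrow> \<phi> x * directional_derivative f v x"
      using AE_directional_derivative[OF L, of v]
    proof eventually_elim
      fix x assume "has_directional_derivative f v x (directional_derivative f v x)"
      then have "(\<lambda>n. forward_quotient f v n x) \<longlonglongrightarrow> directional_derivative f v x" by (rule forward_quotient_tendsto)
      moreover have "(\<lambda>n. \<phi> (x - t n *\<^sub>R w)) \<longlonglongrightarrow> \<phi> x"
      proof (rule continuous_on_tendsto_compose[OF \<phi>c])
        have "(\<lambda>n. x - t n *\<^sub>R w) \<longlonglongrightarrow> x - 0 *\<^sub>R w" by (intro tendsto_intros tl)
        then show "(\<lambda>n. x - t n *\<^sub>R w) \<longlonglongrightarrow> x" by simp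
      qed auto
      ultimately show "(\<lambda>n. \<phi> (x - t n *\<^sub>R w) * forward_quotient f v n x) \<longlonglongrightarrow> \<phi> x * directional_derivative f v x"
        by (rule tendsto_mult[rotated])
    qed
    show "AE x in lborel. norm (\<phi> (x - t n *\<^sub>R w) * forward_quotient f v n x) \<le> (L * norm v) * indicator (ball 0 (R + norm w)) x" for n
    proof (rule AE_I2)
      fix x
      have "\<bar>\<phi> (x - t n *\<^sub>R w)\<bar> * \<bar>forward_quotient f v n x\<bar> \<le> 1 * (L * norm v)"
        using \<phi>1[of "x - t n *\<^sub>R w"] forward_quotient_bound[OF L] by (intro mult_mono) auto
      moreover have "\<phi> (x - t n *\<^sub>R w) = 0" if "\<not> norm x < R + norm w"
      proof (rule \<phi>0)
        have "norm (t n *\<^sub>R w) \<le> norm w" using t[of n] by (simp add: mult_left_le_one_le)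
        then show "R \<le> norm (x - t n *\<^sub>R w)" using that norm_triangle_ineq2[of x "t n *\<^sub>R w"] by linarith
      qed
      ultimately show "norm (\<phi> (x - t n *\<^sub>R w) * forward_quotient f v n x) \<le> (L * norm v) * indicator (ball 0 (R + norm w)) x"
        by (cases "norm x < R + norm w") (auto simp: abs_mult)
    qed
  qed measurable
  then show ?thesis unfolding eq[symmetric] unfolding t_def .
qed

text \<open>The quotient in direction \<open>v + w\<close> at \<open>x\<close> is the sum of the quotient in direction \<open>v\<close> at \<open>x\<close> and
  the one in direction \<open>w\<close> at the shifted point \<open>x + v / (n + 1)\<close>.\<close>
lemma test_integral_additive:
  fixes f :: "'a::euclidean_space \<Rightarrow> real"
  assumes L: "L-lipschitz_on UNIV f" and \<phi>c: "continuous_on UNIV \<phi>"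
    and \<phi>1: "\<And>x. \<phi> x \<in> {0..1::real}" and \<phi>0: "\<And>x. norm x \<ge> R \<Longrightarrow> \<phi> x = 0"
  shows "(\<integral>x. \<phi> x * directional_derivative f (v + w) x \<partial>lborel)
     = (\<integral>x. \<phi> x * directional_derivative f v x \<partial>lborel) + (\<integral>x. \<phi> x * directional_derivative f w x \<partial>lborel)"
proof -
  note fc = lipschitz_on_continuous_on[OF L]
  note [measurable] = forward_quotient_measurable[OF fc]
  have split: "forward_quotient f (v + w) n x
     = forward_quotient f v n x + forward_quotient f w n (x + (1 / real (Suc n)) *\<^sub>R v)" for n x
    by (simp add: forward_quotient_def scaleR_add_right add.assoc right_diff_distrib)
  have int: "integrable lborel (\<lambda>x. \<phi> x * forward_quotient f u n (x + c))" for u n c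
    by (rule integrable_test_mult[where B="L * norm u" and R=R]) (use forward_quotient_bound[OF L] \<phi>c \<phi>1 \<phi>0 in auto)
  have "(\<integral>x. \<phi> x * forward_quotient f (v + w) n x \<partial>lborel)
     = (\<integral>x. \<phi> x * forward_quotient f v n x \<partial>lborel)
       + (\<integral>x. \<phi> x * forward_quotient f w n (x + (1 / real (Suc n)) *\<^sub>R v) \<partial>lborel)" for n
    unfolding split distrib_left using int[of v n 0] int[of w n]
    by (intro Bochner_Integration.integral_add) auto
  moreover have "(\<lambda>n. (\<integral>x. \<phi> x * forward_quotient f v n x \<partial>lborel)
       + (\<integral>x. \<phi> x * forward_quotient f w n (x + (1 / real (Suc n)) *\<^sub>R v) \<partial>lborel))
     \<longlonglongrightarrow> (\<integral>x. \<phi> x * directional_derivative f v x \<partial>lborel) + (\<integral>x. \<phi> x * directional_derivative f w x \<partial>lborel)"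
    using test_integral_forward_quotient[OF L \<phi>c \<phi>1 \<phi>0, where v=v and w=0]
      test_integral_forward_quotient[OF L \<phi>c \<phi>1 \<phi>0, where v=w and w=v]
    by (intro tendsto_add) auto
  moreover have "(\<lambda>n. \<integral>x. \<phi> x * forward_quotient f (v + w) n x \<partial>lborel)
     \<longlonglongrightarrow> (\<integral>x. \<phi> x * directional_derivative f (v + w) x \<partial>lborel)"
    using test_integral_forward_quotient[OF L \<phi>c \<phi>1 \<phi>0, where v="v+w" and w=0] by simp
  ultimately show ?thesis using LIMSEQ_unique by simp
qed

text \<open>The difference of the two sides integrates to zero against all continuous test functions.
  Truncation by the Lipschitz bound makes the derivatives bounded everywhere without changing
  them almost everywhere.\<close>
lemma AE_has_directional_derivative_add:
  fixes f :: "'a::euclidean_space \<Rightarrow> real"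
  assumes L: "L-lipschitz_on UNIV f"
  shows "AE x in lborel. \<forall>l m. has_directional_derivative f v x l \<longrightarrow> has_directional_derivative f w x m
     \<longrightarrow> has_directional_derivative f (v + w) x (l + m)"
proof -
  note fc = lipschitz_on_continuous_on[OF L]
  note [measurable] = directional_derivative_measurable[OF fc]
  define D where "D = (\<lambda>u x. max (- (L * norm u)) (min (L * norm u) (directional_derivative f u x)))"
  have Dm[measurable]: "D u \<in> borel_measurable borel" for u unfolding D_def by measurable
  have LN: "L * norm (u::'a) \<ge> 0" for u using lipschitz_on_nonneg[OF L] by simp
  have Db: "\<bar>D u x\<bar> \<le> L * norm u" for u x using LN[of u] by (auto simp: D_def)
  have DAE: "AE x in lborel. D u x = directional_derivative f u x" for u
    using AE_directional_derivative[OF L, of u]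
  proof eventually_elim
    fix x assume "has_directional_derivative f u x (directional_derivative f u x)"
    from directional_derivative_bound[OF L this] show "D u x = directional_derivative f u x" by (auto simp: D_def)
  qed
  define g where "g = (\<lambda>x. D (v + w) x - D v x - D w x)"
  have gm[measurable]: "g \<in> borel_measurable borel" unfolding g_def by measurable
  have gb: "\<bar>g x\<bar> \<le> L * norm (v + w) + L * norm v + L * norm w" for x
    using Db[of "v+w" x] Db[of v x] Db[of w x] by (simp add: g_def)
  have gint: "(\<integral>x. \<phi> x * g x \<partial>lborel) = 0"
    if \<phi>: "continuous_on UNIV \<phi>" "\<And>x. \<phi> x \<in> {0..1}" "\<And>x. norm x \<ge> R \<Longrightarrow> \<phi> x = 0" for \<phi> R
  proof -
    have [measurable]: "\<phi> \<in> borel_measurable borel" using \<phi>(1) by (rule borel_measurable_continuous_onI)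
    have i: "integrable lborel (\<lambda>x. \<phi> x * D u x)" for u
      by (rule integrable_test_mult[OF Dm Db \<phi>]) auto
    have e: "(\<integral>x. \<phi> x * D u x \<partial>lborel) = (\<integral>x. \<phi> x * directional_derivative f u x \<partial>lborel)" for u
      by (rule integral_cong_AE) (use DAE[of u] in auto)
    have "(\<integral>x. \<phi> x * g x \<partial>lborel) = (\<integral>x. \<phi> x * D (v + w) x - \<phi> x * D v x - \<phi> x * D w x \<partial>lborel)"
      by (simp add: g_def algebra_simps)
    also have "\<dots> = (\<integral>x. \<phi> x * D (v + w) x \<partial>lborel) - (\<integral>x. \<phi> x * D v x \<partial>lborel) - (\<integral>x. \<phi> x * D w x \<partial>lborel)"
      using i by simp
    also have "\<dots> = 0" unfolding e using test_integral_additive[OF L \<phi>, where v=v and w=w] by simp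
    finally show ?thesis .
  qed
  have "AE x in lborel. g x \<le> 0" by (rule AE_nonpos_from_continuous_tests[OF gm gb gint])
  moreover have "AE x in lborel. - g x \<le> 0"
  proof (rule AE_nonpos_from_continuous_tests[where B="L * norm (v + w) + L * norm v + L * norm w"])
    show "\<bar>- g x\<bar> \<le> L * norm (v + w) + L * norm v + L * norm w" for x using gb[of x] by simp
    show "(\<integral>x. \<phi> x * - g x \<partial>lborel) = 0"
      if "continuous_on UNIV \<phi>" "\<And>x. \<phi> x \<in> {0..1}" "\<And>x. norm x \<ge> R \<Longrightarrow> \<phi> x = 0" for \<phi> R
      using gint[OF that] by simp
  qed measurable
  ultimately show ?thesis
    using DAE[of v] DAE[of w] DAE[of "v+w"] AE_directional_derivative[OF L, of "v+w"]
  proof eventually_elim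
    case (elim x)
    have "directional_derivative f (v + w) x = directional_derivative f v x + directional_derivative f w x"
      using elim by (simp add: g_def)
    then show ?case using elim(6) has_directional_derivative_eq by metis
  qed
qed

lemma has_directional_derivative_scale:
  assumes "has_directional_derivative f v x l"
  shows "has_directional_derivative f (c *\<^sub>R v) x (c * l)"
proof (cases "c = 0")
  case True
  then show ?thesis by (simp add: has_directional_derivative_def)
next
  case False
  have "filterlim (\<lambda>h. h * c) (at 0) (at (0::real))"
    unfolding filterlim_at using False
    by (auto simp: eventually_at intro!: tendsto_eq_intros exI[of _ 1])
  then have "((\<lambda>h. (f (x + (h * c) *\<^sub>R v) - f x) / (h * c)) \<longlongrightarrow> l) (at 0)"
    using assms unfolding has_directional_derivative_def by (rule filterlim_compose[rotated])
  then have "((\<lambda>h. c * ((f (x + (h * c) *\<^sub>R v) - f x) / (h * c))) \<longlongrightarrow> c * l) (at 0)" by (rule tendsto_mult_left)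
  then show ?thesis using False by (simp add: has_directional_derivative_def)
qed

text \<open>For a Lipschitz function the difference quotients depend on the direction in a Lipschitz
  way, uniformly in \<open>h\<close>; hence derivatives in a dense set of directions suffice.\<close>
lemma has_directional_derivative_approx:
  fixes f :: "'a::real_normed_vector \<Rightarrow> real"
  assumes L: "L-lipschitz_on UNIV f"
    and app: "\<And>e. e > 0 \<Longrightarrow> \<exists>w m. norm (v - w) < e \<and> \<bar>l - m\<bar> < e \<and> has_directional_derivative f w x m"
  shows "has_directional_derivative f v x l"
  unfolding has_directional_derivative_def
proof (rule tendstoI)
  fix e :: real assume "e > 0"
  define d where "d = e / (L + 2)"
  have L0: "L \<ge> 0" using lipschitz_on_nonneg[OF L] .
  have d: "d > 0" "(L + 2) * d = e" using \<open>e > 0\<close> L0 by (auto simp: d_def)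
  obtain w m where w: "norm (v - w) < d" "\<bar>l - m\<bar> < d" "has_directional_derivative f w x m" using app[OF d(1)] by blast
  have "\<forall>\<^sub>F h in at 0. dist ((f (x + h *\<^sub>R w) - f x) / h) m < d"
    using w(3) d(1) unfolding has_directional_derivative_def by (rule tendstoD)
  moreover have "\<forall>\<^sub>F h in at (0::real). h \<noteq> 0" by (simp add: eventually_at_filter)
  ultimately show "\<forall>\<^sub>F h in at 0. dist ((f (x + h *\<^sub>R v) - f x) / h) l < e"
  proof eventually_elim
    case (elim h)
    have "\<bar>f (x + h *\<^sub>R v) - f (x + h *\<^sub>R w)\<bar> \<le> L * (\<bar>h\<bar> * norm (v - w))"
      using lipschitz_onD[OF L, of "x + h *\<^sub>R v" "x + h *\<^sub>R w"] by (simp add: dist_norm scaleR_diff_right[symmetric])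
    also have "\<dots> \<le> L * (\<bar>h\<bar> * d)" using L0 w(1) by (intro mult_left_mono) auto
    finally have "\<bar>(f (x + h *\<^sub>R v) - f (x + h *\<^sub>R w)) / h\<bar> \<le> L * d"
      using elim by (simp add: field_simps)
    moreover have "(f (x + h *\<^sub>R v) - f x) / h - l = (f (x + h *\<^sub>R v) - f (x + h *\<^sub>R w)) / h + ((f (x + h *\<^sub>R w) - f x) / h - m) + (m - l)"
      using elim by (simp add: diff_divide_distrib)
    moreover have "\<bar>(f (x + h *\<^sub>R w) - f x) / h - m\<bar> < d" using elim by (simp add: dist_real_def)
    ultimately have "\<bar>(f (x + h *\<^sub>R v) - f x) / h - l\<bar> < L * d + d + d" using w(2) by linarith
    then show ?case using d(2) by (simp add: dist_real_def algebra_simps)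
  qed
qed

text \<open>Gateaux rather than Frechet differentiability, since the equation involves only directional
  derivatives.\<close>
definition gateaux_derivative :: "('a::euclidean_space \<Rightarrow> real) \<Rightarrow> ('a \<Rightarrow> real) \<Rightarrow> 'a \<Rightarrow> bool" where
  "gateaux_derivative f D x \<longleftrightarrow> linear D \<and> (\<forall>v. has_directional_derivative f v x (D v))"

text \<open>Additivity holds almost everywhere for each of the countably many directions with rational
  coordinates, and these directions are dense.\<close>
theorem rademacher_gateaux:
  fixes f :: "'a::euclidean_space \<Rightarrow> real"
  assumes L: "L-lipschitz_on UNIV f"
  shows "AE x in lborel. \<exists>D. gateaux_derivative f D x"
proof -
  have step: "AE x in lborel. has_directional_derivative f (\<Sum>b\<in>A. q b *\<^sub>R b) x (\<Sum>b\<in>A. q b * directional_derivative f b x)"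
    if "finite A" for A :: "'a set" and q
    using that
  proof (induction A)
    case empty
    then show ?case by (simp add: has_directional_derivative_def)
  next
    case (insert b A)
    show ?case
      using insert.IH AE_directional_derivative[OF L, of b]
        AE_has_directional_derivative_add[OF L, of "q b *\<^sub>R b" "\<Sum>b\<in>A. q b *\<^sub>R b"]
      by eventually_elim (use insert.hyps has_directional_derivative_scale in fastforce)
  qed
  have "countable ((Basis :: 'a set) \<rightarrow>\<^sub>E \<rat>)" by (rule countable_PiE) (auto intro: countable_rat)
  then have "AE x in lborel. \<forall>q\<in>(Basis :: 'a set) \<rightarrow>\<^sub>E \<rat>. has_directional_derivative f (\<Sum>b\<in>Basis. q b *\<^sub>R b) x (\<Sum>b\<in>Basis. q b * directional_derivative f b x)"
    by (subst AE_ball_countable) (auto intro: step)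
  then show ?thesis
  proof eventually_elim
    fix x assume x: "\<forall>q\<in>(Basis :: 'a set) \<rightarrow>\<^sub>E \<rat>. has_directional_derivative f (\<Sum>b\<in>Basis. q b *\<^sub>R b) x (\<Sum>b\<in>Basis. q b * directional_derivative f b x)"
    define D where "D = (\<lambda>v. \<Sum>b\<in>Basis. (v \<bullet> b) * directional_derivative f b x)"
    have "linear D" unfolding D_def
      by (rule linearI) (auto simp: inner_add_left algebra_simps sum.distrib sum_distrib_left)
    moreover have "has_directional_derivative f v x (D v)" for v
    proof (rule has_directional_derivative_approx[OF L])
      fix e :: real assume "e > 0"
      define B where "B = (\<Sum>b\<in>(Basis::'a set). 1 + \<bar>directional_derivative f b x\<bar>)"
      have B: "B > 0" unfolding B_def by (rule sum_pos) auto
      define d where "d = e / B"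
      have d: "d > 0" using B \<open>e > 0\<close> by (simp add: d_def)
      have "\<exists>q\<in>\<rat>. \<bar>v \<bullet> b - q\<bar> < d" for b
      proof -
        obtain q where "q \<in> \<rat>" "v \<bullet> b < q" "q < v \<bullet> b + d" using Rats_dense_in_real[of "v \<bullet> b" "v \<bullet> b + d"] d by auto
        then show ?thesis by (intro bexI[of _ q]) auto
      qed
      then obtain q' where q': "\<And>b. q' b \<in> \<rat>" "\<And>b. \<bar>v \<bullet> b - q' b\<bar> < d" by metis
      define q where "q = restrict q' Basis"
      have q: "q \<in> (Basis :: 'a set) \<rightarrow>\<^sub>E \<rat>" "\<And>b. b \<in> Basis \<Longrightarrow> \<bar>v \<bullet> b - q b\<bar> < d" using q' by (auto simp: q_def)
      have dB: "(\<Sum>b\<in>(Basis::'a set). d * (1 + \<bar>directional_derivative f b x\<bar>)) = e"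
        using B unfolding sum_distrib_left[symmetric] B_def[symmetric] d_def by simp
      have "v - (\<Sum>b\<in>Basis. q b *\<^sub>R b) = (\<Sum>b\<in>Basis. (v \<bullet> b - q b) *\<^sub>R b)"
        by (simp add: scaleR_diff_left sum_subtractf euclidean_representation)
      also have "norm \<dots> \<le> (\<Sum>b\<in>Basis. norm ((v \<bullet> b - q b) *\<^sub>R b))" by (rule norm_sum)
      also have "\<dots> < (\<Sum>b\<in>(Basis::'a set). d * (1 + \<bar>directional_derivative f b x\<bar>))"
      proof (rule sum_strict_mono)
        fix b :: 'a assume b: "b \<in> Basis"
        have "d * 1 \<le> d * (1 + \<bar>directional_derivative f b x\<bar>)" using d by (intro mult_left_mono) auto
        then show "norm ((v \<bullet> b - q b) *\<^sub>R b) < d * (1 + \<bar>directional_derivative f b x\<bar>)" using q(2)[OF b] b by simp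
      qed auto
      finally have n: "norm (v - (\<Sum>b\<in>Basis. q b *\<^sub>R b)) < e" unfolding dB .
      have "D v - (\<Sum>b\<in>Basis. q b * directional_derivative f b x) = (\<Sum>b\<in>Basis. (v \<bullet> b - q b) * directional_derivative f b x)"
        by (simp add: D_def left_diff_distrib sum_subtractf)
      also have "\<bar>\<dots>\<bar> \<le> (\<Sum>b\<in>Basis. \<bar>(v \<bullet> b - q b) * directional_derivative f b x\<bar>)" by (rule sum_abs)
      also have "\<dots> < (\<Sum>b\<in>(Basis::'a set). d * (1 + \<bar>directional_derivative f b x\<bar>))"
      proof (rule sum_strict_mono)
        fix b :: 'a assume b: "b \<in> Basis"
        have "\<bar>v \<bullet> b - q b\<bar> * \<bar>directional_derivative f b x\<bar> \<le> d * \<bar>directional_derivative f b x\<bar>"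
          using q(2)[OF b] by (intro mult_right_mono) auto
        then show "\<bar>(v \<bullet> b - q b) * directional_derivative f b x\<bar> < d * (1 + \<bar>directional_derivative f b x\<bar>)"
          using d unfolding abs_mult by (simp add: distrib_left)
      qed auto
      finally have "\<bar>D v - (\<Sum>b\<in>Basis. q b * directional_derivative f b x)\<bar> < e" unfolding dB .
      with n x q(1) show "\<exists>w m. norm (v - w) < e \<and> \<bar>D v - m\<bar> < e \<and> has_directional_derivative f w x m" by blast
    qed
    ultimately show "\<exists>D. gateaux_derivative f D x" unfolding gateaux_derivative_def by blast
  qed
qed

section \<open>The discrete characteristic flow and its a priori estimates\<close>

text \<open>The hypotheses in quantitative form, with one constant \<open>C\<close> for all bounds and \<open>\<alpha> \<le> 1\<close>.  Here
  \<open>S\<close> is the linear part of \<open>T\<close> and \<open>S'\<close> its adjoint.\<close>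
locale planning_data =
  fixes F G :: "'a::euclidean_space \<times> 'a \<Rightarrow> 'a" and S S' T :: "'a \<Rightarrow> 'a" and x0 :: 'a
    and lam \<alpha> C :: real
  assumes lam: "0 \<le> lam" "lam \<le> C" and C: "1 \<le> C" and \<alpha>: "0 < \<alpha>" "\<alpha> \<le> 1"
    and F_lip: "norm (F (x, p) - F (y, q)) \<le> C * (norm (x - y) + norm (p - q))"
    and G_lip: "norm (G (x, p) - G (y, q)) \<le> C * (norm (x - y) + norm (p - q))"
    and F_growth: "norm (F (x, p)) \<le> C * (1 + norm (x - x0) + norm p)"
    and G_growth: "norm (G (x, p)) \<le> C * (1 + norm (x - x0) + norm p)"
    and strong_mono: "\<alpha> * (norm (p - q))\<^sup>2 \<le> inner (G (x, p) - G (y, q)) (x - y) + inner (F (x, p) - F (y, q)) (p - q)"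
    and T_diff: "T x - T y = S (x - y)"
    and S_bound: "norm (S x) \<le> C * norm x"
    and S'_linear: "linear S'"
    and S'_bound: "norm (S' x) \<le> C * norm x"
    and S'_adjoint: "inner x (S' y) = inner (S x) y"
    and T_growth: "norm (T x - x) \<le> C * (1 + norm (x - x0))"
begin

text \<open>Monotonicity together with an inequality that controls \<open>|dU|\<close> by \<open>|dx|\<close> when \<open>\<beta> > 0\<close>.  The
  negative term \<open>- \<beta> |dx|\<^sup>2\<close> is essential: without it the Lipschitz dependence of \<open>G\<close> on \<open>x\<close> would destroy
  the inequality.\<close>
definition cocoercive :: "real \<Rightarrow> ('a \<Rightarrow> 'a) \<Rightarrow> bool" where
  "cocoercive \<beta> U \<longleftrightarrow> (\<forall>x y. inner (x - y) (U x - U y) \<ge> 0 \<and>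
     inner (x - y) (U x - U y) \<ge> \<beta> * ((norm (U x - U y))\<^sup>2 - (norm (x - y))\<^sup>2))"

text \<open>Given \<open>U\<close> at one time and \<open>V\<close> at the next, every point \<open>(y, V y)\<close> of the new graph comes from a point
  \<open>(x, U x)\<close> of the old one.  The position moves with the new value of \<open>u\<close> and the old position;
  the factor \<open>1 / (1 + \<lambda> \<delta>)\<close> in the first equation lets the products \<open>\<langle>F, du\<rangle>\<close> and \<open>\<langle>G, dx\<rangle>\<close> of the differences enter with the
  same weight \<open>\<delta>\<close>.\<close>
definition euler_step :: "real \<Rightarrow> ('a \<Rightarrow> 'a) \<Rightarrow> ('a \<Rightarrow> 'a) \<Rightarrow> bool" where
  "euler_step \<delta> U V \<longleftrightarrow> (\<forall>y. \<exists>x. y = x + (\<delta> / (1 + lam * \<delta>)) *\<^sub>R F (x, V y) \<and>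
     (1 + lam * \<delta>) *\<^sub>R V y = U x + \<delta> *\<^sub>R G (x, V y) + (lam * \<delta>) *\<^sub>R S' (U (T x)))"

text \<open>Steps with \<open>M \<delta> \<le> 1\<close> are small enough for all estimates that do not involve the Lipschitz
  constant of \<open>U\<close>.\<close>
definition M :: real where "M = 8 * C ^ 3"
text \<open>The speed at which the parameter of cocoercivity grows; \<open>cap\<close> is the threshold up to which it
  grows.\<close>
definition rate :: real where "rate = \<alpha> / 4"
definition cap :: real where "cap = \<alpha> / (12 * M)"

lemma C_powers: "C \<le> C^2" "C^2 \<le> C^3" "1 \<le> C^2" "1 \<le> C^3" "C \<le> C^3" "0 < C"
proof -
  show "C \<le> C^2" "C^2 \<le> C^3" "C \<le> C^3" using power_increasing[of 1 2 C] power_increasing[of 2 3 C] power_increasing[of 1 3 C] C by simp_all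
  show "1 \<le> C^2" "1 \<le> C^3" "0 < C" using C by (simp_all add: one_le_power)
qed

lemma M_pos: "M \<ge> 8" "M > 0" "rate > 0" "rate \<le> 1" "cap > 0" "cap \<le> 1"
proof -
  show m: "M \<ge> 8" "M > 0" using C_powers by (auto simp: M_def)
  show "rate > 0" "rate \<le> 1" "cap > 0" "cap \<le> 1" using \<alpha> m by (auto simp: rate_def cap_def field_simps)
qed

text \<open>For nonnegative parameters the inequality interpolates between monotonicity, which is the
  case 0, and the case \<open>\<beta>\<close>.\<close>
lemma cocoercive_mono: "cocoercive \<beta> U \<Longrightarrow> 0 \<le> \<beta>' \<Longrightarrow> \<beta>' \<le> \<beta> \<Longrightarrow> cocoercive \<beta>' U"
  unfolding cocoercive_def
proof (intro allI conjI)
  fix x y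
  assume h: "\<forall>x y. 0 \<le> inner (x - y) (U x - U y) \<and> \<beta> * ((norm (U x - U y))\<^sup>2 - (norm (x - y))\<^sup>2) \<le> inner (x - y) (U x - U y)"
    and b: "0 \<le> \<beta>'" "\<beta>' \<le> \<beta>"
  show "0 \<le> inner (x - y) (U x - U y)" using h by blast
  show "\<beta>' * ((norm (U x - U y))\<^sup>2 - (norm (x - y))\<^sup>2) \<le> inner (x - y) (U x - U y)"
  proof (cases "(norm (U x - U y))\<^sup>2 - (norm (x - y))\<^sup>2 \<ge> 0")
    case True
    then have "\<beta>' * ((norm (U x - U y))\<^sup>2 - (norm (x - y))\<^sup>2) \<le> \<beta> * ((norm (U x - U y))\<^sup>2 - (norm (x - y))\<^sup>2)"
      using b by (intro mult_right_mono) auto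
    then show ?thesis using h order_trans by blast
  next
    case False
    then have "\<beta>' * ((norm (U x - U y))\<^sup>2 - (norm (x - y))\<^sup>2) \<le> 0" using b by (simp add: mult_nonneg_nonpos)
    then show ?thesis using h order_trans by blast
  qed
qed

text \<open>By Cauchy-Schwarz, \<open>|dU| = r |dx|\<close> implies \<open>\<beta> (r\<^sup>2 - 1) \<le> r\<close>, which fails for \<open>r > 1 + 1/\<beta>\<close>.\<close>
lemma cocoercive_lipschitz:
  assumes "cocoercive \<beta> U" "\<beta> > 0"
  shows "norm (U x - U y) \<le> (1 + 1 / \<beta>) * norm (x - y)"
proof (rule ccontr)
  let ?u = "norm (U x - U y)" and ?d = "norm (x - y)"
  assume "\<not> ?thesis"
  then have gt: "?u > (1 + 1 / \<beta>) * ?d" by simp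
  have d0: "?d \<ge> 0" "(1 / \<beta>) * ?d \<ge> 0" using assms by simp_all
  have "(1 + 1 / \<beta>) * ?d = ?d + (1 / \<beta>) * ?d" by (simp add: algebra_simps)
  then have u: "?u > 0" using gt d0 by linarith
  have "\<beta> * (?u\<^sup>2 - ?d\<^sup>2) \<le> inner (x - y) (U x - U y)" using assms(1) by (simp add: cocoercive_def)
  also have "\<dots> \<le> ?d * ?u" by (rule norm_cauchy_schwarz)
  finally have 1: "\<beta> * (?u\<^sup>2 - ?d\<^sup>2) \<le> ?d * ?u" .
  have 2: "\<beta> * ?u > \<beta> * ?d + ?d" using gt assms(2) by (simp add: field_simps)
  have "\<beta> * (?u * ?u) > (\<beta> * ?d + ?d) * ?u" using mult_strict_right_mono[OF 2 u] by (simp add: algebra_simps)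
  moreover have "\<beta> * ?d * ?u \<ge> \<beta> * ?d * ?d"
  proof (rule mult_left_mono)
    have "(1 + 1 / \<beta>) * ?d = ?d + (1 / \<beta>) * ?d" by (simp add: algebra_simps)
    then show "?d \<le> ?u" using gt d0 by linarith
  qed (use assms in auto)
  ultimately show False using 1 by (simp add: power2_eq_square algebra_simps)
qed

lemma kappa_bounds:
  assumes "0 \<le> \<delta>" "M * \<delta> \<le> 1"
  shows "0 \<le> lam * \<delta>" "lam * \<delta> \<le> C * \<delta>" "C * \<delta> \<le> M * \<delta> / 8" "lam * \<delta> * C^2 \<le> M * \<delta> / 8" "lam * \<delta> \<le> 1"
    "C * \<delta> \<le> 1 / 8" "C^2 * \<delta> \<le> 1/8" "\<delta> \<le> 1/8"
proof -
  show 1: "0 \<le> lam * \<delta>" "lam * \<delta> \<le> C * \<delta>" using assms(1) lam mult_right_mono[of lam C \<delta>] by simp_all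
  show 2: "C * \<delta> \<le> M * \<delta> / 8" using C_powers assms by (simp add: M_def mult_right_mono)
  have "lam * \<delta> * C^2 \<le> C * \<delta> * C^2" using 1(2) by (rule mult_right_mono) simp
  also have "\<dots> = M * \<delta> / 8" by (simp add: M_def power2_eq_square power3_eq_cube)
  finally show 3: "lam * \<delta> * C^2 \<le> M * \<delta> / 8" .
  show "C * \<delta> \<le> 1 / 8" using 2 assms by simp
  then show "lam * \<delta> \<le> 1" using 1 by simp
  have "C^2 * \<delta> \<le> M * \<delta> / 8" using C_powers assms by (simp add: M_def mult_right_mono)
  then show "C^2 * \<delta> \<le> 1/8" using assms by simp
  have "8 * \<delta> \<le> M * \<delta>" using M_pos assms by (intro mult_right_mono) auto
  then show "\<delta> \<le> 1/8" using assms by simp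
qed

text \<open>Cauchy's inequality \<open>(a + k c v)\<^sup>2 \<le> (1 + k c\<^sup>2) (a\<^sup>2 + k v\<^sup>2)\<close>, combined with
  \<open>(1 - k c\<^sup>2) (1 + k c\<^sup>2) \<le> 1\<close>.\<close>
lemma sq_young:
  fixes a v :: real
  assumes "0 \<le> k" "0 \<le> c" "0 \<le> a" "0 \<le> v"
  shows "(1 - k * c\<^sup>2) * (a + k * c * v)\<^sup>2 \<le> a\<^sup>2 + k * v\<^sup>2"
proof -
  have e: "(a + k * c * v)\<^sup>2 + k * (c * a - v)\<^sup>2 = (1 + k * c\<^sup>2) * (a\<^sup>2 + k * v\<^sup>2)"
    by (simp add: power2_eq_square algebra_simps)
  then have "(a + k * c * v)\<^sup>2 \<le> (1 + k * c\<^sup>2) * (a\<^sup>2 + k * v\<^sup>2)"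
    using mult_nonneg_nonneg[OF assms(1) zero_le_power2[of "c * a - v"]] by linarith
  show ?thesis
  proof (cases "1 - k * c\<^sup>2 \<ge> 0")
    case True
    have "(1 - k * c\<^sup>2) * (a + k * c * v)\<^sup>2 \<le> (1 - k * c\<^sup>2) * ((1 + k * c\<^sup>2) * (a\<^sup>2 + k * v\<^sup>2))"
      using True \<open>(a + k * c * v)\<^sup>2 \<le> _\<close> by (intro mult_left_mono)
    also have "\<dots> = (a\<^sup>2 + k * v\<^sup>2) - (k * c\<^sup>2)\<^sup>2 * (a\<^sup>2 + k * v\<^sup>2)"
      by (simp add: power2_eq_square algebra_simps)
    also have "\<dots> \<le> a\<^sup>2 + k * v\<^sup>2" using assms by simp
    finally show ?thesis .
  next
    case False
    then have "(1 - k * c\<^sup>2) * (a + k * c * v)\<^sup>2 \<le> 0" by (simp add: mult_nonpos_nonneg)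
    moreover have "0 \<le> a\<^sup>2 + k * v\<^sup>2" using assms by simp
    ultimately show ?thesis by linarith
  qed
qed

text \<open>The gain of cocoercivity in one step, for the differences of two trajectories: \<open>X\<close> and \<open>Y\<close> of the
  old and new positions, \<open>a\<close> and \<open>p\<close> of the old and new values, \<open>v\<close> of the values at \<open>T x\<close> and \<open>w\<close> of their
  images under the adjoint.  The identity
  \<open>(1 + \<kappa>) \<langle>Y, p\<rangle> = \<langle>X, a\<rangle> + \<kappa> \<langle>X, w\<rangle> + \<delta> (\<langle>g, X\<rangle> + \<langle>f, p\<rangle>)\<close> is exact.  The hypotheses on \<open>a\<close> and \<open>v\<close>
  bound its right-hand side from below in terms of \<open>|a|\<^sup>2 + \<kappa> |v|\<^sup>2\<close>, \<open>|X|\<^sup>2\<close> and \<open>\<delta> \<alpha> |p|\<^sup>2\<close>;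
  replacing \<open>a\<close>, \<open>v\<close> and \<open>X\<close> by \<open>p\<close> and \<open>Y\<close> costs terms of order \<open>\<beta> \<delta>\<close>, and for \<open>\<beta> \<le> cap\<close> these
  are dominated by \<open>\<delta> \<alpha> |p|\<^sup>2\<close> and by the growth of \<open>\<beta>\<close> in front of \<open>|Y|\<^sup>2\<close>.\<close>
lemma cocoercive_step_vectors:
  fixes X Y p f g a v w :: 'a
  assumes \<delta>: "0 \<le> \<delta>" "M * \<delta> \<le> 1" and \<beta>: "0 \<le> \<beta>" "\<beta> \<le> cap"
    and Y: "Y = X + (\<delta> / (1 + \<kappa>)) *\<^sub>R f" and p: "(1 + \<kappa>) *\<^sub>R p = a + \<delta> *\<^sub>R g + \<kappa> *\<^sub>R w"
    and \<kappa>: "\<kappa> = lam * \<delta>"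
    and f: "norm f \<le> C * (norm X + norm p)" and g: "norm g \<le> C * (norm X + norm p)"
    and w: "norm w \<le> C * norm v"
    and mono: "\<alpha> * (norm p)\<^sup>2 \<le> inner g X + inner f p"
    and a: "0 \<le> inner X a" "\<beta> * ((norm a)\<^sup>2 - (norm X)\<^sup>2) \<le> inner X a"
    and v: "0 \<le> inner X w" "\<beta> * ((norm v)\<^sup>2 - C^2 * (norm X)\<^sup>2) \<le> inner X w"
  shows "0 \<le> inner Y p \<and> (\<beta> + rate * \<delta>) * ((norm p)\<^sup>2 - (norm Y)\<^sup>2) \<le> inner Y p"
proof -
  note kb = kappa_bounds[OF \<delta>, folded \<kappa>]
  define m where "m = M * \<delta>"
  have m: "0 \<le> m" "m \<le> 1" using \<delta> M_pos by (auto simp: m_def)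
  define d where "d = C * \<delta>"
  have d: "0 \<le> d" "d \<le> m / 8" using kb \<delta> C_powers by (auto simp: d_def m_def)
  define P X2 Y2 where "P = (norm p)\<^sup>2" and "X2 = (norm X)\<^sup>2" and "Y2 = (norm Y)\<^sup>2"
  have nn: "0 \<le> P" "0 \<le> X2" "0 \<le> Y2" by (auto simp: P_def X2_def Y2_def)
  have k1: "1 + \<kappa> > 0" using kb by simp
  have xp: "2 * (norm X * norm p) \<le> X2 + P"
    using sum_squares_bound[of "norm X" "norm p"] by (simp add: X2_def P_def)
  have Xp: "(1 + \<kappa>) * inner X p = inner X a + \<delta> * inner g X + \<kappa> * inner X w"
  proof -
    have "(1 + \<kappa>) * inner X p = inner X ((1 + \<kappa>) *\<^sub>R p)" by simp
    then show ?thesis unfolding p by (simp add: inner_add_right inner_commute)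
  qed
  have Yp: "(1 + \<kappa>) * inner Y p = (1 + \<kappa>) * inner X p + \<delta> * inner f p"
    using k1 unfolding Y by (simp add: inner_add_left distrib_left)
  have id: "(1 + \<kappa>) * inner Y p = inner X a + \<kappa> * inner X w + \<delta> * (inner g X + inner f p)"
    unfolding Yp Xp by (simp add: algebra_simps)
  have good: "\<delta> * (\<alpha> * P) \<le> \<delta> * (inner g X + inner f p)" using mono \<delta> by (simp add: mult_left_mono P_def)
  have "0 \<le> \<delta> * (\<alpha> * P)" using \<delta> \<alpha> nn by simp
  then have nonneg: "0 \<le> (1 + \<kappa>) * inner Y p" unfolding id using a(1) mult_nonneg_nonneg[OF kb(1) v(1)] good by linarith
  \<comment> \<open>the old values are expressed by the new ones\<close>
  have z: "a + \<kappa> *\<^sub>R w = (1 + \<kappa>) *\<^sub>R p - \<delta> *\<^sub>R g" using p by (simp add: algebra_simps)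
  have e1: "(1 - \<kappa> * C\<^sup>2) * (norm (a + \<kappa> *\<^sub>R w))\<^sup>2 \<le> (norm a)\<^sup>2 + \<kappa> * (norm v)\<^sup>2"
  proof -
    have "norm (a + \<kappa> *\<^sub>R w) \<le> norm a + \<kappa> * norm w" using norm_triangle_ineq[of a "\<kappa> *\<^sub>R w"] kb(1) by simp
    also have "\<dots> \<le> norm a + \<kappa> * (C * norm v)" using w kb(1) by (intro add_left_mono mult_left_mono) auto
    finally have "(norm (a + \<kappa> *\<^sub>R w))\<^sup>2 \<le> (norm a + \<kappa> * C * norm v)\<^sup>2" by (intro power_mono) (auto simp: mult.assoc)
    then have "(1 - \<kappa> * C\<^sup>2) * (norm (a + \<kappa> *\<^sub>R w))\<^sup>2 \<le> (1 - \<kappa> * C\<^sup>2) * (norm a + \<kappa> * C * norm v)\<^sup>2"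
      using kb(4) \<delta>(2) by (intro mult_left_mono) auto
    also have "\<dots> \<le> (norm a)\<^sup>2 + \<kappa> * (norm v)\<^sup>2" by (rule sq_young) (use kb(1) C_powers in auto)
    finally show ?thesis .
  qed
  have e2: "(1 - 6 * d) * P - 2 * d * X2 \<le> (norm (a + \<kappa> *\<^sub>R w))\<^sup>2"
  proof -
    have "(norm (a + \<kappa> *\<^sub>R w))\<^sup>2 = (1 + \<kappa>)\<^sup>2 * P - 2 * (1 + \<kappa>) * \<delta> * inner p g + \<delta>\<^sup>2 * (norm g)\<^sup>2"
      unfolding z P_def power2_norm_eq_inner
      by (simp add: inner_diff_left inner_diff_right inner_commute power2_eq_square algebra_simps)
    moreover have "2 * (1 + \<kappa>) * \<delta> * inner p g \<le> 4 * d * P + 2 * d * (P + X2)"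
    proof -
      have "inner p g \<le> norm p * norm g" by (rule norm_cauchy_schwarz)
      also have "\<dots> \<le> norm p * (C * (norm X + norm p))" by (intro mult_left_mono g) auto
      finally have ig: "inner p g \<le> C * (norm X * norm p) + C * P" by (simp add: P_def power2_eq_square algebra_simps)
      have "2 * (1 + \<kappa>) * \<delta> * inner p g \<le> 2 * (1 + \<kappa>) * \<delta> * (C * (norm X * norm p) + C * P)"
        using kb(1) \<delta>(1) ig by (intro mult_left_mono) auto
      also have "\<dots> \<le> 4 * \<delta> * (C * (norm X * norm p) + C * P)"
        using kb(1,5) \<delta>(1) C_powers nn by (intro mult_right_mono) auto
      also have "\<dots> = 2 * d * (2 * (norm X * norm p)) + 4 * d * P" by (simp add: d_def algebra_simps)
      also have "\<dots> \<le> 2 * d * (X2 + P) + 4 * d * P" using xp d by (intro add_right_mono mult_left_mono) auto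
      finally show ?thesis by (simp add: add.commute)
    qed
    moreover have "P \<le> (1 + \<kappa>)\<^sup>2 * P" using nn kb(1) mult_right_mono[of 1 "(1 + \<kappa>)\<^sup>2" P] by (simp add: one_le_power)
    moreover have "0 \<le> \<delta>\<^sup>2 * (norm g)\<^sup>2" by simp
    moreover have "(1 - 6 * d) * P - 2 * d * X2 = P - (4 * d * P + 2 * d * (P + X2))" by (simp add: algebra_simps)
    ultimately show ?thesis by linarith
  qed
  have e3: "(1 - 7 * m / 8) * P - m / 4 * X2 \<le> (norm a)\<^sup>2 + \<kappa> * (norm v)\<^sup>2"
  proof -
    define k where "k = \<kappa> * C\<^sup>2"
    have k: "0 \<le> k" "k \<le> m / 8" using kb by (auto simp: k_def m_def)
    have "(1 - k) * ((1 - 6 * d) * P - 2 * d * X2) \<le> (1 - k) * (norm (a + \<kappa> *\<^sub>R w))\<^sup>2"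
      using e2 k m by (intro mult_left_mono) auto
    also have "\<dots> \<le> (norm a)\<^sup>2 + \<kappa> * (norm v)\<^sup>2" using e1 by (simp add: k_def)
    finally have 1: "(1 - k) * ((1 - 6 * d) * P - 2 * d * X2) \<le> (norm a)\<^sup>2 + \<kappa> * (norm v)\<^sup>2" .
    have "(1 - k) * ((1 - 6 * d) * P - 2 * d * X2) = P - (k + 6 * d) * P + 6 * (k * d) * P - 2 * d * X2 + 2 * (k * d) * X2"
      by (simp add: algebra_simps)
    moreover have "0 \<le> (k * d) * P" "0 \<le> (k * d) * X2" using k d nn by simp_all
    moreover have "(k + 6 * d) * P \<le> (7 * m / 8) * P" using k d nn by (intro mult_right_mono) auto
    moreover have "2 * d * X2 \<le> m / 4 * X2" using d nn by (intro mult_right_mono) auto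
    ultimately show ?thesis using 1 by (simp add: algebra_simps)
  qed
  \<comment> \<open>the old positions are expressed by the new ones\<close>
  have e4: "X2 \<le> (1 + 3 * m / 4) * (Y2 + m / 8 * P)"
  proof -
    define t where "t = \<delta> / (1 + \<kappa>)"
    have t: "0 \<le> t" "t \<le> \<delta>" using \<delta> kb(1) by (auto simp: t_def field_simps)
    have "Y2 = X2 + 2 * t * inner X f + t\<^sup>2 * (norm f)\<^sup>2"
      unfolding Y2_def X2_def Y t_def[symmetric] power2_norm_eq_inner
      by (simp add: inner_add_left inner_add_right inner_commute power2_eq_square algebra_simps)
    moreover have "2 * t * inner X f \<ge> - (d * (3 * X2 + P))"
    proof -
      have "- inner X f \<le> norm X * norm f" using Cauchy_Schwarz_ineq2[of X f] by linarith
      also have "\<dots> \<le> norm X * (C * (norm X + norm p))" by (intro mult_left_mono f) auto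
      finally have ig: "- inner X f \<le> C * (X2 + norm X * norm p)" by (simp add: X2_def power2_eq_square algebra_simps)
      have "2 * t * (- inner X f) \<le> 2 * t * (C * (X2 + norm X * norm p))" using t ig by (intro mult_left_mono) auto
      also have "\<dots> \<le> 2 * \<delta> * (C * (X2 + norm X * norm p))" using t C_powers nn by (intro mult_right_mono) auto
      also have "\<dots> = d * (2 * X2 + 2 * (norm X * norm p))" by (simp add: d_def algebra_simps)
      also have "\<dots> \<le> d * (2 * X2 + (X2 + P))" using xp d by (intro mult_left_mono) auto
      finally show ?thesis by (simp add: algebra_simps)
    qed
    moreover have "0 \<le> t\<^sup>2 * (norm f)\<^sup>2" by simp
    moreover have "(1 - 3 * d) * X2 - d * P = X2 - d * (3 * X2 + P)" by (simp add: algebra_simps)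
    ultimately have 1: "(1 - 3 * d) * X2 \<le> Y2 + d * P" by linarith
    have "1 \<le> (1 + 6 * d) * (1 - 3 * d)"
    proof -
      have "0 \<le> 3 * d * (1 - 6 * d)" using d m by simp
      then show ?thesis by (simp add: algebra_simps)
    qed
    then have "X2 \<le> (1 + 6 * d) * ((1 - 3 * d) * X2)" using nn mult_right_mono[of 1 "(1 + 6 * d) * (1 - 3 * d)" X2] by (simp add: mult.assoc)
    also have "\<dots> \<le> (1 + 6 * d) * (Y2 + d * P)" using 1 d by (intro mult_left_mono) auto
    also have "\<dots> \<le> (1 + 3 * m / 4) * (Y2 + m / 8 * P)" using d m nn by (intro mult_mono add_mono mult_right_mono) auto
    finally show ?thesis .
  qed
  have e5: "(1 + m / 2) * X2 \<le> (1 + 2 * m) * Y2 + m / 2 * P"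
  proof -
    have mm: "m * m \<le> m" using m mult_left_mono[of m 1 m] by simp
    have "(1 + m / 2) * X2 \<le> (1 + m / 2) * ((1 + 3 * m / 4) * (Y2 + m / 8 * P))" using e4 m by (intro mult_left_mono) auto
    also have "\<dots> = ((1 + m / 2) * (1 + 3 * m / 4)) * (Y2 + m / 8 * P)" by (simp add: mult.assoc)
    also have "\<dots> \<le> (1 + 2 * m) * (Y2 + m / 8 * P)" 
    proof (rule mult_right_mono)
      have "(1 + m / 2) * (1 + 3 * m / 4) = 1 + 5 / 4 * m + 3 / 8 * (m * m)" by (simp add: field_simps)
      then show "(1 + m / 2) * (1 + 3 * m / 4) \<le> 1 + 2 * m" using mm m by linarith
    qed (use m nn in auto)
    also have "\<dots> = (1 + 2 * m) * Y2 + (m / 8 + (m * m) / 4) * P" by (simp add: algebra_simps)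
    also have "\<dots> \<le> (1 + 2 * m) * Y2 + (m / 2) * P" using mm m nn by (intro add_left_mono mult_right_mono) auto
    finally show ?thesis .
  qed
  have main: "(\<beta> + \<delta> * \<alpha> - 2 * m * \<beta>) * P - \<beta> * (1 + 2 * m) * Y2 \<le> (1 + \<kappa>) * inner Y p"
  proof -
    have "\<kappa> * (\<beta> * ((norm v)\<^sup>2 - C^2 * X2)) \<le> \<kappa> * inner X w" using v(2) kb(1) by (intro mult_left_mono) (auto simp: X2_def)
    then have "\<beta> * ((norm a)\<^sup>2 + \<kappa> * (norm v)\<^sup>2) - \<beta> * ((1 + \<kappa> * C^2) * X2) + \<delta> * \<alpha> * P \<le> (1 + \<kappa>) * inner Y p"
      unfolding id using a(2) good by (simp add: X2_def algebra_simps)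
    moreover have "\<beta> * ((1 - 7 * m / 8) * P - m / 4 * X2) \<le> \<beta> * ((norm a)\<^sup>2 + \<kappa> * (norm v)\<^sup>2)"
      using e3 \<beta> by (intro mult_left_mono) auto
    moreover have "\<beta> * ((1 + \<kappa> * C^2) * X2) \<le> \<beta> * ((1 + m / 8) * X2)"
      using kb(4) \<beta> nn by (intro mult_left_mono mult_right_mono) (auto simp: m_def)
    moreover have "\<beta> * ((1 + m / 2) * X2) \<le> \<beta> * ((1 + 2 * m) * Y2 + m / 2 * P)"
      using e5 \<beta> by (intro mult_left_mono) auto
    moreover have "0 \<le> \<beta> * m * X2" "0 \<le> \<beta> * m * P" using \<beta> m nn by simp_all
    ultimately show ?thesis by (simp add: algebra_simps)
  qed
  have Mb: "M * \<beta> \<le> \<alpha> / 12"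
  proof -
    have "M * \<beta> \<le> M * cap" using \<beta> M_pos by (intro mult_left_mono) auto
    then show ?thesis using M_pos by (simp add: cap_def)
  qed
  have mb: "m * \<beta> \<le> \<delta> * \<alpha> / 12" using mult_left_mono[OF Mb \<delta>(1)] by (simp add: m_def algebra_simps)
  \<comment> \<open>here \<open>\<beta> \<le> cap\<close> lets the dissipation pay for all errors and for the growth of \<open>\<beta>\<close>\<close>
  have up: "(1 + \<kappa>) * (\<beta> + rate * \<delta>) \<le> \<beta> + \<delta> * \<alpha> - 2 * m * \<beta>"
  proof -
    have "\<kappa> \<le> m" using kb(2,3) m by (simp add: m_def)
    then have "\<kappa> * \<beta> \<le> m * \<beta>" using \<beta> by (intro mult_right_mono)
    moreover have "\<kappa> * (rate * \<delta>) \<le> 1 * (rate * \<delta>)" using kb(5) M_pos \<delta> by (intro mult_right_mono) auto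
    ultimately have "(1 + \<kappa>) * (\<beta> + rate * \<delta>) \<le> \<beta> + m * \<beta> + 2 * (rate * \<delta>)" by (simp add: algebra_simps)
    also have "\<dots> \<le> \<beta> + \<delta> * \<alpha> - 2 * m * \<beta>" using mb mult_nonneg_nonneg[OF \<delta>(1), of \<alpha>] \<alpha> by (simp add: rate_def algebra_simps)
    finally show ?thesis .
  qed
  have lo: "\<beta> * (1 + 2 * m) \<le> (1 + \<kappa>) * (\<beta> + rate * \<delta>)"
  proof -
    have "\<beta> * (1 + 2 * m) \<le> \<beta> + rate * \<delta>" using mb mult_nonneg_nonneg[OF \<delta>(1), of \<alpha>] \<alpha> by (simp add: rate_def algebra_simps)
    also have "\<dots> \<le> (1 + \<kappa>) * (\<beta> + rate * \<delta>)" using kb(1) \<beta> \<delta> M_pos mult_right_mono[of 1 "1 + \<kappa>" "\<beta> + rate * \<delta>"] by simp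
    finally show ?thesis .
  qed
  have "(1 + \<kappa>) * ((\<beta> + rate * \<delta>) * (P - Y2)) = ((1 + \<kappa>) * (\<beta> + rate * \<delta>)) * P - ((1 + \<kappa>) * (\<beta> + rate * \<delta>)) * Y2"
    by (simp add: algebra_simps)
  also have "\<dots> \<le> (\<beta> + \<delta> * \<alpha> - 2 * m * \<beta>) * P - \<beta> * (1 + 2 * m) * Y2"
    using up lo nn by (intro diff_mono mult_right_mono)
  also have "\<dots> \<le> (1 + \<kappa>) * inner Y p" by (rule main)
  finally have "(\<beta> + rate * \<delta>) * (P - Y2) \<le> inner Y p" using k1 by simp
  moreover have "0 \<le> inner Y p" using nonneg k1 by (simp add: zero_le_mult_iff)
  ultimately show ?thesis by (simp add: P_def Y2_def)
qed

lemma S'_diff: "S' x - S' y = S' (x - y)"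
  using linear_diff[OF S'_linear] by simp

lemma cocoercive_euler_step:
  assumes st: "euler_step \<delta> U V" and \<delta>: "0 \<le> \<delta>" "M * \<delta> \<le> 1" and \<beta>: "0 \<le> \<beta>" "\<beta> \<le> cap"
    and co: "cocoercive \<beta> U"
  shows "cocoercive (\<beta> + rate * \<delta>) V"
  unfolding cocoercive_def
proof (intro allI)
  fix y1 y2
  obtain x1 where x1: "y1 = x1 + (\<delta> / (1 + lam * \<delta>)) *\<^sub>R F (x1, V y1)"
     "(1 + lam * \<delta>) *\<^sub>R V y1 = U x1 + \<delta> *\<^sub>R G (x1, V y1) + (lam * \<delta>) *\<^sub>R S' (U (T x1))"
    using st by (auto simp: euler_step_def)
  obtain x2 where x2: "y2 = x2 + (\<delta> / (1 + lam * \<delta>)) *\<^sub>R F (x2, V y2)"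
     "(1 + lam * \<delta>) *\<^sub>R V y2 = U x2 + \<delta> *\<^sub>R G (x2, V y2) + (lam * \<delta>) *\<^sub>R S' (U (T x2))"
    using st by (auto simp: euler_step_def)
  have adj: "inner (x1 - x2) (S' (U (T x1)) - S' (U (T x2))) = inner (T x1 - T x2) (U (T x1) - U (T x2))"
    by (simp add: S'_diff S'_adjoint T_diff)
  show "0 \<le> inner (y1 - y2) (V y1 - V y2) \<and>
     (\<beta> + rate * \<delta>) * ((norm (V y1 - V y2))\<^sup>2 - (norm (y1 - y2))\<^sup>2) \<le> inner (y1 - y2) (V y1 - V y2)"
  proof (rule cocoercive_step_vectors[OF \<delta> \<beta>, where f="F (x1, V y1) - F (x2, V y2)" and g="G (x1, V y1) - G (x2, V y2)"
        and X="x1 - x2" and a="U x1 - U x2" and w="S' (U (T x1)) - S' (U (T x2))" and v="U (T x1) - U (T x2)", OF _ _ refl])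
    show "y1 - y2 = x1 - x2 + (\<delta> / (1 + lam * \<delta>)) *\<^sub>R (F (x1, V y1) - F (x2, V y2))"
      using x1(1) x2(1) by (simp add: algebra_simps)
    show "(1 + lam * \<delta>) *\<^sub>R (V y1 - V y2) = U x1 - U x2 + \<delta> *\<^sub>R (G (x1, V y1) - G (x2, V y2)) + (lam * \<delta>) *\<^sub>R (S' (U (T x1)) - S' (U (T x2)))"
      unfolding scaleR_diff_right x1(2) x2(2) by simp
    show "norm (S' (U (T x1)) - S' (U (T x2))) \<le> C * norm (U (T x1) - U (T x2))"
      unfolding S'_diff by (rule S'_bound)
    show "0 \<le> inner (x1 - x2) (U x1 - U x2)" "\<beta> * ((norm (U x1 - U x2))\<^sup>2 - (norm (x1 - x2))\<^sup>2) \<le> inner (x1 - x2) (U x1 - U x2)"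
      using co by (auto simp: cocoercive_def)
    show "0 \<le> inner (x1 - x2) (S' (U (T x1)) - S' (U (T x2)))"
      unfolding adj using co by (auto simp: cocoercive_def)
    have "(norm (T x1 - T x2))\<^sup>2 \<le> (C * norm (x1 - x2))\<^sup>2" unfolding T_diff by (intro power_mono S_bound) auto
    then have "\<beta> * ((norm (U (T x1) - U (T x2)))\<^sup>2 - C\<^sup>2 * (norm (x1 - x2))\<^sup>2) \<le> \<beta> * ((norm (U (T x1) - U (T x2)))\<^sup>2 - (norm (T x1 - T x2))\<^sup>2)"
      using \<beta> by (intro mult_left_mono) (auto simp: power_mult_distrib)
    also have "\<dots> \<le> inner (T x1 - T x2) (U (T x1) - U (T x2))" using co by (auto simp: cocoercive_def)
    finally show "\<beta> * ((norm (U (T x1) - U (T x2)))\<^sup>2 - C\<^sup>2 * (norm (x1 - x2))\<^sup>2) \<le> inner (x1 - x2) (S' (U (T x1)) - S' (U (T x2)))"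
      unfolding adj .
    show "\<alpha> * (norm (V y1 - V y2))\<^sup>2 \<le> inner (G (x1, V y1) - G (x2, V y2)) (x1 - x2) + inner (F (x1, V y1) - F (x2, V y2)) (V y1 - V y2)"
      by (rule strong_mono)
  qed (rule F_lip G_lip)+
qed

text \<open>The implicit equation for \<open>u\<close> at a given old position is a contraction with a Lipschitz
  solution \<open>P\<close>; then \<open>x \<mapsto> x + \<delta> / (1 + \<kappa>) F(x, P x)\<close> is a small Lipschitz perturbation of the identity and
  therefore surjective.\<close>
lemma euler_step_exists:
  assumes \<delta>: "0 \<le> \<delta>" "M * \<delta> \<le> 1" and L: "1 \<le> L" "14 * C * L * \<delta> \<le> 1"
    and U: "\<And>x y. norm (U x - U y) \<le> L * norm (x - y)"
  shows "\<exists>V. euler_step \<delta> U V"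
proof -
  define \<kappa> where "\<kappa> = lam * \<delta>"
  note kb = kappa_bounds[OF \<delta>, folded \<kappa>_def]
  define d where "d = C * \<delta>"
  have d: "0 \<le> d" "d \<le> 1/8" using \<delta> C_powers kb by (auto simp: d_def)
  have k1: "1 \<le> 1 + \<kappa>" "0 < 1 + \<kappa>" using kb by auto
  have "\<exists>p. (1 + \<kappa>) *\<^sub>R p = U x + \<delta> *\<^sub>R G (x, p) + \<kappa> *\<^sub>R S' (U (T x))" for x
  proof -
    let ?\<Psi> = "\<lambda>p. (1 / (1 + \<kappa>)) *\<^sub>R (U x + \<delta> *\<^sub>R G (x, p) + \<kappa> *\<^sub>R S' (U (T x)))"
    have "\<exists>!p. ?\<Psi> p = p"
    proof (rule banach_fix_type[where c="1/8"])
      show "\<forall>p q. dist (?\<Psi> p) (?\<Psi> q) \<le> 1 / 8 * dist p q"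
      proof (intro allI)
        fix p q
        have "dist (?\<Psi> p) (?\<Psi> q) = norm ((\<delta> / (1 + \<kappa>)) *\<^sub>R (G (x, p) - G (x, q)))"
          by (simp add: dist_norm scaleR_diff_right[symmetric])
        also have "\<dots> = (\<delta> / (1 + \<kappa>)) * norm (G (x, p) - G (x, q))" using \<delta> kb by simp
        also have "\<dots> \<le> \<delta> * (C * (norm (x - x) + norm (p - q)))"
          using \<delta> k1 by (intro mult_mono G_lip) (auto simp: field_simps)
        also have "\<dots> = d * norm (p - q)" by (simp add: d_def)
        also have "\<dots> \<le> 1/8 * norm (p - q)" using d by (intro mult_right_mono) auto
        finally show "dist (?\<Psi> p) (?\<Psi> q) \<le> 1 / 8 * dist p q" by (simp add: dist_norm)
      qed
    qed auto
    then obtain p where "?\<Psi> p = p" by blast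
    then have "(1 + \<kappa>) *\<^sub>R p = (1 + \<kappa>) *\<^sub>R ?\<Psi> p" by simp
    then show ?thesis using k1 by (intro exI[of _ p]) simp
  qed
  then obtain P where P: "\<And>x. (1 + \<kappa>) *\<^sub>R P x = U x + \<delta> *\<^sub>R G (x, P x) + \<kappa> *\<^sub>R S' (U (T x))" by metis
  have Plip: "norm (P x - P y) \<le> 2 * L * norm (x - y)" for x y
  proof -
    have "norm (P x - P y) \<le> (1 + \<kappa>) * norm (P x - P y)" using k1 mult_right_mono[of 1 "1 + \<kappa>" "norm (P x - P y)"] by simp
    also have "\<dots> = norm ((1 + \<kappa>) *\<^sub>R P x - (1 + \<kappa>) *\<^sub>R P y)" using k1 by (simp add: scaleR_diff_right[symmetric])
    also have "\<dots> = norm ((U x - U y) + \<delta> *\<^sub>R (G (x, P x) - G (y, P y)) + \<kappa> *\<^sub>R S' (U (T x) - U (T y)))"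
      unfolding P by (simp add: S'_diff[symmetric] algebra_simps)
    also have "\<dots> \<le> norm (U x - U y) + \<delta> * norm (G (x, P x) - G (y, P y)) + \<kappa> * norm (S' (U (T x) - U (T y)))"
      using \<delta> kb(1) by (intro norm_triangle_le add_mono) auto
    also have "\<dots> \<le> L * norm (x - y) + \<delta> * (C * (norm (x - y) + norm (P x - P y))) + \<kappa> * (C^2 * L * norm (x - y))"
    proof (intro add_mono mult_left_mono U G_lip)
      have "norm (S' (U (T x) - U (T y))) \<le> C * norm (U (T x) - U (T y))" by (rule S'_bound)
      also have "\<dots> \<le> C * (L * norm (T x - T y))" using C_powers by (intro mult_left_mono U) auto
      also have "\<dots> \<le> C * (L * (C * norm (x - y)))" unfolding T_diff using C_powers L by (intro mult_left_mono S_bound) auto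
      finally show "norm (S' (U (T x) - U (T y))) \<le> C\<^sup>2 * L * norm (x - y)" by (simp add: power2_eq_square mult_ac)
    qed (use \<delta> kb in auto)
    also have "\<dots> = (L + d + (\<kappa> * C^2) * L) * norm (x - y) + d * norm (P x - P y)" by (simp add: d_def algebra_simps)
    also have "\<dots> \<le> (10/8 * L) * norm (x - y) + 1/8 * norm (P x - P y)"
    proof (intro add_mono mult_right_mono)
      have "(\<kappa> * C^2) * L \<le> 1/8 * L" using kb(4) \<delta>(2) L by (intro mult_right_mono) linarith+
      then show "L + d + (\<kappa> * C^2) * L \<le> 10/8 * L" using d L(1) by linarith
    qed (use d in auto)
    finally have "7/8 * norm (P x - P y) \<le> 10/8 * (L * norm (x - y))" by simp
    moreover have "0 \<le> L * norm (x - y)" using L by simp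
    ultimately show ?thesis by linarith
  qed
  have "\<exists>x. y = x + (\<delta> / (1 + \<kappa>)) *\<^sub>R F (x, P x)" for y
  proof -
    let ?\<Psi> = "\<lambda>x. y - (\<delta> / (1 + \<kappa>)) *\<^sub>R F (x, P x)"
    have "\<exists>!x. ?\<Psi> x = x"
    proof (rule banach_fix_type[where c="3/14"])
      show "\<forall>x z. dist (?\<Psi> x) (?\<Psi> z) \<le> 3/14 * dist x z"
      proof (intro allI)
        fix x z
        have "dist (?\<Psi> x) (?\<Psi> z) = norm ((\<delta> / (1 + \<kappa>)) *\<^sub>R (F (x, P x) - F (z, P z)))"
          by (simp add: dist_norm scaleR_diff_right norm_minus_commute)
        also have "\<dots> = (\<delta> / (1 + \<kappa>)) * norm (F (x, P x) - F (z, P z))" using \<delta> kb by simp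
        also have "\<dots> \<le> \<delta> * (C * (norm (x - z) + norm (P x - P z)))"
          using \<delta> k1 by (intro mult_mono F_lip) (auto simp: field_simps)
        also have "\<dots> \<le> \<delta> * (C * (norm (x - z) + 2 * L * norm (x - z)))"
          using \<delta> C_powers by (intro mult_left_mono add_left_mono Plip) auto
        also have "\<dots> = (C * \<delta> * (1 + 2 * L)) * norm (x - z)" by (simp add: algebra_simps)
        also have "\<dots> \<le> 3/14 * norm (x - z)"
        proof (intro mult_right_mono)
          have "C * \<delta> * (1 + 2 * L) \<le> C * \<delta> * (3 * L)" using L d(1) by (intro mult_left_mono) (auto simp: d_def)
          moreover have "C * \<delta> * (3 * L) = 3/14 * (14 * C * L * \<delta>)" by simp
          ultimately show "C * \<delta> * (1 + 2 * L) \<le> 3/14" using L by linarith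
        qed auto
        finally show "dist (?\<Psi> x) (?\<Psi> z) \<le> 3/14 * dist x z" by (simp add: dist_norm)
      qed
    qed auto
    then obtain x where "?\<Psi> x = x" by blast
    then show ?thesis by (intro exI[of _ x]) (simp add: algebra_simps)
  qed
  then obtain X where X: "\<And>y. y = X y + (\<delta> / (1 + \<kappa>)) *\<^sub>R F (X y, P (X y))" by metis
  have "euler_step \<delta> U (\<lambda>y. P (X y))"
    unfolding euler_step_def \<kappa>_def[symmetric] using X P by blast
  then show ?thesis by blast
qed

lemma euler_stepE:
  assumes st: "euler_step \<delta> U V" and \<delta>: "0 \<le> \<delta>"
  obtains x where "y = x + (\<delta> / (1 + lam * \<delta>)) *\<^sub>R F (x, V y)"
     "(1 + lam * \<delta>) *\<^sub>R V y = U x + \<delta> *\<^sub>R G (x, V y) + (lam * \<delta>) *\<^sub>R S' (U (T x))"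
     "norm (y - x) \<le> \<delta> * (C * (1 + norm (x - x0) + norm (V y)))"
proof -
  obtain x where x: "y = x + (\<delta> / (1 + lam * \<delta>)) *\<^sub>R F (x, V y)"
     "(1 + lam * \<delta>) *\<^sub>R V y = U x + \<delta> *\<^sub>R G (x, V y) + (lam * \<delta>) *\<^sub>R S' (U (T x))"
    using st by (auto simp: euler_step_def)
  have l: "0 \<le> lam * \<delta>" using lam \<delta> by simp
  have "y - x = (\<delta> / (1 + lam * \<delta>)) *\<^sub>R F (x, V y)" using x(1) by (metis add_diff_cancel_left')
  then have "norm (y - x) = (\<delta> / (1 + lam * \<delta>)) * norm (F (x, V y))" using \<delta> l by simp
  also have "\<dots> \<le> \<delta> * (C * (1 + norm (x - x0) + norm (V y)))"
    using \<delta> l by (intro mult_mono F_growth) (auto simp: field_simps)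
  finally show ?thesis using that x by blast
qed

text \<open>Constants of the estimate near time 0.  They are chosen so that the terms produced in
  \<open>anchor_step\<close> close up: \<open>H\<close> absorbs the logarithmic growth of \<open>u\<close>, and \<open>s1\<close> is the time up to which the
  estimate is propagated.\<close>
definition N :: real where "N = 4 * C^3 / rate"
definition s1 :: real where "s1 = 1 / (32 * C * N)"
definition K :: real where "K = 4 * C"
definition H :: real where "H = 3 * N + 1"

lemma anchor_constants:
  "4 * C^3 \<le> N" "4 \<le> N" "0 < s1" "s1 \<le> 1 / 128" "rate * s1 \<le> cap" "1 \<le> K" "0 < H"
proof -
  show N1: "4 * C^3 \<le> N"
  proof -
    have "4 * C^3 * rate \<le> 4 * C^3 * 1" using C_powers M_pos by (intro mult_left_mono) auto
    then show ?thesis using M_pos by (simp add: N_def field_simps)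
  qed
  then show N4: "4 \<le> N" using C_powers by linarith
  show "0 < s1" using N4 C_powers by (simp add: s1_def)
  have "4 \<le> C * N" using mult_mono[of 1 C 4 N] C N4 by simp
  then show "s1 \<le> 1/128" using C_powers N4 by (simp add: s1_def field_simps)
  show "1 \<le> K" using C by (simp add: K_def)
  show "0 < H" using N4 by (simp add: H_def)
  have "24 * C^3 \<le> 32 * C * N"
  proof -
    have "24 * C^3 \<le> 32 * (1 * N)" using N1 C_powers by simp
    also have "\<dots> \<le> 32 * (C * N)" using C N4 by (intro mult_left_mono mult_right_mono) auto
    finally show ?thesis by simp
  qed
  then have "\<alpha> / 4 / (32 * C * N) \<le> \<alpha> / 4 / (24 * C^3)"
    using \<alpha> C_powers N4 by (intro divide_left_mono) auto
  then show "rate * s1 \<le> cap" by (simp add: rate_def s1_def cap_def M_def)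
qed

text \<open>One step of \<open>|x - x0| \<le> K s (H + |U x|)\<close>.  Backwards in time the value \<open>u\<close> changes at most at the
  rate \<open>O((1 + |x - x0|) / s + |u|)\<close>, because the Lipschitz constant of \<open>U\<close> at time \<open>s\<close> is \<open>O(1/s)\<close> and \<open>T\<close> may move
  \<open>x\<close> by a fixed amount.  This rate is not integrable at 0, but multiplied by \<open>s\<close> it is: the
  resulting loss \<open>O(\<delta>)\<close> in \<open>s |U x|\<close> is paid by the increase \<open>K \<delta> H\<close> of the right-hand side.\<close>
lemma anchor_step:
  assumes st: "euler_step \<delta> U V" and \<delta>: "0 \<le> \<delta>" "M * \<delta> \<le> 1" "\<delta> \<le> s" and s: "0 < s" "s \<le> s1"
    and lip: "\<And>x y. norm (U x - U y) \<le> 2 / (rate * s) * norm (x - y)"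
    and anchor: "\<And>x. norm (x - x0) \<le> K * s * (H + norm (U x))"
  shows "norm (y - x0) \<le> K * (s + \<delta>) * (H + norm (V y))"
proof -
  define \<kappa> where "\<kappa> = lam * \<delta>"
  note kb = kappa_bounds[OF \<delta>(1,2), folded \<kappa>_def]
  note ac = anchor_constants
  obtain x where x: "y = x + (\<delta> / (1 + \<kappa>)) *\<^sub>R F (x, V y)"
     "(1 + \<kappa>) *\<^sub>R V y = U x + \<delta> *\<^sub>R G (x, V y) + \<kappa> *\<^sub>R S' (U (T x))"
     "norm (y - x) \<le> \<delta> * (C * (1 + norm (x - x0) + norm (V y)))"
    by (rule euler_stepE[OF st \<delta>(1), of y, folded \<kappa>_def])
  define D u a where "D = norm (x - x0)" and "u = norm (V y)" and "a = norm (U x)"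
  have nn: "0 \<le> D" "0 \<le> u" "0 \<le> a" by (auto simp: D_def u_def a_def)
  have i: "norm (y - x0) \<le> D + \<delta> * (C * (1 + D + u))"
    using norm_triangle_ineq[of "y - x" "x - x0"] x(3) by (simp add: D_def u_def)
  have s': "s \<le> 1" using s ac by linarith
  have rs: "0 < rate * s" using M_pos s by simp
  have UT: "norm (S' (U (T x))) \<le> C * a + C^2 * (2 / (rate * s)) * (1 + D)"
  proof -
    have "norm (U (T x)) \<le> a + norm (U (T x) - U x)" using norm_triangle_ineq2[of "U (T x)" "U x"] by (simp add: a_def)
    also have "\<dots> \<le> a + 2 / (rate * s) * norm (T x - x)" by (intro add_left_mono lip)
    also have "\<dots> \<le> a + 2 / (rate * s) * (C * (1 + D))" unfolding D_def using rs by (intro add_left_mono mult_left_mono T_growth) auto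
    finally have "C * norm (U (T x)) \<le> C * (a + 2 / (rate * s) * (C * (1 + D)))" using C_powers by (intro mult_left_mono) auto
    then have "norm (S' (U (T x))) \<le> C * (a + 2 / (rate * s) * (C * (1 + D)))" using S'_bound order_trans by blast
    then show ?thesis by (simp add: power2_eq_square algebra_simps)
  qed
  have ii: "a \<le> u + \<delta> * (2 * C * u + C^2 * a + (C + 2 * C^3 / (rate * s)) * (1 + D))"
  proof -
    have "U x = (1 + \<kappa>) *\<^sub>R V y - \<delta> *\<^sub>R G (x, V y) - \<kappa> *\<^sub>R S' (U (T x))" using x(2) by simp
    then have "a \<le> norm ((1 + \<kappa>) *\<^sub>R V y) + norm (\<delta> *\<^sub>R G (x, V y)) + norm (\<kappa> *\<^sub>R S' (U (T x)))"
      using norm_triangle_ineq4[of "(1 + \<kappa>) *\<^sub>R V y - \<delta> *\<^sub>R G (x, V y)" "\<kappa> *\<^sub>R S' (U (T x))"]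
        norm_triangle_ineq4[of "(1 + \<kappa>) *\<^sub>R V y" "\<delta> *\<^sub>R G (x, V y)"] by (simp add: a_def)
    also have "\<dots> = (1 + \<kappa>) * u + \<delta> * norm (G (x, V y)) + \<kappa> * norm (S' (U (T x)))"
      using \<delta> kb by (simp add: u_def)
    also have "\<dots> \<le> (1 + C * \<delta>) * u + \<delta> * (C * (1 + D + u)) + (C * \<delta>) * (C * a + C^2 * (2 / (rate * s)) * (1 + D))"
    proof (intro add_mono)
      show "(1 + \<kappa>) * u \<le> (1 + C * \<delta>) * u" using kb(2) nn by (intro mult_right_mono) auto
      show "\<delta> * norm (G (x, V y)) \<le> \<delta> * (C * (1 + D + u))" unfolding D_def u_def using \<delta>(1) by (intro mult_left_mono G_growth)
      show "\<kappa> * norm (S' (U (T x))) \<le> (C * \<delta>) * (C * a + C^2 * (2 / (rate * s)) * (1 + D))"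
        using UT kb(1,2) by (intro mult_mono) auto
    qed
    also have "\<dots> = u + \<delta> * (2 * C * u + C^2 * a + (C + 2 * C^3 / (rate * s)) * (1 + D))"
      by (simp add: power2_eq_square power3_eq_cube algebra_simps)
    finally show ?thesis .
  qed
  have iii: "s * a \<le> s * u + \<delta> * N * (s * u + 1 + D)"
  proof -
    define q where "q = C^2 * \<delta>"
    have q: "0 \<le> q" "q \<le> 1/8" using kb \<delta> by (auto simp: q_def)
    have "s * a \<le> s * (u + \<delta> * (2 * C * u + C^2 * a + (C + 2 * C^3 / (rate * s)) * (1 + D)))"
      using ii s by (intro mult_left_mono) auto
    also have "\<dots> = s * u + 2 * (\<delta> * C) * (s * u) + q * (s * a) + \<delta> * ((s * C + 2 * C^3 / rate) * (1 + D))"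
      using s(1) M_pos(3) by (simp add: q_def field_simps)
    finally have 1: "s * a \<le> s * u + 2 * (\<delta> * C) * (s * u) + q * (s * a) + \<delta> * ((s * C + 2 * C^3 / rate) * (1 + D))" .
    have "\<delta> * C \<le> q" using mult_left_mono[OF C_powers(1) \<delta>(1)] by (simp add: q_def mult.commute)
    then have 2: "(\<delta> * C) * (s * u) \<le> q * (s * u)" by (rule mult_right_mono) (use s nn in auto)
    have "s * C * rate \<le> 1 * C^3 * 1" using s s' C_powers M_pos by (intro mult_mono) auto
    then have "s * C + 2 * C^3 / rate \<le> 3 * C^3 / rate" using M_pos by (simp add: field_simps)
    then have "(s * C + 2 * C^3 / rate) * (1 + D) \<le> (3 * C^3 / rate) * (1 + D)" by (rule mult_right_mono) (use nn in auto)
    then have 3: "\<delta> * ((s * C + 2 * C^3 / rate) * (1 + D)) \<le> \<delta> * ((3 * C^3 / rate) * (1 + D))" using \<delta>(1) by (rule mult_left_mono)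
    have "s * a \<le> s * u + 2 * (q * (s * u)) + q * (s * a) + \<delta> * ((3 * C^3 / rate) * (1 + D))"
      using 1 2 3 by linarith
    then have "(1 - q) * (s * a) \<le> (1 + 2 * q) * (s * u) + \<delta> * ((3 * C^3 / rate) * (1 + D))"
      by (simp add: algebra_simps)
    also have "\<dots> \<le> (1 - q) * ((1 + 4 * q) * (s * u)) + (1 - q) * (\<delta> * (N * (1 + D)))"
    proof (intro add_mono)
      have "1 + 2 * q \<le> (1 - q) * (1 + 4 * q)"
      proof -
        have "0 \<le> q * (1 - 4 * q)" using q by simp
        then show ?thesis by (simp add: algebra_simps)
      qed
      then have "(1 + 2 * q) * (s * u) \<le> ((1 - q) * (1 + 4 * q)) * (s * u)" using s nn by (intro mult_right_mono) auto
      then show "(1 + 2 * q) * (s * u) \<le> (1 - q) * ((1 + 4 * q) * (s * u))" by (simp only: mult.assoc)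
      have "3 * C^3 / rate = 3/4 * N" by (simp add: N_def)
      also have "\<dots> \<le> (1 - q) * N" using q ac by (intro mult_right_mono) auto
      finally have "(3 * C^3 / rate) * (\<delta> * (1 + D)) \<le> ((1 - q) * N) * (\<delta> * (1 + D))" using \<delta> nn by (intro mult_right_mono) auto
      then show "\<delta> * ((3 * C^3 / rate) * (1 + D)) \<le> (1 - q) * (\<delta> * (N * (1 + D)))" by (simp only: mult_ac)
    qed
    also have "\<dots> = (1 - q) * ((1 + 4 * q) * (s * u) + \<delta> * (N * (1 + D)))" by (simp add: distrib_left)
    finally have "s * a \<le> (1 + 4 * q) * (s * u) + \<delta> * (N * (1 + D))" using q by simp
    also have "\<dots> = s * u + (\<delta> * (4 * C^2)) * (s * u) + \<delta> * N * (1 + D)" by (simp add: q_def algebra_simps)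
    also have "\<dots> \<le> s * u + (\<delta> * N) * (s * u) + \<delta> * N * (1 + D)"
    proof (intro add_right_mono add_left_mono mult_right_mono)
      have "4 * C^2 \<le> N" using ac(1) C_powers(2) by linarith
      then show "\<delta> * (4 * C^2) \<le> \<delta> * N" using \<delta>(1) by (rule mult_left_mono)
    qed (use s nn in auto)
    finally show ?thesis by (simp add: algebra_simps)
  qed
  have Ds: "D \<le> K * s * H + K * (s * u) + K * N * \<delta> * (s * u + 1 + D)"
  proof -
    have "D \<le> K * s * H + K * (s * a)" using anchor[of x] by (simp add: D_def a_def algebra_simps)
    also have "\<dots> \<le> K * s * H + K * (s * u + \<delta> * N * (s * u + 1 + D))" using iii ac by (intro add_left_mono mult_left_mono) auto
    finally show ?thesis by (simp add: algebra_simps)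
  qed
  have CNs: "32 * C * N * s \<le> 1"
  proof -
    have "32 * C * N * s \<le> 32 * C * N * s1" using s ac C_powers by (intro mult_left_mono) auto
    then show ?thesis using ac C_powers by (simp add: s1_def)
  qed
  have Cs: "128 * (C * s) \<le> 1"
  proof -
    have "4 * (C * s) \<le> N * (C * s)" using ac C_powers s by (intro mult_right_mono) auto
    then show ?thesis using CNs by (simp add: mult_ac)
  qed
  have KN\<delta>: "K * N * \<delta> \<le> 1/8"
  proof -
    have "C * N * \<delta> \<le> C * N * s" using \<delta> ac C_powers by (intro mult_left_mono) auto
    then show ?thesis using CNs by (simp add: K_def)
  qed
  have KHs: "K * s * H \<le> 1/2"
  proof -
    have "K * s * H = 4 * (C * s) * (3 * N + 1)" by (simp add: K_def H_def)
    also have "\<dots> \<le> 4 * (C * s) * (4 * N)" using ac C_powers s by (intro mult_left_mono) auto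
    finally show ?thesis using CNs by (simp add: mult_ac)
  qed
  have D2: "1 + D + s * u \<le> 3 + 4 * (K * (s * u))"
  proof -
    have "0 \<le> s * u" using s nn by simp
    have "K * N * \<delta> * (s * u + 1 + D) \<le> 1/8 * (s * u + 1 + D)" using KN\<delta> nn s by (intro mult_right_mono) auto
    then have "8 * (K * N * \<delta> * (s * u + 1 + D)) \<le> s * u + 1 + D" by simp
    then have "8 * D \<le> 4 + 8 * (K * (s * u)) + (s * u + 1 + D)" using Ds KHs by linarith
    moreover have "s * u \<le> K * (s * u)" using ac \<open>0 \<le> s * u\<close> mult_right_mono[of 1 K "s * u"] by simp
    ultimately show ?thesis using \<open>0 \<le> s * u\<close> by linarith
  qed
  have fin: "K * N * (s * u + 1 + D) + C * (1 + D + u) \<le> K * (H + u)"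
  proof -
    define A where "A = K * (s * u)"
    have KN: "0 \<le> K * N" using ac by simp
    have su: "0 \<le> s * u" using s nn by simp
    have Cu: "0 \<le> C * u" using C_powers nn by simp
    have "K * N * (s * u + 1 + D) \<le> K * N * (3 + 4 * A)"
      by (rule mult_left_mono) (use D2 KN in \<open>auto simp: A_def\<close>)
    then have f1: "K * N * (s * u + 1 + D) \<le> 3 * (K * N) + 4 * (K * N * A)" by (simp only: distrib_left mult.commute mult.left_commute)
    have "C * (1 + D + u) \<le> C * (3 + 4 * A + u)"
      by (rule mult_left_mono) (use D2 su C_powers in \<open>auto simp: A_def\<close>)
    then have f2: "C * (1 + D + u) \<le> 3 * C + 4 * (C * A) + C * u" by (simp only: distrib_left mult.commute mult.left_commute)
    have "K * N * A = 1/2 * ((32 * C * N * s) * (C * u))" by (simp add: A_def K_def)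
    moreover have "(32 * C * N * s) * (C * u) \<le> 1 * (C * u)" using CNs Cu by (rule mult_right_mono)
    ultimately have f3: "K * N * A \<le> 1/2 * (C * u)" by linarith
    have "C * A = 1/32 * ((128 * (C * s)) * (C * u))" by (simp add: A_def K_def)
    moreover have "(128 * (C * s)) * (C * u) \<le> 1 * (C * u)" using Cs Cu by (rule mult_right_mono)
    ultimately have f4: "C * A \<le> 1/32 * (C * u)" by linarith
    have "K * (H + u) = 3 * (K * N) + 4 * C + 4 * (C * u)" by (simp add: K_def H_def distrib_left)
    then show ?thesis using f1 f2 f3 f4 Cu C_powers by linarith
  qed
  have "norm (y - x0) \<le> K * s * H + K * (s * u) + \<delta> * (K * N * (s * u + 1 + D) + C * (1 + D + u))"
    using i Ds by (simp add: algebra_simps)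
  also have "\<dots> \<le> K * s * H + K * (s * u) + \<delta> * (K * (H + u))" using fin \<delta> by (intro add_left_mono mult_left_mono) auto
  also have "\<dots> = K * (s + \<delta>) * (H + u)" by (simp add: algebra_simps)
  finally show ?thesis by (simp add: u_def)
qed

end

lemma norm_add_add_diff:
  fixes a b c d :: "'a::real_normed_vector"
  shows "norm (a + b + c - d) \<le> norm a + norm b + norm c + norm d"
  using norm_triangle_ineq4[of "a + b + c" d] norm_triangle_ineq[of "a + b" c] norm_triangle_ineq[of a b] by linarith

lemma norm_add_diff_add:
  fixes a b c d :: "'a::real_normed_vector"
  shows "norm (a + b - c + d) \<le> norm a + norm b + norm c + norm d"
  using norm_triangle_ineq[of "a + b - c" d] norm_triangle_ineq4[of "a + b" c] norm_triangle_ineq[of a b] by linarith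

context planning_data
begin

text \<open>\<open>x \<mapsto> U x + (x - x0)\<close> is strongly monotone and Lipschitz, so a small damped step is a contraction.\<close>
lemma monotone_lipschitz_zero:
  fixes U :: "'a \<Rightarrow> 'a"
  assumes mono: "\<And>x y. 0 \<le> inner (x - y) (U x - U y)" and L: "0 \<le> L"
    and lip: "\<And>x y. norm (U x - U y) \<le> L * norm (x - y)"
  shows "\<exists>y. U y = - (y - x0)"
proof -
  \<comment> \<open>with this step the square of the contraction factor is \<open>1 - \<theta>\<close>\<close>
  define \<theta> where "\<theta> = 1 / (L + 1)\<^sup>2"
  have th: "0 < \<theta>" "\<theta> \<le> 1" using L by (auto simp: \<theta>_def field_simps one_le_power)
  have th2: "\<theta> * (\<theta> * (L + 1)\<^sup>2) = \<theta>" using L by (simp add: \<theta>_def)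
  let ?\<phi> = "\<lambda>x. x - \<theta> *\<^sub>R (U x + (x - x0))"
  have "\<exists>!y. ?\<phi> y = y"
  proof (rule banach_fix_type[where c="sqrt (1 - \<theta>)"])
    show "\<forall>x y. dist (?\<phi> x) (?\<phi> y) \<le> sqrt (1 - \<theta>) * dist x y"
    proof (intro allI)
      fix x y
      define X D where "X = x - y" and "D = U x - U y + (x - y)"
      have "?\<phi> x - ?\<phi> y = X - \<theta> *\<^sub>R D" by (simp add: X_def D_def algebra_simps)
      moreover have "(norm (X - \<theta> *\<^sub>R D))\<^sup>2 = (norm X)\<^sup>2 - 2 * \<theta> * inner X D + \<theta> * (\<theta> * (norm D)\<^sup>2)"
        unfolding power2_norm_eq_inner by (simp add: inner_diff_left inner_diff_right inner_commute algebra_simps)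
      moreover have "\<theta> * (norm X)\<^sup>2 \<le> \<theta> * inner X D"
      proof (rule mult_left_mono)
        show "(norm X)\<^sup>2 \<le> inner X D" using mono[of x y] by (simp add: X_def D_def inner_add_right power2_norm_eq_inner)
      qed (use th in auto)
      moreover have "\<theta> * (\<theta> * (norm D)\<^sup>2) \<le> \<theta> * (norm X)\<^sup>2"
      proof -
        have "norm D \<le> (L + 1) * norm X" using norm_triangle_ineq[of "U x - U y" "x - y"] lip[of x y] by (simp add: X_def D_def algebra_simps)
        then have "(norm D)\<^sup>2 \<le> ((L + 1) * norm X)\<^sup>2" by (intro power_mono) auto
        then have "\<theta> * (\<theta> * (norm D)\<^sup>2) \<le> \<theta> * (\<theta> * ((L + 1)\<^sup>2 * (norm X)\<^sup>2))" using th by (intro mult_left_mono) (auto simp: power_mult_distrib)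
        also have "\<dots> = (\<theta> * (\<theta> * (L + 1)\<^sup>2)) * (norm X)\<^sup>2" by simp
        finally show ?thesis unfolding th2 .
      qed
      moreover have "(1 - \<theta>) * (norm X)\<^sup>2 = (norm X)\<^sup>2 - \<theta> * (norm X)\<^sup>2" by (simp add: algebra_simps)
      ultimately have "(norm (?\<phi> x - ?\<phi> y))\<^sup>2 \<le> (1 - \<theta>) * (norm X)\<^sup>2" by simp
      then have "sqrt ((norm (?\<phi> x - ?\<phi> y))\<^sup>2) \<le> sqrt ((1 - \<theta>) * (norm X)\<^sup>2)" by (rule real_sqrt_le_mono)
      then show "dist (?\<phi> x) (?\<phi> y) \<le> sqrt (1 - \<theta>) * dist x y" by (simp add: dist_norm X_def real_sqrt_mult)
    qed
  qed (use th in auto)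
  then obtain y where "?\<phi> y = y" by blast
  then have "U y + (y - x0) = 0" using th by simp
  then show ?thesis by (intro exI[of _ y]) (simp only: eq_neg_iff_add_eq_0)
qed

text \<open>Once the Lipschitz constant is bounded, the value at \<open>x0\<close> obeys a discrete Gronwall
  inequality.\<close>
lemma growth_step:
  assumes st: "euler_step \<delta> U V" and \<delta>: "0 \<le> \<delta>" "M * \<delta> \<le> 1" and L: "1 \<le> L" "M * L * \<delta> \<le> 1 / 2"
    and lip: "\<And>x y. norm (U x - U y) \<le> L * norm (x - y)"
  shows "1 + norm (V x0) \<le> (1 + norm (U x0)) * (1 + 4 * (M * L * \<delta>))"
proof -
  define \<kappa> where "\<kappa> = lam * \<delta>"
  note kb = kappa_bounds[OF \<delta>, folded \<kappa>_def]
  obtain x where x: "x0 = x + (\<delta> / (1 + \<kappa>)) *\<^sub>R F (x, V x0)"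
     "(1 + \<kappa>) *\<^sub>R V x0 = U x + \<delta> *\<^sub>R G (x, V x0) + \<kappa> *\<^sub>R S' (U (T x))"
     "norm (x0 - x) \<le> \<delta> * (C * (1 + norm (x - x0) + norm (V x0)))"
    by (rule euler_stepE[OF st \<delta>(1), of x0, folded \<kappa>_def])
  define D u m v where "D = norm (x - x0)" and "u = norm (V x0)" and "m = norm (U x0)" and "v = 1 + u"
  have nn: "0 \<le> D" "0 \<le> u" "0 \<le> m" "1 \<le> v" by (auto simp: D_def u_def m_def v_def)
  define d where "d = C * \<delta>"
  have d: "0 \<le> d" "d \<le> 1/8" using kb C_powers \<delta> by (auto simp: d_def)
  have D1: "D \<le> d * (1 + D + u)" using x(3) by (simp add: D_def u_def d_def norm_minus_commute mult_ac)
  have D2: "D \<le> v"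
  proof -
    have "8 * d * (1 + D + u) \<le> 1 * (1 + D + u)" using d nn by (intro mult_right_mono) auto
    then have "8 * (d * (1 + D + u)) \<le> 1 + D + u" by (simp only: mult.assoc mult_1)
    then have "8 * D \<le> 1 + D + u" using D1 by linarith
    then show ?thesis using nn by (simp add: v_def)
  qed
  have D3: "D \<le> 2 * d * v"
  proof -
    have "d * (1 + D + u) \<le> d * (2 * v)" using D2 d by (intro mult_left_mono) (auto simp: v_def)
    then show ?thesis using D1 by simp
  qed
  have Ux: "norm (U x) \<le> m + L * D"
    using norm_triangle_ineq2[of "U x" "U x0"] lip[of x x0] by (simp add: m_def D_def)
  have UT: "norm (U (T x)) \<le> m + L * (3 * C * v)"
  proof -
    have "norm (T x - x0) \<le> norm (T x - x) + norm (x - x0)" using norm_triangle_ineq[of "T x - x" "x - x0"] by simp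
    also have "\<dots> \<le> C * (1 + D) + D" using T_growth[of x] by (simp add: D_def)
    also have "\<dots> \<le> C * (2 * v) + C * v" using D2 nn C by (intro add_mono mult_left_mono) (auto intro: order_trans[OF D2] simp: v_def)
    finally have "norm (T x - x0) \<le> 3 * C * v" by simp
    then have "L * norm (T x - x0) \<le> L * (3 * C * v)" using L by (intro mult_left_mono) auto
    then show ?thesis using norm_triangle_ineq2[of "U (T x)" "U x0"] lip[of "T x" x0] unfolding m_def by linarith
  qed
  have "u \<le> (1 + \<kappa>) * u" using kb(1) nn mult_right_mono[of 1 "1 + \<kappa>" u] by simp
  also have "\<dots> = norm ((1 + \<kappa>) *\<^sub>R V x0)" using kb(1) by (simp add: u_def)
  also have "\<dots> \<le> norm (U x) + norm (\<delta> *\<^sub>R G (x, V x0)) + norm (\<kappa> *\<^sub>R S' (U (T x)))"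
    unfolding x(2) by (intro norm_triangle_le add_mono norm_triangle_ineq order_refl)
  also have "\<dots> = norm (U x) + \<delta> * norm (G (x, V x0)) + \<kappa> * norm (S' (U (T x)))" using \<delta> kb(1) by simp
  also have "\<dots> \<le> (m + L * (2 * d * v)) + \<delta> * (C * (2 * v)) + (C * \<delta>) * (C * (m + L * (3 * C * v)))"
  proof (intro add_mono)
    have "L * D \<le> L * (2 * d * v)" using D3 L by (intro mult_left_mono) auto
    then show "norm (U x) \<le> m + L * (2 * d * v)" using Ux by linarith
    have "C * (1 + norm (x - x0) + norm (V x0)) \<le> C * (2 * v)" using D2 C_powers by (intro mult_left_mono) (auto simp: D_def u_def v_def)
    then have "norm (G (x, V x0)) \<le> C * (2 * v)" using G_growth order_trans by blast
    then show "\<delta> * norm (G (x, V x0)) \<le> \<delta> * (C * (2 * v))" using \<delta>(1) by (rule mult_left_mono)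
    have "norm (S' (U (T x))) \<le> C * norm (U (T x))" by (rule S'_bound)
    also have "\<dots> \<le> C * (m + L * (3 * C * v))" using UT C_powers by (intro mult_left_mono) auto
    finally show "\<kappa> * norm (S' (U (T x))) \<le> (C * \<delta>) * (C * (m + L * (3 * C * v)))"
      using kb(1,2) by (intro mult_mono) auto
  qed
  also have "\<dots> = m + \<delta> * v * (2 * C * L + 2 * C + 3 * (C^3 * L)) + \<delta> * (C^2 * m)"
    by (simp add: d_def power2_eq_square power3_eq_cube algebra_simps)
  also have "\<dots> \<le> m + \<delta> * v * (8 * (C^3 * L)) + \<delta> * ((8 * (C^3 * L)) * m)"
  proof (intro add_mono mult_left_mono mult_right_mono order_refl)
    have "C * L \<le> C^3 * L" using C_powers L by (intro mult_right_mono) auto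
    moreover have "C * 1 \<le> C^3 * L" using C_powers L by (intro mult_mono) auto
    ultimately show "2 * C * L + 2 * C + 3 * (C^3 * L) \<le> 8 * (C^3 * L)" using L C_powers by linarith
    have "C^2 * 1 \<le> C^3 * L" using C_powers L by (intro mult_mono) auto
    moreover have "0 \<le> C^3 * L" using C_powers L by simp
    ultimately show "C^2 \<le> 8 * (C^3 * L)" by linarith
  qed (use \<delta> nn in auto)
  also have "\<dots> = m + M * L * \<delta> * (v + m)" by (simp add: M_def algebra_simps)
  finally have fin: "u \<le> m + M * L * \<delta> * (v + m)" .
  define q where "q = M * L * \<delta>"
  have q: "0 \<le> q" "q \<le> 1/2" using L M_pos \<delta> by (auto simp: q_def)
  have "v \<le> 1 + m + (q * v + q * m)" using fin by (simp add: q_def[symmetric] v_def distrib_left)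
  moreover have "v * (1 - q) = v - q * v" "(1 + m) * (1 + q) = 1 + m + q + q * m" by (simp_all add: algebra_simps)
  ultimately have "v * (1 - q) \<le> (1 + m) * (1 + q)" using q by linarith
  also have "\<dots> \<le> (1 + m) * ((1 - q) * (1 + 4 * q))"
  proof (rule mult_left_mono)
    have "0 \<le> 2 * q * (1 - 2 * q)" using q by simp
    then show "1 + q \<le> (1 - q) * (1 + 4 * q)" by (simp add: algebra_simps)
  qed (use nn in auto)
  finally have "v * (1 - q) \<le> ((1 + m) * (1 + 4 * q)) * (1 - q)" by (simp only: mult_ac)
  then have "v \<le> (1 + m) * (1 + 4 * q)" using q by simp
  then show ?thesis by (simp add: v_def u_def m_def q_def)
qed

text \<open>Constants of the bounds for increments in time, for the consistency error of one step, and
  for that of several steps, when all functions are tame with constant \<open>Q\<close>.\<close>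
definition Q1 :: "real \<Rightarrow> real" where "Q1 Q = 11 * C^3 * Q^2"
definition Q2 :: "real \<Rightarrow> real" where "Q2 Q = 13 * C * Q^2 * Q1 Q"
definition Q3 :: "real \<Rightarrow> real" where "Q3 Q = 11 * C^3 * Q * Q1 Q + 3 * C * Q * Q2 Q"

text \<open>Affine growth around \<open>x0\<close> and a Lipschitz bound; the remaining estimates are uniform in the
  scheme as long as the functions are tame with the same constant.\<close>
definition tame :: "real \<Rightarrow> ('a \<Rightarrow> 'a) \<Rightarrow> bool" where
  "tame Q U \<longleftrightarrow> (\<forall>x y. norm (U x - U y) \<le> Q * norm (x - y)) \<and> (\<forall>x. norm (U x) \<le> Q * (1 + norm (x - x0)))"

lemma tame_lip: "tame Q U \<Longrightarrow> norm (U x - U y) \<le> Q * norm (x - y)"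
  and tame_growth: "tame Q U \<Longrightarrow> norm (U x) \<le> Q * (1 + norm (x - x0))"
  by (auto simp: tame_def)

lemma T_growth': "1 + norm (T x - x0) \<le> 2 * C * (1 + norm (x - x0))"
proof -
  have "norm (T x - x0) \<le> norm (T x - x) + norm (x - x0)" using norm_triangle_ineq[of "T x - x" "x - x0"] by simp
  moreover have "1 * (1 + norm (x - x0)) \<le> C * (1 + norm (x - x0))" using C by (intro mult_right_mono) auto
  ultimately show ?thesis using T_growth[of x] by (simp add: algebra_simps)
qed

lemma euler_step_displacement:
  assumes x: "norm (z - x) \<le> \<delta> * (C * (1 + norm (x - x0) + norm (V z)))"
    and \<delta>: "0 \<le> \<delta>" "M * \<delta> \<le> 1" and Q: "1 \<le> Q" and V: "tame Q V"
  shows "norm (z - x) \<le> 3 * (C * Q) * (\<delta> * (1 + norm (z - x0)))"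
    and "1 + norm (x - x0) \<le> 2 * Q * (1 + norm (z - x0))"
proof -
  note kb = kappa_bounds[OF \<delta>]
  define e w where "e = norm (z - x)" and "w = 1 + norm (z - x0)"
  have "1 \<le> w" by (simp add: w_def)
  then have w1: "1 \<le> w" "w \<le> Q * w" using mult_right_mono[OF Q, of w] by auto
  have xw: "1 + norm (x - x0) \<le> w + e" using norm_triangle_ineq[of "x - z" "z - x0"] by (simp add: e_def w_def norm_minus_commute)
  have e0: "0 \<le> e" by (simp add: e_def)
  have "e \<le> \<delta> * (C * (1 + norm (x - x0) + norm (V z)))" using x by (simp add: e_def)
  also have "\<dots> \<le> \<delta> * (C * ((w + e) + Q * w))"
    using \<delta>(1) C_powers xw tame_growth[OF V, of z] by (intro mult_left_mono) (auto simp: w_def)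
  also have "\<dots> = \<delta> * C * (w + Q * w) + (C * \<delta>) * e" by (simp add: algebra_simps)
  also have "\<dots> \<le> \<delta> * C * (2 * (Q * w)) + 1/8 * e"
    using \<delta> C_powers w1 kb e0 by (intro add_mono mult_left_mono mult_right_mono) auto
  finally have "7 * e \<le> 16 * (C * Q * (\<delta> * w))" by (simp add: algebra_simps)
  moreover have p0: "0 \<le> C * Q * (\<delta> * w)" using C_powers Q \<delta> w1 by simp
  ultimately have e: "e \<le> 3 * (C * Q * (\<delta> * w))" by linarith
  then show "norm (z - x) \<le> 3 * (C * Q) * (\<delta> * (1 + norm (z - x0)))" by (simp add: e_def w_def)
  have "C * Q * (\<delta> * w) = (C * \<delta>) * (Q * w)" by simp
  also have "\<dots> \<le> 1/8 * (Q * w)" using kb Q w1 by (intro mult_right_mono) auto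
  finally have "8 * (C * Q * (\<delta> * w)) \<le> Q * w" by simp
  then have "w + e \<le> 2 * (Q * w)" using e w1 p0 by linarith
  then show "1 + norm (x - x0) \<le> 2 * Q * (1 + norm (z - x0))" using xw by (simp add: w_def)
qed

lemma Q_facts:
  assumes Q: "1 \<le> Q"
  shows "11 * (C * Q^2) \<le> Q1 Q" "1 \<le> Q1 Q" "0 \<le> Q2 Q" "C * Q \<le> C * Q^2" "0 < C * Q" "Q \<le> Q^2"
    "8 * (C^3 * Q^2) \<le> Q1 Q"
proof -
  have q: "1 \<le> Q^2" "Q \<le> Q^2" using Q mult_left_mono[OF Q, of Q] one_le_power[OF Q, of 2] by (auto simp: power2_eq_square)
  show "Q \<le> Q^2" by fact
  have cq: "C * Q^2 \<le> C^3 * Q^2" using C_powers q by (intro mult_right_mono) auto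
  show "11 * (C * Q^2) \<le> Q1 Q" using cq by (simp add: Q1_def)
  have "1 * 1 \<le> C^3 * Q^2" using C_powers q by (intro mult_mono) auto
  then show 1: "1 \<le> Q1 Q" unfolding Q1_def by linarith
  show "0 \<le> Q2 Q" unfolding Q2_def using 1 C_powers q by simp
  show "C * Q \<le> C * Q^2" using q C_powers by (intro mult_left_mono) auto
  show "0 < C * Q" using C_powers Q by simp
  show "8 * (C^3 * Q^2) \<le> Q1 Q" using C_powers q by (simp add: Q1_def)
qed

lemma euler_step_increment:
  assumes st: "euler_step \<delta> U V" and \<delta>: "0 \<le> \<delta>" "M * \<delta> \<le> 1" and Q: "1 \<le> Q" and U: "tame Q U" and V: "tame Q V"
  shows "norm (V z - U z) \<le> Q1 Q * (\<delta> * (1 + norm (z - x0)))"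
proof -
  define \<kappa> where "\<kappa> = lam * \<delta>"
  note kb = kappa_bounds[OF \<delta>, folded \<kappa>_def]
  obtain x where x: "z = x + (\<delta> / (1 + \<kappa>)) *\<^sub>R F (x, V z)"
     "(1 + \<kappa>) *\<^sub>R V z = U x + \<delta> *\<^sub>R G (x, V z) + \<kappa> *\<^sub>R S' (U (T x))"
     "norm (z - x) \<le> \<delta> * (C * (1 + norm (x - x0) + norm (V z)))"
    by (rule euler_stepE[OF st \<delta>(1), of z, folded \<kappa>_def])
  define w where "w = 1 + norm (z - x0)"
  have w: "1 \<le> w" by (simp add: w_def)
  note dis = euler_step_displacement[OF x(3) \<delta> Q V, folded w_def]
  have Vz: "norm (V z) \<le> Q * w" using tame_growth[OF V] by (simp add: w_def)
  have UT: "norm (S' (U (T x))) \<le> C * (Q * (2 * C * (2 * Q * w)))"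
  proof -
    have "norm (S' (U (T x))) \<le> C * norm (U (T x))" by (rule S'_bound)
    also have "\<dots> \<le> C * (Q * (1 + norm (T x - x0)))" using C_powers by (intro mult_left_mono tame_growth[OF U]) auto
    also have "\<dots> \<le> C * (Q * (2 * C * (1 + norm (x - x0))))" using C_powers Q by (intro mult_left_mono T_growth') auto
    also have "\<dots> \<le> C * (Q * (2 * C * (2 * Q * w)))" using C_powers Q dis(2) by (intro mult_left_mono) auto
    finally show ?thesis .
  qed
  have "V z - U z = (U x - U z) + \<delta> *\<^sub>R G (x, V z) + \<kappa> *\<^sub>R S' (U (T x)) - \<kappa> *\<^sub>R V z"
    using x(2) by (simp add: algebra_simps)
  then have "norm (V z - U z) \<le> norm (U x - U z) + norm (\<delta> *\<^sub>R G (x, V z)) + norm (\<kappa> *\<^sub>R S' (U (T x))) + norm (\<kappa> *\<^sub>R V z)"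
    by (simp only:) (rule norm_add_add_diff)
  also have "\<dots> = norm (U x - U z) + \<delta> * norm (G (x, V z)) + \<kappa> * norm (S' (U (T x))) + \<kappa> * norm (V z)"
    using \<delta> kb(1) by simp
  also have "\<dots> \<le> Q * (3 * (C * Q) * (\<delta> * w)) + \<delta> * (C * (2 * Q * w + Q * w)) + (C * \<delta>) * (C * (Q * (2 * C * (2 * Q * w)))) + (C * \<delta>) * (Q * w)"
  proof (intro add_mono)
    have "norm (U x - U z) \<le> Q * norm (z - x)" using tame_lip[OF U, of x z] by (simp add: norm_minus_commute)
    also have "\<dots> \<le> Q * (3 * (C * Q) * (\<delta> * w))" using dis(1) Q by (intro mult_left_mono) auto
    finally show "norm (U x - U z) \<le> Q * (3 * (C * Q) * (\<delta> * w))" .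
    have "norm (G (x, V z)) \<le> C * (1 + norm (x - x0) + norm (V z))" by (rule G_growth)
    also have "\<dots> \<le> C * (2 * Q * w + Q * w)" using C_powers dis(2) Vz by (intro mult_left_mono add_mono) auto
    finally show "\<delta> * norm (G (x, V z)) \<le> \<delta> * (C * (2 * Q * w + Q * w))" using \<delta>(1) by (rule mult_left_mono)
    show "\<kappa> * norm (S' (U (T x))) \<le> (C * \<delta>) * (C * (Q * (2 * C * (2 * Q * w))))" using kb(1,2) UT by (intro mult_mono) auto
    show "\<kappa> * norm (V z) \<le> (C * \<delta>) * (Q * w)" using kb(1,2) Vz by (intro mult_mono) auto
  qed
  also have "\<dots> = (3 * (C * Q^2) + 4 * (C * Q) + 4 * (C^3 * Q^2)) * (\<delta> * w)"
    by (simp add: power2_eq_square power3_eq_cube algebra_simps)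
  also have "\<dots> \<le> Q1 Q * (\<delta> * w)"
  proof (rule mult_right_mono)
    have "C * Q^2 \<le> C^3 * Q^2" using C_powers by (intro mult_right_mono) auto
    then show "3 * (C * Q^2) + 4 * (C * Q) + 4 * (C^3 * Q^2) \<le> Q1 Q" using Q_facts(4)[OF Q] by (simp add: Q1_def)
  qed (use \<delta> w in auto)
  finally show ?thesis by (simp add: w_def)
qed

text \<open>The right-hand side of the equation along a characteristic.\<close>
definition rhs :: "('a \<Rightarrow> 'a) \<Rightarrow> 'a \<Rightarrow> 'a" where
  "rhs U z = G (z, U z) - lam *\<^sub>R U z + lam *\<^sub>R S' (U (T z))"

text \<open>The characteristic through \<open>z\<close> is compared with the trajectory of the scheme that ends at
  \<open>z + \<delta> F(z, U z)\<close>: its starting point differs from \<open>z\<close> by \<open>O(\<delta>\<^sup>2)\<close>, and all other differences are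
  of order \<open>\<delta>\<close> and are multiplied by \<open>\<delta>\<close>.\<close>
lemma euler_step_consistent:
  assumes st: "euler_step \<delta> U V" and \<delta>: "0 \<le> \<delta>" "M * \<delta> \<le> 1" and Q: "1 \<le> Q" and U: "tame Q U" and V: "tame Q V"
  shows "norm (V (z + \<delta> *\<^sub>R F (z, U z)) - U z - \<delta> *\<^sub>R rhs U z) \<le> Q2 Q * (\<delta>\<^sup>2 * (1 + norm (z - x0)))"
proof -
  define \<kappa> where "\<kappa> = lam * \<delta>"
  note kb = kappa_bounds[OF \<delta>, folded \<kappa>_def]
  note qf = Q_facts[OF Q]
  define f where "f = F (z, U z)"
  define y where "y = z + \<delta> *\<^sub>R f"
  obtain x where x: "y = x + (\<delta> / (1 + \<kappa>)) *\<^sub>R F (x, V y)"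
     "(1 + \<kappa>) *\<^sub>R V y = U x + \<delta> *\<^sub>R G (x, V y) + \<kappa> *\<^sub>R S' (U (T x))"
     "norm (y - x) \<le> \<delta> * (C * (1 + norm (x - x0) + norm (V y)))"
    by (rule euler_stepE[OF st \<delta>(1), of y, folded \<kappa>_def])
  define w where "w = 1 + norm (z - x0)"
  have w: "1 \<le> w" by (simp add: w_def)
  define dw where "dw = \<delta> * w"
  have dw: "0 \<le> dw" using \<delta> w by (simp add: dw_def)
  have Qw: "w \<le> Q * w" using Q w by simp
  have f: "norm f \<le> 2 * (C * Q) * w"
  proof -
    have "norm f \<le> C * (1 + norm (z - x0) + norm (U z))" unfolding f_def by (rule F_growth)
    also have "\<dots> \<le> C * (Q * w + Q * w)" using C_powers Qw tame_growth[OF U, of z] by (intro mult_left_mono add_mono) (auto simp: w_def)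
    finally show ?thesis by simp
  qed
  have yz: "norm (y - z) \<le> 2 * (C * Q) * dw"
    using mult_left_mono[OF f \<delta>(1)] \<delta>(1) by (simp add: y_def dw_def mult_ac)
  have wy: "1 + norm (y - x0) \<le> 2 * Q * w"
  proof -
    have "8 * ((C * \<delta>) * (Q * w)) \<le> Q * w" using mult_right_mono[OF kb(6), of "Q * w"] Q w by simp
    then have "2 * (C * Q) * dw \<le> Q * w" using Q w by (simp add: dw_def mult_ac)
    moreover have "norm (y - x0) \<le> norm (y - z) + norm (z - x0)" using norm_triangle_ineq[of "y - z" "z - x0"] by simp
    ultimately show ?thesis using yz Qw unfolding w_def by linarith
  qed
  have uU: "norm (V y - U z) \<le> 3 * (Q * Q1 Q) * dw"
  proof -
    have "norm (V y - U z) \<le> norm (V y - U y) + norm (U y - U z)" using norm_triangle_ineq[of "V y - U y" "U y - U z"] by simp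
    also have "\<dots> \<le> Q1 Q * (\<delta> * (1 + norm (y - x0))) + Q * norm (y - z)"
      by (intro add_mono euler_step_increment[OF st \<delta> Q U V] tame_lip[OF U])
    also have "\<dots> \<le> Q1 Q * (\<delta> * (2 * Q * w)) + Q * (2 * (C * Q) * dw)"
      using wy yz Q \<delta> qf by (intro add_mono mult_left_mono) auto
    also have "\<dots> = (2 * (Q * Q1 Q) + 2 * (C * Q^2)) * dw" by (simp add: dw_def power2_eq_square algebra_simps)
    also have "\<dots> \<le> (3 * (Q * Q1 Q)) * dw"
    proof (rule mult_right_mono)
      have "1 * Q1 Q \<le> Q * Q1 Q" using Q qf by (intro mult_right_mono) auto
      moreover have "0 \<le> C * Q^2" using C_powers by simp
      ultimately show "2 * (Q * Q1 Q) + 2 * (C * Q^2) \<le> 3 * (Q * Q1 Q)" using qf(1) by linarith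
    qed (rule dw)
    finally show ?thesis .
  qed
  have xz: "norm (x - z) \<le> 8 * (C * Q^2) * dw"
  proof -
    have "norm (y - x) \<le> 3 * (C * Q) * (\<delta> * (1 + norm (y - x0)))" by (rule euler_step_displacement[OF x(3) \<delta> Q V])
    also have "\<dots> \<le> 3 * (C * Q) * (\<delta> * (2 * Q * w))" using wy \<delta> C_powers Q by (intro mult_left_mono) auto
    also have "\<dots> = 6 * (C * Q^2) * dw" by (simp add: dw_def power2_eq_square)
    finally have 1: "norm (y - x) \<le> 6 * (C * Q^2) * dw" .
    have "2 * (C * Q) * dw \<le> 2 * (C * Q^2) * dw" using qf(4) dw by (intro mult_right_mono) auto
    moreover have "norm (x - z) \<le> norm (y - x) + norm (y - z)" using norm_triangle_ineq4[of "y - z" "y - x"] by simp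
    ultimately show ?thesis using 1 yz by (simp add: algebra_simps)
  qed
  define e where "e = C * Q * Q1 Q"
  have e8: "8 * (C^2 * Q^2) \<le> e" "8 * (C^4 * Q^3) \<le> e" "2 * (C^2 * Q) \<le> e" "0 \<le> e"
  proof -
    have CQ: "1 \<le> C * Q" using mult_mono[of 1 C 1 Q] C Q by simp
    have a: "8 * (C^3 * Q^2) * (C * Q) \<le> Q1 Q * (C * Q)" using qf(7) qf(5) by (intro mult_right_mono) auto
    then show c4: "8 * (C^4 * Q^3) \<le> e" by (simp add: e_def power2_eq_square power3_eq_cube eval_nat_numeral mult_ac)
    have "C^2 * Q^2 \<le> C^4 * Q^3" using C Q by (intro mult_mono power_increasing) auto
    then show c2: "8 * (C^2 * Q^2) \<le> e" using c4 by linarith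
    have "C^2 * Q \<le> C^2 * Q^2" using qf(6) by (intro mult_left_mono) auto
    moreover have "0 \<le> C^2 * Q^2" by simp
    ultimately show "2 * (C^2 * Q) \<le> e" using c2 by linarith
    show "0 \<le> e" unfolding e_def using qf Q C_powers by simp
  qed
  have lipb: "C * (norm (x - z) + norm (V y - U z)) \<le> 4 * e * dw"
  proof -
    have "C * (norm (x - z) + norm (V y - U z)) \<le> C * (8 * (C * Q^2) * dw + 3 * (Q * Q1 Q) * dw)"
      using xz uU C_powers by (intro mult_left_mono add_mono) auto
    also have "\<dots> = (8 * (C^2 * Q^2) + 3 * e) * dw" by (simp add: e_def power2_eq_square algebra_simps)
    also have "\<dots> \<le> (4 * e) * dw" using e8 dw by (intro mult_right_mono) auto
    finally show ?thesis .
  qed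
  define \<delta>' where "\<delta>' = \<delta> / (1 + \<kappa>)"
  have \<delta>': "0 \<le> \<delta>'" "\<delta>' \<le> \<delta>" using \<delta> kb(1) by (auto simp: \<delta>'_def field_simps)
  have xz2: "norm (x - z) \<le> 5 * e * (\<delta> * dw)"
  proof -
    have "x - z = \<delta> *\<^sub>R f - \<delta>' *\<^sub>R F (x, V y)" using x(1) by (simp add: y_def \<delta>'_def algebra_simps)
    also have "\<dots> = (\<delta> - \<delta>') *\<^sub>R f - \<delta>' *\<^sub>R (F (x, V y) - f)" by (simp add: algebra_simps)
    finally have "norm (x - z) \<le> norm ((\<delta> - \<delta>') *\<^sub>R f) + norm (\<delta>' *\<^sub>R (F (x, V y) - f))" by (simp only: norm_triangle_ineq4)
    also have "\<dots> = (\<delta> - \<delta>') * norm f + \<delta>' * norm (F (x, V y) - F (z, U z))" using \<delta>' by (simp add: f_def)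
    also have "\<dots> \<le> (C * \<delta> * \<delta>) * (2 * (C * Q) * w) + \<delta> * (4 * e * dw)"
    proof (intro add_mono mult_mono f)
      have "\<delta> - \<delta>' = \<kappa> * \<delta>'" using kb(1) by (simp add: \<delta>'_def field_simps)
      also have "\<dots> \<le> (C * \<delta>) * \<delta>" using kb \<delta>' by (intro mult_mono) auto
      finally show "\<delta> - \<delta>' \<le> C * \<delta> * \<delta>" .
      show "norm (F (x, V y) - F (z, U z)) \<le> 4 * e * dw" using F_lip lipb order_trans by blast
    qed (use \<delta> \<delta>' C_powers in auto)
    also have "\<dots> = (2 * (C^2 * Q) + 4 * e) * (\<delta> * dw)" by (simp add: dw_def power2_eq_square algebra_simps)
    also have "\<dots> \<le> (5 * e) * (\<delta> * dw)" using e8 dw \<delta> by (intro mult_right_mono) auto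
    finally show ?thesis .
  qed
  have "V y - U z - \<delta> *\<^sub>R rhs U z = (U x - U z) + \<delta> *\<^sub>R (G (x, V y) - G (z, U z)) - \<kappa> *\<^sub>R (V y - U z) + \<kappa> *\<^sub>R S' (U (T x) - U (T z))"
    using x(2) by (simp add: rhs_def \<kappa>_def S'_diff[symmetric] algebra_simps)
  then have "norm (V y - U z - \<delta> *\<^sub>R rhs U z) \<le> norm (U x - U z) + norm (\<delta> *\<^sub>R (G (x, V y) - G (z, U z))) + norm (\<kappa> *\<^sub>R (V y - U z)) + norm (\<kappa> *\<^sub>R S' (U (T x) - U (T z)))"
    by (simp only:) (rule norm_add_diff_add)
  also have "\<dots> = norm (U x - U z) + \<delta> * norm (G (x, V y) - G (z, U z)) + \<kappa> * norm (V y - U z) + \<kappa> * norm (S' (U (T x) - U (T z)))"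
    using \<delta> kb(1) by simp
  also have "\<dots> \<le> Q * (5 * e * (\<delta> * dw)) + \<delta> * (4 * e * dw) + (C * \<delta>) * (3 * (Q * Q1 Q) * dw) + (C * \<delta>) * (C * (Q * (C * (8 * (C * Q^2) * dw))))"
  proof (intro add_mono)
    have "norm (U x - U z) \<le> Q * norm (x - z)" by (rule tame_lip[OF U])
    also have "\<dots> \<le> Q * (5 * e * (\<delta> * dw))" using xz2 Q by (intro mult_left_mono) auto
    finally show "norm (U x - U z) \<le> Q * (5 * e * (\<delta> * dw))" .
    have "norm (G (x, V y) - G (z, U z)) \<le> 4 * e * dw" using G_lip lipb order_trans by blast
    then show "\<delta> * norm (G (x, V y) - G (z, U z)) \<le> \<delta> * (4 * e * dw)" using \<delta>(1) by (rule mult_left_mono)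
    show "\<kappa> * norm (V y - U z) \<le> (C * \<delta>) * (3 * (Q * Q1 Q) * dw)" using kb(1,2) uU by (intro mult_mono) auto
    have "norm (S' (U (T x) - U (T z))) \<le> C * norm (U (T x) - U (T z))" by (rule S'_bound)
    also have "\<dots> \<le> C * (Q * norm (T x - T z))" using C_powers by (intro mult_left_mono tame_lip[OF U]) auto
    also have "\<dots> \<le> C * (Q * (C * norm (x - z)))" unfolding T_diff using C_powers Q by (intro mult_left_mono S_bound) auto
    also have "\<dots> \<le> C * (Q * (C * (8 * (C * Q^2) * dw)))" using C_powers Q xz by (intro mult_left_mono) auto
    finally show "\<kappa> * norm (S' (U (T x) - U (T z))) \<le> (C * \<delta>) * (C * (Q * (C * (8 * (C * Q^2) * dw))))" using kb(1,2) by (intro mult_mono) auto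
  qed
  also have "\<dots> = (5 * (Q * e) + 7 * e + 8 * (C^4 * Q^3)) * (\<delta> * dw)"
    by (simp add: e_def eval_nat_numeral algebra_simps)
  also have "\<dots> \<le> (13 * (Q * e)) * (\<delta> * dw)"
  proof (rule mult_right_mono)
    have "1 * e \<le> Q * e" using Q e8 by (intro mult_right_mono) auto
    then show "5 * (Q * e) + 7 * e + 8 * (C^4 * Q^3) \<le> 13 * (Q * e)" using e8(2) by linarith
  qed (use \<delta> dw in auto)
  also have "\<dots> = Q2 Q * (\<delta>\<^sup>2 * w)" by (simp add: Q2_def e_def dw_def power2_eq_square algebra_simps)
  finally show ?thesis by (simp add: w_def y_def f_def)
qed

end

context planning_data
begin

lemma tame_chain_increment:
  assumes \<delta>: "0 \<le> \<delta>" "M * \<delta> \<le> 1" and Q: "1 \<le> Q"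
    and st: "\<And>i. i < j \<Longrightarrow> euler_step \<delta> (W i) (W (Suc i))"
    and tame: "\<And>i. i \<le> j \<Longrightarrow> tame Q (W i)"
  shows "i \<le> j \<Longrightarrow> norm (W i z - W 0 z) \<le> Q1 Q * (real i * \<delta> * (1 + norm (z - x0)))"
proof (induction i)
  case 0
  then show ?case by simp
next
  case (Suc i)
  have "norm (W (Suc i) z - W 0 z) \<le> norm (W (Suc i) z - W i z) + norm (W i z - W 0 z)"
    using norm_triangle_ineq[of "W (Suc i) z - W i z" "W i z - W 0 z"] by simp
  also have "\<dots> \<le> Q1 Q * (\<delta> * (1 + norm (z - x0))) + Q1 Q * (real i * \<delta> * (1 + norm (z - x0)))"
    using Suc by (intro add_mono euler_step_increment[OF st \<delta> Q tame tame] Suc.IH) auto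
  finally show ?case by (simp add: algebra_simps)
qed

text \<open>Summing the one-step errors along the straight line \<open>x + i \<delta> F(x, W 0 x)\<close>.  At step \<open>i\<close> both the
  velocity and the right-hand side have changed by \<open>O(i \<delta>)\<close>, and \<open>\<Sum> (i + 1) \<delta>\<^sup>2\<close> is at most the square
  of the elapsed time.\<close>
lemma tame_chain_consistent:
  assumes \<delta>: "0 \<le> \<delta>" "M * \<delta> \<le> 1" and Q: "1 \<le> Q"
    and st: "\<And>i. i < j \<Longrightarrow> euler_step \<delta> (W i) (W (Suc i))"
    and tame: "\<And>i. i \<le> j \<Longrightarrow> tame Q (W i)" and j: "real j * \<delta> \<le> 1"
  shows "i \<le> j \<Longrightarrow> norm (W i (x + (real i * \<delta>) *\<^sub>R F (x, W 0 x)) - W 0 x - (real i * \<delta>) *\<^sub>R rhs (W 0) x)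
     \<le> Q3 Q * ((real i * \<delta>)\<^sup>2 * (1 + norm (x - x0)))"
proof (induction i)
  case 0
  then show ?case by simp
next
  case (Suc i)
  note qf = Q_facts[OF Q]
  define f w z y where "f = F (x, W 0 x)" and "w = 1 + norm (x - x0)"
    and "z = x + (real i * \<delta>) *\<^sub>R f" and "y = z + \<delta> *\<^sub>R F (z, W i z)"
  have w: "1 \<le> w" by (simp add: w_def)
  have Qw: "w \<le> Q * w" using mult_right_mono[OF Q, of w] w by simp
  have ij: "i < j" "i \<le> j" "Suc i \<le> j" using Suc.prems by auto
  define h where "h = real i * \<delta>"
  have h: "0 \<le> h" "h \<le> 1"
  proof -
    show "0 \<le> h" using \<delta> by (simp add: h_def)
    have "h \<le> real j * \<delta>" unfolding h_def using \<delta> ij by (intro mult_right_mono) auto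
    then show "h \<le> 1" using j by simp
  qed
  have hw: "0 \<le> h * w" using h w by simp
  have f: "norm f \<le> 2 * (C * Q) * w"
  proof -
    have "norm f \<le> C * (1 + norm (x - x0) + norm (W 0 x))" unfolding f_def by (rule F_growth)
    also have "\<dots> \<le> C * (Q * w + Q * w)" using C_powers Qw tame_growth[OF tame[of 0], of x] by (intro mult_left_mono add_mono) (auto simp: w_def)
    finally show ?thesis by simp
  qed
  have zx: "norm (z - x) \<le> 2 * (C * Q) * (h * w)"
    using mult_left_mono[OF f h(1)] h by (simp add: z_def h_def mult_ac)
  have CQ: "1 \<le> C * Q" using mult_mono[of 1 C 1 Q] C Q by simp
  have zx1: "norm (z - x) \<le> Q1 Q * (h * w)"
  proof -
    have "2 * (C * Q) \<le> Q1 Q" using qf(1,4) CQ by linarith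
    then have "2 * (C * Q) * (h * w) \<le> Q1 Q * (h * w)" using hw by (rule mult_right_mono)
    then show ?thesis using zx by linarith
  qed
  have wz: "1 + norm (z - x0) \<le> 3 * (C * Q) * w"
  proof -
    have "2 * (C * Q) * (h * w) \<le> 2 * (C * Q) * (1 * w)" using h w CQ by (intro mult_left_mono mult_right_mono) auto
    moreover have "1 * w \<le> (C * Q) * w" using CQ w by (intro mult_right_mono) auto
    moreover have "1 + norm (z - x0) \<le> norm (z - x) + w" using norm_triangle_ineq[of "z - x" "x - x0"] by (simp add: w_def)
    ultimately show ?thesis using zx by linarith
  qed
  have incr: "norm (W i x' - W 0 x') \<le> Q1 Q * (h * (1 + norm (x' - x0)))" for x'
    unfolding h_def by (rule tame_chain_increment[where W=W and j=j, OF \<delta> Q st tame ij(2)])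
  have Wz: "norm (W i z - W 0 x) \<le> 2 * Q1 Q * (h * w)"
  proof -
    have "norm (W i z - W 0 x) \<le> norm (W i z - W i x) + norm (W i x - W 0 x)"
      using norm_triangle_ineq[of "W i z - W i x" "W i x - W 0 x"] by simp
    also have "\<dots> \<le> Q * (2 * (C * Q) * (h * w)) + Q1 Q * (h * w)"
    proof (rule add_mono)
      have "norm (W i z - W i x) \<le> Q * norm (z - x)" by (rule tame_lip[OF tame[OF ij(2)]])
      also have "\<dots> \<le> Q * (2 * (C * Q) * (h * w))" using zx Q by (intro mult_left_mono) auto
      finally show "norm (W i z - W i x) \<le> Q * (2 * (C * Q) * (h * w))" .
    qed (use incr[of x] in \<open>simp add: w_def\<close>)
    also have "\<dots> = (2 * (C * Q^2) + Q1 Q) * (h * w)" by (simp add: power2_eq_square algebra_simps)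
    also have "\<dots> \<le> (2 * Q1 Q) * (h * w)"
    proof (rule mult_right_mono)
      have "0 \<le> C * Q^2" using C_powers by simp
      then show "2 * (C * Q^2) + Q1 Q \<le> 2 * Q1 Q" using qf(1) by linarith
    qed (rule hw)
    finally show ?thesis .
  qed
  have lipb: "C * (norm (z - x) + norm (W i z - W 0 x)) \<le> 3 * (C * Q1 Q) * (h * w)"
  proof -
    have "C * (norm (z - x) + norm (W i z - W 0 x)) \<le> C * (Q1 Q * (h * w) + 2 * Q1 Q * (h * w))"
      using zx1 Wz C_powers by (intro mult_left_mono add_mono) auto
    then show ?thesis by (simp add: algebra_simps)
  qed
  have rhsb: "norm (rhs (W i) z - rhs (W 0) x) \<le> 8 * (C^3 * Q * Q1 Q) * (h * w)"
  proof -
    have "rhs (W i) z - rhs (W 0) x = 0 + (G (z, W i z) - G (x, W 0 x)) - lam *\<^sub>R (W i z - W 0 x) + lam *\<^sub>R S' (W i (T z) - W 0 (T x))"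
      by (simp add: rhs_def S'_diff[symmetric] algebra_simps)
    then have "norm (rhs (W i) z - rhs (W 0) x) \<le> norm (0::'a) + norm (G (z, W i z) - G (x, W 0 x)) + norm (lam *\<^sub>R (W i z - W 0 x)) + norm (lam *\<^sub>R S' (W i (T z) - W 0 (T x)))"
      by (simp only:) (rule norm_add_diff_add)
    also have "\<dots> = norm (G (z, W i z) - G (x, W 0 x)) + lam * norm (W i z - W 0 x) + lam * norm (S' (W i (T z) - W 0 (T x)))"
      using lam by simp
    also have "\<dots> \<le> 3 * (C * Q1 Q) * (h * w) + C * (2 * Q1 Q * (h * w)) + C * (C * (3 * (C * Q * Q1 Q) * (h * w)))"
    proof (intro add_mono)
      show "norm (G (z, W i z) - G (x, W 0 x)) \<le> 3 * (C * Q1 Q) * (h * w)" using G_lip lipb order_trans by blast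
      show "lam * norm (W i z - W 0 x) \<le> C * (2 * Q1 Q * (h * w))" using lam Wz by (intro mult_mono) auto
      have "norm (W i (T z) - W 0 (T x)) \<le> norm (W i (T z) - W i (T x)) + norm (W i (T x) - W 0 (T x))"
        using norm_triangle_ineq[of "W i (T z) - W i (T x)" "W i (T x) - W 0 (T x)"] by simp
      also have "\<dots> \<le> Q * (C * (Q1 Q * (h * w))) + Q1 Q * (h * (2 * C * w))"
      proof (rule add_mono)
        have "norm (W i (T z) - W i (T x)) \<le> Q * norm (T z - T x)" by (rule tame_lip[OF tame[OF ij(2)]])
        also have "\<dots> \<le> Q * (C * norm (z - x))" unfolding T_diff using Q by (intro mult_left_mono S_bound) auto
        also have "\<dots> \<le> Q * (C * (Q1 Q * (h * w)))" using Q C_powers zx1 by (intro mult_left_mono) auto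
        finally show "norm (W i (T z) - W i (T x)) \<le> Q * (C * (Q1 Q * (h * w)))" .
        have "Q1 Q * (h * (1 + norm (T x - x0))) \<le> Q1 Q * (h * (2 * C * w))"
          unfolding w_def using h qf by (intro mult_left_mono T_growth') auto
        then show "norm (W i (T x) - W 0 (T x)) \<le> Q1 Q * (h * (2 * C * w))" using incr[of "T x"] by linarith
      qed
      also have "\<dots> = (Q * (C * Q1 Q) + 2 * (1 * (C * Q1 Q))) * (h * w)" by (simp add: algebra_simps)
      also have "\<dots> \<le> (Q * (C * Q1 Q) + 2 * (Q * (C * Q1 Q))) * (h * w)"
        using Q C_powers qf hw by (intro mult_right_mono add_left_mono mult_left_mono) auto
      finally have 1: "norm (W i (T z) - W 0 (T x)) \<le> 3 * (C * Q * Q1 Q) * (h * w)" by (simp add: algebra_simps)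
      have "norm (S' (W i (T z) - W 0 (T x))) \<le> C * norm (W i (T z) - W 0 (T x))" by (rule S'_bound)
      also have "\<dots> \<le> C * (3 * (C * Q * Q1 Q) * (h * w))" using C_powers 1 by (intro mult_left_mono) auto
      finally show "lam * norm (S' (W i (T z) - W 0 (T x))) \<le> C * (C * (3 * (C * Q * Q1 Q) * (h * w)))"
        using lam by (intro mult_mono) auto
    qed
    also have "\<dots> = (5 * (C * 1 * Q1 Q) + 3 * (C^3 * Q * Q1 Q)) * (h * w)" by (simp add: power3_eq_cube algebra_simps)
    also have "\<dots> \<le> (5 * (C^3 * Q * Q1 Q) + 3 * (C^3 * Q * Q1 Q)) * (h * w)"
      using Q C_powers qf hw by (intro mult_right_mono add_right_mono mult_left_mono mult_mono) auto
    finally show ?thesis by (simp add: algebra_simps)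
  qed
  have next_point: "x + (real (Suc i) * \<delta>) *\<^sub>R f = z + \<delta> *\<^sub>R f" by (simp add: z_def algebra_simps)
  have t1: "norm (W (Suc i) (z + \<delta> *\<^sub>R f) - W (Suc i) y) \<le> Q * (\<delta> * (3 * (C * Q1 Q) * (h * w)))"
  proof -
    have "norm (W (Suc i) (z + \<delta> *\<^sub>R f) - W (Suc i) y) \<le> Q * norm ((z + \<delta> *\<^sub>R f) - y)" by (rule tame_lip[OF tame[OF ij(3)]])
    also have "(z + \<delta> *\<^sub>R f) - y = \<delta> *\<^sub>R (F (x, W 0 x) - F (z, W i z))" by (simp add: y_def f_def algebra_simps)
    also have "Q * norm \<dots> = Q * (\<delta> * norm (F (z, W i z) - F (x, W 0 x)))" using \<delta> by (simp add: norm_minus_commute)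
    also have "\<dots> \<le> Q * (\<delta> * (3 * (C * Q1 Q) * (h * w)))"
      using Q \<delta> F_lip[of z "W i z" x "W 0 x"] lipb by (intro mult_left_mono) auto
    finally show ?thesis .
  qed
  have t2: "norm (W (Suc i) y - W i z - \<delta> *\<^sub>R rhs (W i) z) \<le> Q2 Q * (\<delta>\<^sup>2 * (3 * (C * Q) * w))"
  proof -
    have "norm (W (Suc i) y - W i z - \<delta> *\<^sub>R rhs (W i) z) \<le> Q2 Q * (\<delta>\<^sup>2 * (1 + norm (z - x0)))"
      unfolding y_def by (rule euler_step_consistent[OF st[OF ij(1)] \<delta> Q tame[OF ij(2)] tame[OF ij(3)]])
    also have "\<dots> \<le> Q2 Q * (\<delta>\<^sup>2 * (3 * (C * Q) * w))" using wz qf by (intro mult_left_mono) auto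
    finally show ?thesis .
  qed
  have t3: "norm (\<delta> *\<^sub>R (rhs (W i) z - rhs (W 0) x)) \<le> \<delta> * (8 * (C^3 * Q * Q1 Q) * (h * w))"
    using mult_left_mono[OF rhsb \<delta>(1)] \<delta>(1) by simp
  have t4: "norm (W i z - W 0 x - h *\<^sub>R rhs (W 0) x) \<le> Q3 Q * (h\<^sup>2 * w)"
    using Suc.IH[OF ij(2)] by (simp add: z_def f_def h_def w_def)
  have "W (Suc i) (z + \<delta> *\<^sub>R f) - W 0 x - (real (Suc i) * \<delta>) *\<^sub>R rhs (W 0) x
     = ((W (Suc i) (z + \<delta> *\<^sub>R f) - W (Suc i) y) + (W (Suc i) y - W i z - \<delta> *\<^sub>R rhs (W i) z))
       + (\<delta> *\<^sub>R (rhs (W i) z - rhs (W 0) x) + (W i z - W 0 x - h *\<^sub>R rhs (W 0) x))"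
    by (simp add: h_def algebra_simps)
  then have "norm (W (Suc i) (z + \<delta> *\<^sub>R f) - W 0 x - (real (Suc i) * \<delta>) *\<^sub>R rhs (W 0) x)
     \<le> Q * (\<delta> * (3 * (C * Q1 Q) * (h * w))) + Q2 Q * (\<delta>\<^sup>2 * (3 * (C * Q) * w))
       + (\<delta> * (8 * (C^3 * Q * Q1 Q) * (h * w)) + Q3 Q * (h\<^sup>2 * w))"
    by (simp only:) (intro norm_triangle_mono t1 t2 t3 t4)
  also have "\<dots> = (3 * (C * Q * Q1 Q) + 8 * (C^3 * Q * Q1 Q)) * (\<delta> * h * w) + 3 * C * Q * Q2 Q * (\<delta>\<^sup>2 * w) + Q3 Q * (h\<^sup>2 * w)"
    by (simp add: algebra_simps)
  also have "\<dots> \<le> Q3 Q * (\<delta> * h * w) + Q3 Q * (\<delta>\<^sup>2 * w) + Q3 Q * (h\<^sup>2 * w)"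
  proof (intro add_mono mult_right_mono order_refl)
    have "C * Q * Q1 Q \<le> C^3 * Q * Q1 Q" using C_powers Q qf by (intro mult_right_mono) auto
    moreover have n: "0 \<le> C * Q * Q2 Q" "0 \<le> C^3 * Q * Q1 Q" using C_powers Q qf by auto
    ultimately show "3 * (C * Q * Q1 Q) + 8 * (C^3 * Q * Q1 Q) \<le> Q3 Q" unfolding Q3_def by linarith
    show "3 * C * Q * Q2 Q \<le> Q3 Q" unfolding Q3_def using n by linarith
    show "0 \<le> \<delta> * h * w" "0 \<le> \<delta>\<^sup>2 * w" "0 \<le> h\<^sup>2 * w" using \<delta> h w by auto
  qed
  also have "\<dots> \<le> Q3 Q * ((real (Suc i) * \<delta>)\<^sup>2 * w)"
  proof -
    have Q30: "0 \<le> Q3 Q" unfolding Q3_def using C_powers Q qf by (intro add_nonneg_nonneg mult_nonneg_nonneg) auto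
    have "\<delta> * h * w + \<delta>\<^sup>2 * w + h\<^sup>2 * w \<le> (real (Suc i) * \<delta>)\<^sup>2 * w"
    proof -
      have "real (Suc i) * \<delta> = h + \<delta>" by (simp add: h_def algebra_simps)
      then have "(real (Suc i) * \<delta>)\<^sup>2 * w = \<delta> * h * w + \<delta>\<^sup>2 * w + h\<^sup>2 * w + \<delta> * h * w" by (simp add: power2_eq_square algebra_simps)
      then show ?thesis using \<delta> h w by simp
    qed
    from mult_left_mono[OF this Q30] show ?thesis by (simp only: distrib_left)
  qed
  finally show ?case unfolding next_point[symmetric] unfolding f_def w_def .
qed

text \<open>The scheme with step \<open>\<delta>\<close> started from \<open>(x - x0) / \<epsilon>\<close>.  Those data are cocoercive with parameter \<open>\<epsilon>\<close>,
  so the parameter after \<open>k\<close> steps is that of a solution of age \<open>\<epsilon> + k \<delta>\<close>.\<close>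
definition euler_orbit :: "real \<Rightarrow> real \<Rightarrow> (nat \<Rightarrow> 'a \<Rightarrow> 'a) \<Rightarrow> bool" where
  "euler_orbit \<delta> \<epsilon> W \<longleftrightarrow> 0 < \<delta> \<and> \<delta> \<le> \<epsilon> \<and> \<epsilon> \<le> 1 \<and> M * \<delta> \<le> 1 \<and> W 0 = (\<lambda>x. (1 / \<epsilon>) *\<^sub>R (x - x0)) \<and>
     (\<forall>k. euler_step \<delta> (W k) (W (Suc k)) \<and> cocoercive (min cap (rate * (\<epsilon> + real k * \<delta>))) (W k))"

lemma euler_orbit_exists:
  assumes \<epsilon>: "0 < \<epsilon>" "\<epsilon> \<le> 1"
  shows "\<exists>\<delta> W. euler_orbit \<delta> \<epsilon> W"
proof -
  define \<beta>0 where "\<beta>0 = min cap (rate * \<epsilon>)"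
  have \<beta>0: "0 < \<beta>0" "\<beta>0 \<le> \<epsilon>"
  proof -
    show "0 < \<beta>0" using M_pos \<epsilon> by (simp add: \<beta>0_def)
    have "rate * \<epsilon> \<le> 1 * \<epsilon>" using M_pos \<epsilon> by (intro mult_right_mono) auto
    then show "\<beta>0 \<le> \<epsilon>" by (simp add: \<beta>0_def)
  qed
  define L where "L = 1 + 1 / \<beta>0"
  have L: "1 \<le> L" "1 / L \<le> \<beta>0" using \<beta>0 by (auto simp: L_def field_simps)
  define \<delta> where "\<delta> = 1 / (14 * C * L * M)"
  have \<delta>0: "0 < \<delta>" using C_powers L M_pos by (simp add: \<delta>_def)
  have \<delta>L: "14 * C * L * \<delta> \<le> 1" using C_powers L M_pos by (simp add: \<delta>_def)
  have \<delta>M: "M * \<delta> \<le> 1"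
  proof -
    have "1 \<le> 14 * C * L" using mult_mono[of 1 C 1 L] C L by simp
    then show ?thesis using M_pos by (simp add: \<delta>_def)
  qed
  have \<delta>\<epsilon>: "\<delta> \<le> \<epsilon>"
  proof -
    have "1 \<le> 14 * C * M" using mult_mono[of 1 C 1 M] C M_pos by simp
    then have "L * 1 \<le> L * (14 * C * M)" using L by (intro mult_left_mono) auto
    then have "\<delta> \<le> 1 / L" unfolding \<delta>_def using L C_powers M_pos by (intro divide_left_mono) (auto simp: mult_ac)
    then show ?thesis using L \<beta>0 by linarith
  qed
  define Good where "Good = (\<lambda>k U. cocoercive (min cap (rate * (\<epsilon> + real k * \<delta>))) U)"
  define W0 where "W0 = (\<lambda>x. (1 / \<epsilon>) *\<^sub>R (x - x0))"
  have "\<exists>W. \<forall>k. Good k (W k) \<and> (k = 0 \<longrightarrow> W k = W0) \<and> euler_step \<delta> (W k) (W (Suc k))"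
  proof -
    have "\<exists>W. \<forall>k. (Good k (W k) \<and> (k = 0 \<longrightarrow> W k = W0)) \<and> euler_step \<delta> (W k) (W (Suc k))"
    proof (rule dependent_nat_choice)
      have "cocoercive \<epsilon> W0"
        unfolding cocoercive_def
      proof (intro allI conjI)
        fix x y
        have d: "W0 x - W0 y = (1 / \<epsilon>) *\<^sub>R (x - y)" by (simp add: W0_def algebra_simps)
        show "0 \<le> inner (x - y) (W0 x - W0 y)" unfolding d using \<epsilon> by simp
        have "\<epsilon> * ((norm (W0 x - W0 y))\<^sup>2 - (norm (x - y))\<^sup>2) \<le> \<epsilon> * (norm (W0 x - W0 y))\<^sup>2" using \<epsilon> by (intro mult_left_mono) auto
        also have "\<dots> = (1 / \<epsilon>) * (norm (x - y))\<^sup>2" unfolding d using \<epsilon> by (simp add: power2_eq_square)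
        also have "\<dots> = inner (x - y) (W0 x - W0 y)" unfolding d by (simp add: power2_norm_eq_inner)
        finally show "\<epsilon> * ((norm (W0 x - W0 y))\<^sup>2 - (norm (x - y))\<^sup>2) \<le> inner (x - y) (W0 x - W0 y)" .
      qed
      then show "\<exists>U. Good 0 U \<and> (0 = (0::nat) \<longrightarrow> U = W0)"
        using \<beta>0 cocoercive_mono[of \<epsilon> W0 \<beta>0] unfolding Good_def by (intro exI[of _ W0]) (simp add: \<beta>0_def)
    next
      fix U k assume U: "Good k U \<and> (k = 0 \<longrightarrow> U = W0)"
      define b where "b = min cap (rate * (\<epsilon> + real k * \<delta>))"
      have b: "0 \<le> b" "b \<le> cap" using M_pos \<epsilon> \<delta>0 by (auto simp: b_def)
      have bb: "\<beta>0 \<le> b" unfolding b_def \<beta>0_def using M_pos \<delta>0 by (intro min.mono mult_left_mono) auto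
      have cU: "cocoercive b U" using U by (simp add: Good_def b_def)
      have "norm (U x - U y) \<le> L * norm (x - y)" for x y
        unfolding L_def using \<beta>0 bb by (intro cocoercive_lipschitz cocoercive_mono[OF cU]) auto
      then obtain V where V: "euler_step \<delta> U V" using euler_step_exists[OF _ \<delta>M L(1) \<delta>L, of U] \<delta>0 by auto
      have "cocoercive (b + rate * \<delta>) V" by (rule cocoercive_euler_step[OF V _ \<delta>M b cU]) (use \<delta>0 in simp)
      moreover have "min cap (rate * (\<epsilon> + real (Suc k) * \<delta>)) \<le> b + rate * \<delta>"
      proof -
        have "rate * (\<epsilon> + real (Suc k) * \<delta>) = rate * (\<epsilon> + real k * \<delta>) + rate * \<delta>" "0 \<le> rate * \<delta>"
          using M_pos \<delta>0 by (simp_all add: algebra_simps)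
        then show ?thesis unfolding b_def by linarith
      qed
      moreover have "0 \<le> min cap (rate * (\<epsilon> + real (Suc k) * \<delta>))" using M_pos \<epsilon> \<delta>0 by auto
      ultimately have "Good (Suc k) V" unfolding Good_def using cocoercive_mono by blast
      then show "\<exists>V. (Good (Suc k) V \<and> (Suc k = 0 \<longrightarrow> V = W0)) \<and> euler_step \<delta> U V" using V by blast
    qed
    then show ?thesis by blast
  qed
  then obtain W where "\<forall>k. Good k (W k) \<and> (k = 0 \<longrightarrow> W k = W0) \<and> euler_step \<delta> (W k) (W (Suc k))" by blast
  then have "euler_orbit \<delta> \<epsilon> W"
    unfolding euler_orbit_def Good_def W0_def using \<delta>0 \<delta>\<epsilon> \<delta>M \<epsilon> by blast
  then show ?thesis by blast
qed

lemma orbit_lipschitz: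
  assumes W: "euler_orbit \<delta> \<epsilon> W" and s: "0 < s" "s \<le> \<epsilon> + real k * \<delta>"
  shows "norm (W k x - W k y) \<le> (1 + 1 / min cap (rate * s)) * norm (x - y)"
proof (rule cocoercive_lipschitz)
  have "cocoercive (min cap (rate * (\<epsilon> + real k * \<delta>))) (W k)" using W by (simp add: euler_orbit_def)
  then show "cocoercive (min cap (rate * s)) (W k)"
  proof (rule cocoercive_mono)
    show "min cap (rate * s) \<le> min cap (rate * (\<epsilon> + real k * \<delta>))"
      by (rule min.mono[OF order_refl mult_left_mono[OF s(2)]]) (use M_pos in simp)
  qed (use M_pos s in auto)
qed (use M_pos s in auto)

lemma orbit_anchor:
  assumes W: "euler_orbit \<delta> \<epsilon> W"
  shows "\<epsilon> + real k * \<delta> \<le> s1 \<Longrightarrow> norm (x - x0) \<le> K * (\<epsilon> + real k * \<delta>) * (H + norm (W k x))"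
proof (induction k arbitrary: x)
  have o: "0 < \<delta>" "\<delta> \<le> \<epsilon>" "M * \<delta> \<le> 1" using W by (auto simp: euler_orbit_def)
  note ac = anchor_constants
  case 0
  have W0: "W 0 x = (1 / \<epsilon>) *\<^sub>R (x - x0)" using W by (simp add: euler_orbit_def)
  have "norm (x - x0) = 1 * \<epsilon> * (0 + norm (W 0 x))" unfolding W0 using o by simp
  also have "\<dots> \<le> K * \<epsilon> * (H + norm (W 0 x))" using ac o by (intro mult_mono add_right_mono) auto
  finally show ?case by simp
next
  have o: "0 < \<delta>" "\<delta> \<le> \<epsilon>" "M * \<delta> \<le> 1" using W by (auto simp: euler_orbit_def)
  note ac = anchor_constants
  case (Suc k)
  define s where "s = \<epsilon> + real k * \<delta>"
  have s: "0 < s" "\<delta> \<le> s" "s + \<delta> \<le> s1" using Suc.prems o by (auto simp: s_def algebra_simps intro: add_increasing2 add_pos_nonneg)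
  have s1: "s \<le> s1" using s o by linarith
  have rs: "0 < rate * s" "rate * s \<le> cap" "rate * s \<le> 1"
  proof -
    show "0 < rate * s" using M_pos s by simp
    have "rate * s \<le> rate * s1" using M_pos s1 by (intro mult_left_mono) auto
    then show "rate * s \<le> cap" "rate * s \<le> 1" using ac M_pos by linarith+
  qed
  have "norm (x - x0) \<le> K * (s + \<delta>) * (H + norm (W (Suc k) x))"
  proof (rule anchor_step[OF _ _ o(3) s(2,1) s1])
    show "euler_step \<delta> (W k) (W (Suc k))" using W by (simp add: euler_orbit_def)
    fix x y
    have "norm (W k x - W k y) \<le> (1 + 1 / min cap (rate * s)) * norm (x - y)"
      by (rule orbit_lipschitz[OF W s(1)]) (simp add: s_def)
    also have "\<dots> \<le> 2 / (rate * s) * norm (x - y)"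
    proof (rule mult_right_mono)
      have "1 \<le> 1 / (rate * s)" using rs by simp
      moreover have "min cap (rate * s) = rate * s" using rs by simp
      ultimately show "1 + 1 / min cap (rate * s) \<le> 2 / (rate * s)" by simp
    qed auto
    finally show "norm (W k x - W k y) \<le> 2 / (rate * s) * norm (x - y)" .
    show "norm (x - x0) \<le> K * s * (H + norm (W k x))" using Suc.IH[of x] s1 by (simp add: s_def)
  qed (use o in auto)
  then show ?case by (simp add: s_def algebra_simps)
qed

end

section \<open>Uniform bounds and compactness\<close>

text \<open>Tychonoff's theorem, with a limit along a filter.  A filter is enough here because all
  properties to be passed to the limit are inequalities between values at given points.\<close>
lemma pointwise_cluster_filter:
  fixes u :: "nat \<Rightarrow> 'i \<Rightarrow> 'b::heine_borel"
  assumes bdd: "\<And>i. bounded (range (\<lambda>n. u n i))"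
  obtains \<F> v where "\<F> \<noteq> bot" "\<F> \<le> sequentially" "\<And>i. ((\<lambda>n. u n i) \<longlongrightarrow> v i) \<F>"
proof -
  define K where "K = (\<lambda>i. closure (range (\<lambda>n. u n i)))"
  have "compact (K i)" for i unfolding K_def using bdd[of i] by simp
  then have "compactin (product_topology (\<lambda>i. euclidean) UNIV) (PiE UNIV K)"
    unfolding compactin_PiE by simp
  then have comp: "compact (PiE UNIV K)" by (simp add: euclidean_product_topology)
  have inK: "u n \<in> PiE UNIV K" for n
    unfolding K_def using closure_subset by fastforce
  have "filtermap u sequentially \<noteq> bot" by (simp add: filtermap_bot_iff)
  moreover have "eventually (\<lambda>x. x \<in> PiE UNIV K) (filtermap u sequentially)" using inK by (simp add: eventually_filtermap)
  ultimately obtain v where v: "inf (nhds v) (filtermap u sequentially) \<noteq> bot"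
    using comp unfolding compact_filter by blast
  define \<F> where "\<F> = inf sequentially (filtercomap u (nhds v))"
  have ne: "\<F> \<noteq> bot"
  proof
    assume "\<F> = bot"
    then have "eventually (\<lambda>_. False) (inf sequentially (filtercomap u (nhds v)))" by (simp add: \<F>_def)
    then obtain P R where P: "eventually P sequentially" and R: "eventually R (filtercomap u (nhds v))"
      and PR: "\<And>n. P n \<Longrightarrow> R n \<Longrightarrow> False" unfolding eventually_inf by blast
    obtain R' where R': "eventually R' (nhds v)" "\<And>n. R' (u n) \<Longrightarrow> R n" using R unfolding eventually_filtercomap by blast
    have "eventually (\<lambda>y. \<exists>m. P m \<and> y = u m) (filtermap u sequentially)"
      unfolding eventually_filtermap using P by eventually_elim blast
    then have "eventually (\<lambda>_. False) (inf (nhds v) (filtermap u sequentially))"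
      unfolding eventually_inf using R' PR by blast
    then show False using v by (simp add: trivial_limit_def)
  qed
  have u: "filterlim u (nhds v) \<F>"
    unfolding filterlim_iff
  proof (intro allI impI)
    fix P assume "eventually P (nhds v)"
    then have "eventually (\<lambda>n. P (u n)) (filtercomap u (nhds v))" by (rule eventually_filtercomapI)
    then show "eventually (\<lambda>n. P (u n)) \<F>" unfolding \<F>_def by (rule filter_leD[OF inf.cobounded2])
  qed
  have lim: "((\<lambda>n. u n i) \<longlongrightarrow> v i) \<F>" for i
  proof -
    have "((\<lambda>w. w i) \<longlongrightarrow> v i) (nhds v)"
    proof (rule topological_tendstoI)
      fix A :: "'b set" assume A: "open A" "v i \<in> A"
      have "open ((\<lambda>w. w i) -` A \<inter> UNIV)"
        using continuous_on_product_coordinates[of i] A(1) by (subst (asm) continuous_on_open_vimage) auto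
      then show "\<forall>\<^sub>F w in nhds v. w i \<in> A" unfolding eventually_nhds using A by (intro exI[of _ "(\<lambda>w. w i) -` A"]) auto
    qed
    then show ?thesis using u by (rule filterlim_compose)
  qed
  show ?thesis by (rule that[OF ne _ lim]) (simp add: \<F>_def)
qed

context planning_data
begin

lemma anchor_radius: "K * s1 * H \<le> 1 / 2" "K * s1 \<le> 1 / 2"
proof -
  note ac = anchor_constants
  have "K * s1 * H = (3 * N + 1) / (8 * N)" using ac C_powers by (simp add: K_def H_def s1_def field_simps)
  also have "\<dots> \<le> 1/2" using ac by (simp add: field_simps)
  finally show 1: "K * s1 * H \<le> 1/2" .
  have "K * s1 * 1 \<le> K * s1 * H" using ac by (intro mult_left_mono) (auto simp: H_def)
  then show "K * s1 \<le> 1/2" using 1 by simp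
qed

text \<open>Some value of \<open>W k\<close> is bounded near \<open>x0\<close>: where \<open>W k y = - (y - x0)\<close>, the estimate
  \<open>|y - x0| \<le> K s (H + |y - x0|)\<close> forces \<open>|y - x0| \<le> 1\<close>.\<close>
lemma orbit_start_bound:
  assumes W: "euler_orbit \<delta> \<epsilon> W" and s: "\<epsilon> + real k * \<delta> \<le> s1" and L: "0 \<le> L"
    and lip: "\<And>x y. norm (W k x - W k y) \<le> L * norm (x - y)"
  shows "norm (W k x0) \<le> 1 + L"
proof -
  note ac = anchor_constants
  define s where "s = \<epsilon> + real k * \<delta>"
  have s0: "0 \<le> s" "s \<le> s1" using W s by (auto simp: euler_orbit_def s_def)
  have "cocoercive (min cap (rate * (\<epsilon> + real k * \<delta>))) (W k)" using W by (simp add: euler_orbit_def)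
  then have mono: "0 \<le> inner (x - y) (W k x - W k y)" for x y by (simp add: cocoercive_def)
  obtain y where y: "W k y = - (y - x0)" using monotone_lipschitz_zero[OF mono L lip] by blast
  define r where "r = norm (y - x0)"
  have ny: "norm (W k y) = r" by (simp add: y r_def norm_minus_commute)
  have Ks: "K * s * H \<le> 1/2" "K * s \<le> 1/2"
  proof -
    have 1: "K * s \<le> K * s1" using s0 ac by (intro mult_left_mono) auto
    then show "K * s \<le> 1/2" using anchor_radius by simp
    have "K * s * H \<le> K * s1 * H" using 1 ac by (intro mult_right_mono) auto
    then show "K * s * H \<le> 1/2" using anchor_radius by simp
  qed
  have "r \<le> K * s * (H + r)" using orbit_anchor[OF W s, of y] ny by (simp add: r_def s_def)
  also have "\<dots> = K * s * H + K * s * r" by (simp add: algebra_simps)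
  also have "K * s * r \<le> 1/2 * r" using Ks by (intro mult_right_mono) (auto simp: r_def)
  finally have r: "r \<le> 1" using Ks by simp
  have "norm (W k x0) \<le> norm (W k y) + norm (W k x0 - W k y)" using norm_triangle_ineq[of "W k y" "W k x0 - W k y"] by simp
  also have "\<dots> \<le> 1 + L * r" using r ny lip[of x0 y] by (simp add: r_def norm_minus_commute)
  also have "\<dots> \<le> 1 + L * 1" using r L by (intro add_left_mono mult_left_mono) auto
  finally show ?thesis by simp
qed

text \<open>At an age just below \<open>min a s1\<close> the value at \<open>x0\<close> is bounded independently of \<open>\<epsilon>\<close>, and from
  there on the Gronwall inequality takes over.\<close>
lemma orbit_tame:
  assumes a: "0 < a"
  shows "\<exists>Q\<ge>1. \<exists>e0>0. \<forall>\<delta> \<epsilon> W k. euler_orbit \<delta> \<epsilon> W \<longrightarrow> \<epsilon> \<le> e0 \<longrightarrow> a \<le> \<epsilon> + real k * \<delta> \<longrightarrow> \<epsilon> + real k * \<delta> \<le> B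
     \<longrightarrow> tame Q (W k)"
proof -
  define a' where "a' = min a s1"
  have a': "0 < a'" "a' \<le> a" "a' \<le> s1" using a anchor_constants by (auto simp: a'_def)
  define L where "L = 1 + 1 / min cap (rate * (a' / 2))"
  have mp: "0 < min cap (rate * (a' / 2))" using M_pos a' by simp
  have L: "1 \<le> L" using mp by (simp add: L_def)
  define e0 where "e0 = min (a' / 2) (1 / (2 * M * L))"
  have e0: "0 < e0" "e0 \<le> a' / 2" "e0 \<le> 1 / (2 * M * L)" unfolding e0_def using a' L M_pos by (simp, intro min.cobounded1, intro min.cobounded2)
  define E where "E = (2 + L) * exp (4 * (M * L * B))"
  define Q where "Q = L + E"
  have E: "0 < E" using L by (simp add: E_def)
  have Q: "1 \<le> Q" using L E by (simp add: Q_def)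
  have "tame Q (W k)" if W: "euler_orbit \<delta> \<epsilon> W" and \<epsilon>: "\<epsilon> \<le> e0" and k: "a \<le> \<epsilon> + real k * \<delta>" "\<epsilon> + real k * \<delta> \<le> B" for \<delta> \<epsilon> W k
  proof -
    have o: "0 < \<delta>" "\<delta> \<le> \<epsilon>" "M * \<delta> \<le> 1" "0 < \<epsilon>" using W by (auto simp: euler_orbit_def)
    \<comment> \<open>the last index whose age is at most \<open>a'\<close>; its age is then at least \<open>a' / 2\<close>\<close>
    define j where "j = nat \<lfloor>(a' - \<epsilon>) / \<delta>\<rfloor>"
    have ea: "\<epsilon> \<le> a' / 2" "\<epsilon> \<le> a'" using \<epsilon> e0 a' by linarith+
    have "0 \<le> (a' - \<epsilon>) / \<delta>" using ea o by simp
    then have jr: "real j \<le> (a' - \<epsilon>) / \<delta>" "(a' - \<epsilon>) / \<delta> < real j + 1" unfolding j_def by linarith+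
    have js: "\<epsilon> + real j * \<delta> \<le> a'" "a' < \<epsilon> + real j * \<delta> + \<delta>" using jr o by (auto simp: field_simps)
    have j2: "a' / 2 \<le> \<epsilon> + real j * \<delta>" using js o ea by linarith
    have lip: "norm (W i x - W i y) \<le> L * norm (x - y)" if "j \<le> i" for i x y
      unfolding L_def
    proof (rule orbit_lipschitz[OF W])
      have "real j * \<delta> \<le> real i * \<delta>" using that o by (intro mult_right_mono) auto
      then show "a' / 2 \<le> \<epsilon> + real i * \<delta>" using j2 by linarith
    qed (use a' in simp)
    have jk: "j \<le> k"
    proof (rule ccontr)
      assume "\<not> j \<le> k"
      then have "real (Suc k) * \<delta> \<le> real j * \<delta>" using o by (intro mult_right_mono) auto
      then have "\<epsilon> + real k * \<delta> + \<delta> \<le> a'" using js by (simp add: algebra_simps)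
      then show False using k a' o by linarith
    qed
    have q: "M * L * \<delta> \<le> 1 / 2"
    proof -
      have "\<delta> \<le> 1 / (2 * M * L)" using o \<epsilon> e0 by linarith
      then show ?thesis using M_pos L by (simp add: field_simps)
    qed
    define g where "g = 4 * (M * L * \<delta>)"
    have g: "0 \<le> g" using M_pos L o by (simp add: g_def)
    have start: "1 + norm (W j x0) \<le> 2 + L" using orbit_start_bound[OF W _ _ lip[OF order_refl]] js a' L by simp
    have grow: "1 + norm (W (j + i) x0) \<le> (2 + L) * (1 + g) ^ i" for i
    proof (induction i)
      case 0
      then show ?case using start by simp
    next
      case (Suc i)
      have "euler_step \<delta> (W (j + i)) (W (Suc (j + i)))" using W by (simp add: euler_orbit_def)
      then have "1 + norm (W (Suc (j + i)) x0) \<le> (1 + norm (W (j + i) x0)) * (1 + g)"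
        unfolding g_def by (rule growth_step[OF _ _ o(3) L q lip]) (use o in auto)
      also have "\<dots> \<le> ((2 + L) * (1 + g) ^ i) * (1 + g)" using Suc g by (intro mult_right_mono) auto
      finally show ?case by (simp add: mult_ac)
    qed
    have "(1 + g) ^ (k - j) \<le> exp g ^ (k - j)" using g by (intro power_mono) (auto simp: exp_ge_add_one_self)
    also have "\<dots> = exp (real (k - j) * g)" by (simp add: exp_of_nat_mult)
    also have "\<dots> \<le> exp (4 * (M * L * B))"
    proof -
      have "real (k - j) * \<delta> \<le> real k * \<delta>" using o by (intro mult_right_mono) auto
      then have "real (k - j) * \<delta> \<le> B" using k o by linarith
      then have "4 * (M * L) * (real (k - j) * \<delta>) \<le> 4 * (M * L) * B" using M_pos L by (intro mult_left_mono) auto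
      then show ?thesis by (simp add: g_def mult_ac)
    qed
    finally have "(2 + L) * (1 + g) ^ (k - j) \<le> E" unfolding E_def using L by (intro mult_left_mono) auto
    then have m: "norm (W k x0) \<le> E" using grow[of "k - j"] jk by simp
    show ?thesis unfolding tame_def
    proof (intro conjI allI)
      fix x y :: 'a
      have "L * norm (x - y) \<le> Q * norm (x - y)" using E by (intro mult_right_mono) (auto simp: Q_def)
      then show "norm (W k x - W k y) \<le> Q * norm (x - y)" using lip[OF jk, of x y] by linarith
      have "norm (W k x) \<le> norm (W k x0) + norm (W k x - W k x0)" using norm_triangle_ineq[of "W k x0" "W k x - W k x0"] by simp
      also have "\<dots> \<le> E * 1 + L * norm (x - x0)" using m lip[OF jk] by (intro add_mono) auto
      also have "\<dots> \<le> Q * 1 + Q * norm (x - x0)" using L E by (intro add_mono mult_right_mono) (auto simp: Q_def)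
      finally show "norm (W k x) \<le> Q * (1 + norm (x - x0))" by (simp add: algebra_simps)
    qed
  qed
  then show ?thesis using Q e0(1) by blast
qed

lemma F_continuous: "continuous_on UNIV F" and G_continuous: "continuous_on UNIV G"
proof -
  have *: "continuous_on UNIV \<Phi>" if "\<And>x p y q. norm (\<Phi> (x, p) - \<Phi> (y, q)) \<le> C * (norm (x - y) + norm (p - q))"
    for \<Phi> :: "'a \<times> 'a \<Rightarrow> 'a"
  proof (rule lipschitz_on_continuous_on[where L="2 * C"], rule lipschitz_onI)
    fix z z' :: "'a \<times> 'a"
    obtain x p y q where z: "z = (x, p)" "z' = (y, q)" by (cases z, cases z')
    have "norm (x - y) + norm (p - q) \<le> 2 * norm (z - z')"
      using norm_fst_le[of "x - y" "p - q"] norm_snd_le[of "p - q" "x - y"] by (simp add: z)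
    then have "C * (norm (x - y) + norm (p - q)) \<le> C * (2 * norm (z - z'))" using C by (intro mult_left_mono) auto
    then show "dist (\<Phi> z) (\<Phi> z') \<le> 2 * C * dist z z'" using that[of x p y q] by (simp add: z dist_norm)
  qed (use C in auto)
  show "continuous_on UNIV F" by (rule *) (rule F_lip)
  show "continuous_on UNIV G" by (rule *) (rule G_lip)
qed

lemma S'_continuous: "continuous_on UNIV S'"
  using S'_linear by (rule linear_continuous_on[OF linear_conv_bounded_linear[THEN iffD1]])

end

context planning_data
begin

lemma floor_index_bounds:
  assumes "0 < \<delta>" "0 \<le> t"
  shows "real (nat \<lfloor>t / \<delta>\<rfloor>) * \<delta> \<le> t" "t < real (nat \<lfloor>t / \<delta>\<rfloor>) * \<delta> + \<delta>"
proof -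
  have "0 \<le> t / \<delta>" using assms by simp
  then have "real (nat \<lfloor>t / \<delta>\<rfloor>) \<le> t / \<delta>" "t / \<delta> < real (nat \<lfloor>t / \<delta>\<rfloor>) + 1" by linarith+
  then have "real (nat \<lfloor>t / \<delta>\<rfloor>) * \<delta> \<le> t" "t < (real (nat \<lfloor>t / \<delta>\<rfloor>) + 1) * \<delta>"
    using assms(1) by (simp_all only: pos_le_divide_eq pos_divide_less_eq)
  then show "real (nat \<lfloor>t / \<delta>\<rfloor>) * \<delta> \<le> t" "t < real (nat \<lfloor>t / \<delta>\<rfloor>) * \<delta> + \<delta>" by (simp_all add: distrib_right)
qed

text \<open>The failure of \<open>U\<close> to follow, for a time \<open>h\<close>, the straight characteristic starting at \<open>(t, x)\<close>.\<close>
definition defect :: "(real \<Rightarrow> 'a \<Rightarrow> 'a) \<Rightarrow> real \<Rightarrow> real \<Rightarrow> 'a \<Rightarrow> 'a" where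
  "defect U t h x = U (t + h) (x + h *\<^sub>R F (x, U t x)) - U t x - h *\<^sub>R rhs (U t) x"

definition tame_evolution :: "real \<Rightarrow> real \<Rightarrow> real \<Rightarrow> (real \<Rightarrow> 'a \<Rightarrow> 'a) \<Rightarrow> bool" where
  "tame_evolution a B Q U \<longleftrightarrow> (\<forall>t. a \<le> t \<longrightarrow> t \<le> B \<longrightarrow> tame Q (U t)) \<and>
     (\<forall>t t' x. a \<le> t \<longrightarrow> t \<le> t' \<longrightarrow> t' \<le> B \<longrightarrow> norm (U t' x - U t x) \<le> Q1 Q * ((t' - t) * (1 + norm (x - x0)))) \<and>
     (\<forall>t h x. a \<le> t \<longrightarrow> 0 < h \<longrightarrow> h \<le> 1/2 \<longrightarrow> t + h \<le> B \<longrightarrow> norm (defect U t h x) \<le> Q3 Q * (h\<^sup>2 * (1 + norm (x - x0))))"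

text \<open>The limit of the schemes with \<open>\<epsilon> = 1 / (n + 1)\<close>, interpolated as step functions of time.
  The first property holds because the estimates on the schemes are uniform, the second is
  \<open>orbit_anchor\<close>.\<close>
theorem scheme_limit:
  obtains U :: "real \<Rightarrow> 'a \<Rightarrow> 'a" where
    "\<And>a B. 0 < a \<Longrightarrow> \<exists>Q\<ge>1. tame_evolution a B Q U"
    and "\<And>t x. 0 < t \<Longrightarrow> t < s1 \<Longrightarrow> norm (x - x0) \<le> K * t * (H + norm (U t x))"
proof -
  define \<epsilon> where "\<epsilon> = (\<lambda>n. 1 / real (Suc n))"
  have \<epsilon>: "0 < \<epsilon> n" "\<epsilon> n \<le> 1" for n by (auto simp: \<epsilon>_def)
  have \<epsilon>0: "\<epsilon> \<longlonglongrightarrow> 0" unfolding \<epsilon>_def using LIMSEQ_inverse_real_of_nat by (simp add: inverse_eq_divide)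
  have "\<forall>n. \<exists>\<delta> W. euler_orbit \<delta> (\<epsilon> n) W" using euler_orbit_exists \<epsilon> by blast
  then obtain \<delta> W where W: "\<And>n. euler_orbit (\<delta> n) (\<epsilon> n) (W n)" by metis
  have \<delta>: "0 < \<delta> n" "\<delta> n \<le> \<epsilon> n" "M * \<delta> n \<le> 1" for n using W[of n] by (auto simp: euler_orbit_def)
  have st: "euler_step (\<delta> n) (W n k) (W n (Suc k))" for n k using W[of n] by (simp add: euler_orbit_def)
  have \<delta>0: "\<delta> \<longlonglongrightarrow> 0" by (rule tendsto_sandwich[OF _ _ tendsto_const \<epsilon>0]) (use \<delta>(1,2) in \<open>auto intro!: always_eventually less_imp_le\<close>)
  define k where "k = (\<lambda>n t. nat \<lfloor>t / \<delta> n\<rfloor>)"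
  have k: "real (k n t) * \<delta> n \<le> t" "t < real (k n t) * \<delta> n + \<delta> n" if "0 \<le> t" for n t
    unfolding k_def using floor_index_bounds[OF \<delta>(1) that] by auto
  have kt: "(\<lambda>n. real (k n t) * \<delta> n) \<longlonglongrightarrow> t" if "0 \<le> t" for t
  proof (rule tendsto_sandwich[of "\<lambda>n. t - \<delta> n" _ _ "\<lambda>n. t"])
    have "(\<lambda>n. t - \<delta> n) \<longlonglongrightarrow> t - 0" by (intro tendsto_intros \<delta>0)
    then show "(\<lambda>n. t - \<delta> n) \<longlonglongrightarrow> t" by simp
    show "\<forall>\<^sub>F n in sequentially. t - \<delta> n \<le> real (k n t) * \<delta> n"
      using k(2)[OF that] by (intro always_eventually allI) (simp add: less_imp_le algebra_simps)
    show "\<forall>\<^sub>F n in sequentially. real (k n t) * \<delta> n \<le> t" using k(1)[OF that] by simp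
  qed simp
  \<comment> \<open>the value 0 at times \<open>t \<le> 0\<close> only serves to have bounded sequences everywhere\<close>
  define u where "u = (\<lambda>n (t, x). if 0 < t then W n (k n t) x else 0)"
  have tame_ev: "\<exists>Q\<ge>1. \<forall>\<^sub>F n in sequentially. \<forall>i. a \<le> \<epsilon> n + real i * \<delta> n \<longrightarrow> \<epsilon> n + real i * \<delta> n \<le> B \<longrightarrow> tame Q (W n i)"
    if a: "0 < a" for a B
  proof -
    obtain Q e0 where Q: "1 \<le> Q" "0 < e0" "\<And>\<delta> \<epsilon> W k. euler_orbit \<delta> \<epsilon> W \<Longrightarrow> \<epsilon> \<le> e0 \<Longrightarrow> a \<le> \<epsilon> + real k * \<delta> \<Longrightarrow> \<epsilon> + real k * \<delta> \<le> B \<Longrightarrow> tame Q (W k)"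
      using orbit_tame[OF a, of B] by blast
    have "\<forall>\<^sub>F n in sequentially. \<epsilon> n < e0" using \<epsilon>0 Q(2) by (rule order_tendstoD)
    then have "\<forall>\<^sub>F n in sequentially. \<forall>i. a \<le> \<epsilon> n + real i * \<delta> n \<longrightarrow> \<epsilon> n + real i * \<delta> n \<le> B \<longrightarrow> tame Q (W n i)"
      by eventually_elim (use Q(3)[OF W] in \<open>auto intro: less_imp_le\<close>)
    then show ?thesis using Q(1) by blast
  qed
  have s_bounds: "t \<le> \<epsilon> n + real (k n t) * \<delta> n" "\<epsilon> n + real (k n t) * \<delta> n \<le> t + 1" if "0 \<le> t" for n t
    using k[OF that, of n] \<delta>[of n] \<epsilon>[of n] by linarith+
  have tame_t: "\<exists>Q\<ge>1. \<forall>\<^sub>F n in sequentially. \<forall>i t t'. a \<le> t \<longrightarrow> t' \<le> B \<longrightarrow> k n t \<le> i \<longrightarrow> i \<le> k n t' \<longrightarrow> 0 \<le> t' \<longrightarrow> tame Q (W n i)"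
    if a: "0 < a" for a B
  proof -
    obtain Q where Q: "1 \<le> Q" "\<forall>\<^sub>F n in sequentially. \<forall>i. a \<le> \<epsilon> n + real i * \<delta> n \<longrightarrow> \<epsilon> n + real i * \<delta> n \<le> B + 1 \<longrightarrow> tame Q (W n i)"
      using tame_ev[OF a, of "B + 1"] by blast
    from Q(2) have "\<forall>\<^sub>F n in sequentially. \<forall>i t t'. a \<le> t \<longrightarrow> t' \<le> B \<longrightarrow> k n t \<le> i \<longrightarrow> i \<le> k n t' \<longrightarrow> 0 \<le> t' \<longrightarrow> tame Q (W n i)"
    proof (eventually_elim, intro allI impI)
      fix n i t t'
      assume h: "\<forall>i. a \<le> \<epsilon> n + real i * \<delta> n \<longrightarrow> \<epsilon> n + real i * \<delta> n \<le> B + 1 \<longrightarrow> tame Q (W n i)"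
        and t: "a \<le> t" "t' \<le> B" "k n t \<le> i" "i \<le> k n t'" "0 \<le> t'"
      have "real (k n t) * \<delta> n \<le> real i * \<delta> n" "real i * \<delta> n \<le> real (k n t') * \<delta> n"
        using t \<delta>(1)[of n] by (auto intro!: mult_right_mono)
      moreover have "0 \<le> t" using t a by linarith
      ultimately have "a \<le> \<epsilon> n + real i * \<delta> n" "\<epsilon> n + real i * \<delta> n \<le> B + 1" using s_bounds[of t n] s_bounds[of t' n] t by linarith+
      then show "tame Q (W n i)" using h by blast
    qed
    then show ?thesis using Q(1) by blast
  qed
  have bdd: "bounded (range (\<lambda>n. u n i))" for i
  proof -
    obtain t x where i: "i = (t, x)" by (cases i)
    show ?thesis
    proof (cases "0 < t")
      case True
      obtain Q where Q: "\<forall>\<^sub>F n in sequentially. \<forall>i s s'. t \<le> s \<longrightarrow> s' \<le> t \<longrightarrow> k n s \<le> i \<longrightarrow> i \<le> k n s' \<longrightarrow> 0 \<le> s' \<longrightarrow> tame Q (W n i)"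
        using tame_t[OF True, of t] by blast
      from Q have "\<forall>\<^sub>F n in sequentially. norm (u n i) \<le> Q * (1 + norm (x - x0))"
      proof eventually_elim
        case (elim n)
        have "tame Q (W n (k n t))" using elim True by (meson order_refl less_imp_le)
        then show ?case using True tame_growth by (simp add: u_def i)
      qed
      then have "Bfun (\<lambda>n. u n i) sequentially" unfolding Bfun_metric_def eventually_sequentially
        by (intro exI[of _ 0] exI[of _ "max 1 (Q * (1 + norm (x - x0)))"]) (auto simp: dist_norm intro: max.coboundedI2)
      then show ?thesis using Bseq_eq_bounded by blast
    next
      case False
      then show ?thesis by (simp add: u_def i image_constant_conv)
    qed
  qed
  obtain \<F> v where \<F>: "\<F> \<noteq> bot" "\<F> \<le> sequentially" and v: "\<And>i. ((\<lambda>n. u n i) \<longlongrightarrow> v i) \<F>"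
    using pointwise_cluster_filter[of u, OF bdd] by blast
  define U where "U = (\<lambda>t x. v (t, x))"
  have ev: "eventually P sequentially \<Longrightarrow> eventually P \<F>" for P using \<F>(2) by (rule filter_leD)
  have lim: "((\<lambda>n. W n (k n t) x) \<longlongrightarrow> U t x) \<F>" if "0 < t" for t x
    using v[of "(t, x)"] that by (simp add: u_def U_def)
  have tl: "(f \<longlongrightarrow> l) \<F>" if "f \<longlonglongrightarrow> l" for f :: "nat \<Rightarrow> real" and l
    by (rule filterlim_mono[OF that order_refl \<F>(2)])
  have kmono: "k n t \<le> k n t'" if "t \<le> t'" for n t t'
    unfolding k_def using that \<delta>(1)[of n] by (intro nat_mono floor_mono divide_right_mono) auto
  show ?thesis
  proof (rule that)
    fix t x assume t: "0 < t" "t < s1"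
    have "(\<lambda>n. \<epsilon> n + real (k n t) * \<delta> n) \<longlonglongrightarrow> 0 + t" by (intro tendsto_intros \<epsilon>0 kt) (use t in simp)
    then have s: "(\<lambda>n. \<epsilon> n + real (k n t) * \<delta> n) \<longlonglongrightarrow> t" by simp
    show "norm (x - x0) \<le> K * t * (H + norm (U t x))"
    proof (rule tendsto_lowerbound[OF _ _ \<F>(1)])
      show "((\<lambda>n. K * (\<epsilon> n + real (k n t) * \<delta> n) * (H + norm (W n (k n t) x))) \<longlongrightarrow> K * t * (H + norm (U t x))) \<F>"
        by (intro tendsto_intros tl[OF s] lim t)
      have "\<forall>\<^sub>F n in sequentially. \<epsilon> n + real (k n t) * \<delta> n < s1" using s t(2) by (rule order_tendstoD)
      then have "\<forall>\<^sub>F n in sequentially. norm (x - x0) \<le> K * (\<epsilon> n + real (k n t) * \<delta> n) * (H + norm (W n (k n t) x))"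
        by eventually_elim (rule orbit_anchor[OF W], simp)
      then show "\<forall>\<^sub>F n in \<F>. norm (x - x0) \<le> K * (\<epsilon> n + real (k n t) * \<delta> n) * (H + norm (W n (k n t) x))" by (rule ev)
    qed
  next
    fix a B :: real assume a: "0 < a"
    obtain Q where Q: "1 \<le> Q" "\<forall>\<^sub>F n in sequentially. \<forall>i t t'. a \<le> t \<longrightarrow> t' \<le> B \<longrightarrow> k n t \<le> i \<longrightarrow> i \<le> k n t' \<longrightarrow> 0 \<le> t' \<longrightarrow> tame Q (W n i)"
      using tame_t[OF a, of B] by blast
    have tame1: "\<forall>\<^sub>F n in \<F>. tame Q (W n (k n t))" if "a \<le> t" "t \<le> B" for t
    proof (rule ev)
      show "\<forall>\<^sub>F n in sequentially. tame Q (W n (k n t))"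
        using Q(2)
      proof eventually_elim
        case (elim n)
        have "0 \<le> t" using that a by linarith
        then show ?case using elim that by blast
      qed
    qed
    have tameU: "tame Q (U t)" if t: "a \<le> t" "t \<le> B" for t
      unfolding tame_def
    proof (intro conjI allI)
      have t0: "0 < t" using t a by simp
      fix x y
      show "norm (U t x - U t y) \<le> Q * norm (x - y)"
      proof (rule tendsto_upperbound[OF tendsto_norm[OF tendsto_diff[OF lim[OF t0] lim[OF t0]]] _ \<F>(1)])
        show "\<forall>\<^sub>F n in \<F>. norm (W n (k n t) x - W n (k n t) y) \<le> Q * norm (x - y)"
          using tame1[OF t] by eventually_elim (rule tame_lip)
      qed
      show "norm (U t x) \<le> Q * (1 + norm (x - x0))"
      proof (rule tendsto_upperbound[OF tendsto_norm[OF lim[OF t0]] _ \<F>(1)])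
        show "\<forall>\<^sub>F n in \<F>. norm (W n (k n t) x) \<le> Q * (1 + norm (x - x0))"
          using tame1[OF t] by eventually_elim (rule tame_growth)
      qed
    qed
    have timeU: "norm (U t' x - U t x) \<le> Q1 Q * ((t' - t) * (1 + norm (x - x0)))"
      if t: "a \<le> t" "t \<le> t'" "t' \<le> B" for t t' x
    proof -
      have t0: "0 < t" "0 < t'" using t a by auto
      have kd: "(\<lambda>n. real (k n t' - k n t) * \<delta> n) \<longlonglongrightarrow> t' - t"
      proof -
        have "(\<lambda>n. real (k n t') * \<delta> n - real (k n t) * \<delta> n) \<longlonglongrightarrow> t' - t" using t0 by (intro tendsto_diff kt) auto
        then show ?thesis using kmono[OF t(2)] by (simp add: of_nat_diff left_diff_distrib)
      qed
      show ?thesis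
      proof (rule tendsto_le[OF \<F>(1)])
        show "((\<lambda>n. norm (W n (k n t') x - W n (k n t) x)) \<longlongrightarrow> norm (U t' x - U t x)) \<F>"
          using t0 by (intro tendsto_intros lim)
        show "((\<lambda>n. Q1 Q * (real (k n t' - k n t) * \<delta> n * (1 + norm (x - x0)))) \<longlongrightarrow> Q1 Q * ((t' - t) * (1 + norm (x - x0)))) \<F>"
          by (intro tendsto_intros tl[OF kd])
        have "\<forall>\<^sub>F n in sequentially. norm (W n (k n t') x - W n (k n t) x) \<le> Q1 Q * (real (k n t' - k n t) * \<delta> n * (1 + norm (x - x0)))"
          using Q(2)
        proof eventually_elim
          case (elim n)
          define j where "j = k n t' - k n t"
          have j: "k n t + j = k n t'" using kmono[OF t(2), of n] by (simp add: j_def)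
          have tm: "tame Q (W n (k n t + i))" if "i \<le> j" for i
          proof -
            have "k n t \<le> k n t + i" "k n t + i \<le> k n t'" "0 \<le> t'" using that j t0 by auto
            then show ?thesis using elim t(1,3) by blast
          qed
          have "norm (W n (k n t + j) x - W n (k n t + 0) x) \<le> Q1 Q * (real j * \<delta> n * (1 + norm (x - x0)))"
            by (rule tame_chain_increment[where W="\<lambda>i. W n (k n t + i)" and j=j, OF _ \<delta>(3) Q(1) _ tm])
               (use \<delta>(1)[of n] st in \<open>auto intro: less_imp_le\<close>)
          then show ?case by (simp add: j j_def[symmetric])
        qed
        then show "\<forall>\<^sub>F n in \<F>. norm (W n (k n t') x - W n (k n t) x) \<le> Q1 Q * (real (k n t' - k n t) * \<delta> n * (1 + norm (x - x0)))" by (rule ev)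
      qed
    qed
    have consU: "norm (U (t + h) (x + h *\<^sub>R F (x, U t x)) - U t x - h *\<^sub>R rhs (U t) x) \<le> Q3 Q * (h\<^sup>2 * (1 + norm (x - x0)))"
      if t: "a \<le> t" "0 < h" "h \<le> 1/2" "t + h \<le> B" for t h x
    proof -
      have t0: "0 < t" "0 < t + h" "t \<le> B" using t a by auto
      define j where "j = (\<lambda>n. k n (t + h) - k n t)"
      have j: "k n t + j n = k n (t + h)" for n using kmono[of t "t + h" n] t by (simp add: j_def)
      have jd: "(\<lambda>n. real (j n) * \<delta> n) \<longlonglongrightarrow> h"
      proof -
        have "(\<lambda>n. real (k n (t + h)) * \<delta> n - real (k n t) * \<delta> n) \<longlonglongrightarrow> (t + h) - t" using t0 by (intro tendsto_diff kt) auto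
        moreover have "real (k n (t + h)) * \<delta> n - real (k n t) * \<delta> n = real (j n) * \<delta> n" for n
          unfolding j[symmetric] by (simp add: algebra_simps)
        ultimately show ?thesis by simp
      qed
      let ?f = "\<lambda>n. F (x, W n (k n t) x)" and ?z = "x + h *\<^sub>R F (x, U t x)"
      let ?zn = "\<lambda>n. x + (real (j n) * \<delta> n) *\<^sub>R F (x, W n (k n t) x)"
      have Wt: "((\<lambda>n. W n (k n t) y) \<longlongrightarrow> U t y) \<F>" for y by (rule lim[OF t0(1)])
      have fl: "(?f \<longlongrightarrow> F (x, U t x)) \<F>"
        by (rule continuous_on_tendsto_compose[OF F_continuous]) (auto intro!: tendsto_intros Wt)
      have gl: "((\<lambda>n. G (x, W n (k n t) x)) \<longlongrightarrow> G (x, U t x)) \<F>"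
        by (rule continuous_on_tendsto_compose[OF G_continuous]) (auto intro!: tendsto_intros Wt)
      have sl: "((\<lambda>n. S' (W n (k n t) (T x))) \<longlongrightarrow> S' (U t (T x))) \<F>"
        by (rule continuous_on_tendsto_compose[OF S'_continuous Wt]) auto
      have rl: "((\<lambda>n. rhs (W n (k n t)) x) \<longlongrightarrow> rhs (U t) x) \<F>"
        unfolding rhs_def by (intro tendsto_intros gl sl Wt)
      have zl: "(?zn \<longlongrightarrow> ?z) \<F>" by (intro tendsto_intros fl tl[OF jd])
      \<comment> \<open>the evaluation point moves with \<open>n\<close>; the uniform Lipschitz bound takes care of this\<close>
      have Wz: "((\<lambda>n. W n (k n (t + h)) (?zn n)) \<longlongrightarrow> U (t + h) ?z) \<F>"
      proof -
        have "((\<lambda>n. W n (k n (t + h)) (?zn n) - W n (k n (t + h)) ?z) \<longlongrightarrow> 0) \<F>"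
        proof (rule Lim_null_comparison)
          show "\<forall>\<^sub>F n in \<F>. norm (W n (k n (t + h)) (?zn n) - W n (k n (t + h)) ?z) \<le> Q * norm (?zn n - ?z)"
          proof -
            have "\<forall>\<^sub>F n in \<F>. tame Q (W n (k n (t + h)))" using t by (intro tame1) auto
            then show ?thesis by eventually_elim (rule tame_lip)
          qed
          have "((\<lambda>n. Q * norm (?zn n - ?z)) \<longlongrightarrow> Q * norm (?z - ?z)) \<F>" by (intro tendsto_intros zl)
          then show "((\<lambda>n. Q * norm (?zn n - ?z)) \<longlongrightarrow> 0) \<F>" by simp
        qed
        from tendsto_add[OF this lim[OF t0(2), of ?z]] show ?thesis by simp
      qed
      show ?thesis
      proof (rule tendsto_le[OF \<F>(1)])
        show "((\<lambda>n. norm (W n (k n (t + h)) (?zn n) - W n (k n t) x - (real (j n) * \<delta> n) *\<^sub>R rhs (W n (k n t)) x))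
           \<longlongrightarrow> norm (U (t + h) ?z - U t x - h *\<^sub>R rhs (U t) x)) \<F>"
          by (intro tendsto_intros Wz Wt rl tl[OF jd])
        show "((\<lambda>n. Q3 Q * ((real (j n) * \<delta> n)\<^sup>2 * (1 + norm (x - x0)))) \<longlongrightarrow> Q3 Q * (h\<^sup>2 * (1 + norm (x - x0)))) \<F>"
          by (intro tendsto_intros tl[OF jd])
        have "\<forall>\<^sub>F n in sequentially. real (j n) * \<delta> n < 1" using jd t(3) by (intro order_tendstoD(2)[OF jd]) auto
        with Q(2) have "\<forall>\<^sub>F n in sequentially. norm (W n (k n (t + h)) (?zn n) - W n (k n t) x - (real (j n) * \<delta> n) *\<^sub>R rhs (W n (k n t)) x)
            \<le> Q3 Q * ((real (j n) * \<delta> n)\<^sup>2 * (1 + norm (x - x0)))"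
        proof eventually_elim
          case (elim n)
          have tm: "tame Q (W n (k n t + i))" if "i \<le> j n" for i
          proof -
            have "k n t \<le> k n t + i" "k n t + i \<le> k n (t + h)" "0 \<le> t + h" using that j[of n] t0 by auto
            then show ?thesis using elim(1) t(1,4) by blast
          qed
          have "norm (W n (k n t + j n) (x + (real (j n) * \<delta> n) *\<^sub>R F (x, W n (k n t + 0) x)) - W n (k n t + 0) x
              - (real (j n) * \<delta> n) *\<^sub>R rhs (W n (k n t + 0)) x) \<le> Q3 Q * ((real (j n) * \<delta> n)\<^sup>2 * (1 + norm (x - x0)))"
            by (rule tame_chain_consistent[where W="\<lambda>i. W n (k n t + i)" and j="j n", OF _ \<delta>(3) Q(1) _ tm])
               (use \<delta>(1)[of n] st elim(2) in \<open>auto intro: less_imp_le\<close>)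
          then show ?case by (simp add: j)
        qed
        then show "\<forall>\<^sub>F n in \<F>. norm (W n (k n (t + h)) (?zn n) - W n (k n t) x - (real (j n) * \<delta> n) *\<^sub>R rhs (W n (k n t)) x)
            \<le> Q3 Q * ((real (j n) * \<delta> n)\<^sup>2 * (1 + norm (x - x0)))" by (rule ev)
      qed
    qed
    show "\<exists>Q\<ge>1. tame_evolution a B Q U"
      unfolding tame_evolution_def defect_def
      using Q(1) tameU timeU consU by blast
  qed
qed

end

section \<open>Existence for the planning problem\<close>

lemma planning_data_from_hypotheses:
  fixes F G :: "(real^'n) \<times> (real^'n) \<Rightarrow> real^'n"
  assumes lam: "lam \<ge> 0" and F: "globally_lipschitz F" and G: "globally_lipschitz G"
    and \<alpha>: "\<alpha> > 0" and sm: "strongly_monotone_snd \<alpha> G F"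
    and A: "linear A" and T: "\<And>x. T x = A x + b"
  shows "\<exists>C. planning_data F G A (adjoint A) T x0 lam (min \<alpha> 1) C"
proof -
  obtain LF where LF: "LF-lipschitz_on UNIV F" using F by (auto simp: globally_lipschitz_def)
  obtain LG where LG: "LG-lipschitz_on UNIV G" using G by (auto simp: globally_lipschitz_def)
  obtain a where a: "\<And>x. norm (A x) \<le> a * norm x" using linear_bounded[OF A] by blast
  have A': "linear (adjoint A)" by (rule adjoint_linear[OF A])
  obtain a' where a': "\<And>x. norm (adjoint A x) \<le> a' * norm x" using linear_bounded[OF A'] by blast
  have L0: "0 \<le> LF" "0 \<le> LG" using LF LG lipschitz_on_nonneg by blast+
  define C where "C = 2 + lam + LF + LG + norm (F (x0, 0)) + norm (G (x0, 0)) + \<bar>a\<bar> + \<bar>a'\<bar> + norm (T x0 - x0)"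
  have lip: "norm (\<Phi> (x, p) - \<Phi> (y, q)) \<le> C * (norm (x - y) + norm (p - q))"
    if \<Phi>: "L-lipschitz_on UNIV \<Phi>" and L: "0 \<le> L" "L \<le> C" for \<Phi> :: "(real^'n) \<times> (real^'n) \<Rightarrow> real^'n" and L x p y q
  proof -
    have "norm (\<Phi> (x, p) - \<Phi> (y, q)) \<le> L * norm ((x, p) - (y, q))" using lipschitz_onD[OF \<Phi>, of "(x, p)" "(y, q)"] by (simp add: dist_norm)
    also have "\<dots> \<le> C * (norm (x - y) + norm (p - q))" using L norm_Pair_le[of "x - y" "p - q"] by (intro mult_mono) auto
    finally show ?thesis .
  qed
  have growth: "norm (\<Phi> (x, p)) \<le> C * (1 + norm (x - x0) + norm p)"
    if \<Phi>: "L-lipschitz_on UNIV \<Phi>" and L: "0 \<le> L" "L \<le> C" "norm (\<Phi> (x0, 0)) \<le> C" for \<Phi> :: "(real^'n) \<times> (real^'n) \<Rightarrow> real^'n" and L x p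
  proof -
    have "norm (\<Phi> (x, p)) \<le> norm (\<Phi> (x0, 0)) + norm (\<Phi> (x, p) - \<Phi> (x0, 0))"
      using norm_triangle_ineq[of "\<Phi> (x0, 0)" "\<Phi> (x, p) - \<Phi> (x0, 0)"] by simp
    also have "\<dots> \<le> C + C * (norm (x - x0) + norm (p - 0))" using lip[OF \<Phi> L(1,2), of x p x0 0] L by (intro add_mono)
    finally show ?thesis by (simp add: algebra_simps)
  qed
  have CF: "LF \<le> C" "norm (F (x0, 0)) \<le> C" and CG: "LG \<le> C" "norm (G (x0, 0)) \<le> C" and Ca: "\<bar>a\<bar> \<le> C" "\<bar>a'\<bar> \<le> C" "1 + \<bar>a\<bar> \<le> C"
    "norm (T x0 - x0) \<le> C" "lam \<le> C" "1 \<le> C"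
    unfolding C_def using L0 lam by (simp_all add: add_nonneg_nonneg)
  have "planning_data F G A (adjoint A) T x0 lam (min \<alpha> 1) C"
  proof (rule planning_data.intro)
    show "norm (F (x, p) - F (y, q)) \<le> C * (norm (x - y) + norm (p - q))" for x p y q by (rule lip[OF LF L0(1) CF(1)])
    show "norm (G (x, p) - G (y, q)) \<le> C * (norm (x - y) + norm (p - q))" for x p y q by (rule lip[OF LG L0(2) CG(1)])
    show "norm (F (x, p)) \<le> C * (1 + norm (x - x0) + norm p)" for x p by (rule growth[OF LF L0(1) CF])
    show "norm (G (x, p)) \<le> C * (1 + norm (x - x0) + norm p)" for x p by (rule growth[OF LG L0(2) CG])
    show "min \<alpha> 1 * (norm (p - q))\<^sup>2 \<le> (G (x, p) - G (y, q)) \<bullet> (x - y) + (F (x, p) - F (y, q)) \<bullet> (p - q)" for x p y q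
    proof -
      have "min \<alpha> 1 * (norm (p - q))\<^sup>2 \<le> \<alpha> * (norm (p - q))\<^sup>2" by (rule mult_right_mono) auto
      also have "\<dots> \<le> (G (x, p) - G (y, q)) \<bullet> (x - y) + (F (x, p) - F (y, q)) \<bullet> (p - q)"
        using sm unfolding strongly_monotone_snd_def by blast
      finally show ?thesis .
    qed
    show "T x - T y = A (x - y)" for x y by (simp add: T linear_diff[OF A])
    show "norm (A x) \<le> C * norm x" for x
      using a[of x] mult_right_mono[of a C "norm x"] Ca(1) by (simp add: abs_le_iff)
    show "norm (adjoint A x) \<le> C * norm x" for x
      using a'[of x] mult_right_mono[of a' C "norm x"] Ca(2) by (simp add: abs_le_iff)
    show "x \<bullet> adjoint A y = A x \<bullet> y" for x y by (rule adjoint_works[OF A])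
    show "norm (T x - x) \<le> C * (1 + norm (x - x0))" for x
    proof -
      have e: "T x - x = (T x0 - x0) + A (x - x0) - (x - x0)" by (simp add: T linear_diff[OF A])
      have "norm (T x - x) \<le> norm (T x0 - x0) + norm (A (x - x0)) + norm (x - x0)"
        using norm_triangle_ineq4[of "(T x0 - x0) + A (x - x0)" "x - x0"] norm_triangle_ineq[of "T x0 - x0" "A (x - x0)"] unfolding e by linarith
      also have "\<dots> \<le> C + \<bar>a\<bar> * norm (x - x0) + norm (x - x0)"
        using a[of "x - x0"] mult_right_mono[OF abs_ge_self norm_ge_zero, of a "x - x0"] Ca(4) by linarith
      also have "\<dots> = C + (1 + \<bar>a\<bar>) * norm (x - x0)" by (simp add: algebra_simps)
      also have "\<dots> \<le> C + C * norm (x - x0)" using Ca(3) by (intro add_left_mono mult_right_mono) auto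
      finally show ?thesis by (simp add: algebra_simps)
    qed
  qed (use lam Ca \<alpha> A' in auto)
  then show ?thesis by blast
qed

text \<open>The projection onto a closed convex set is nonexpansive.\<close>
lemma lipschitz_extension_convex:
  fixes f :: "'a::euclidean_space \<Rightarrow> 'b::metric_space"
  assumes S: "convex S" "closed S" "S \<noteq> {}" and L: "L-lipschitz_on S f"
  shows "L-lipschitz_on UNIV (\<lambda>z. f (closest_point S z))"
proof (rule lipschitz_onI)
  fix x y
  have "dist (f (closest_point S x)) (f (closest_point S y)) \<le> L * dist (closest_point S x) (closest_point S y)"
    using closest_point_in_set[OF S(2,3)] by (intro lipschitz_onD[OF L])
  also have "\<dots> \<le> L * dist x y" using closest_point_lipschitz[OF S] lipschitz_on_nonneg[OF L] by (intro mult_left_mono)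
  finally show "dist (f (closest_point S x)) (f (closest_point S y)) \<le> L * dist x y" .
qed (rule lipschitz_on_nonneg[OF L])

lemma has_directional_derivative_cong:
  assumes "open A" "z \<in> A" and eq: "\<And>y. y \<in> A \<Longrightarrow> f y = g y" and "has_directional_derivative f v z l"
  shows "has_directional_derivative g v z l"
proof -
  have "((\<lambda>h::real. z + h *\<^sub>R v) \<longlongrightarrow> z + 0 *\<^sub>R v) (at 0)" by (intro tendsto_intros)
  then have "\<forall>\<^sub>F h in at (0::real). z + h *\<^sub>R v \<in> A" using assms(1,2) by (intro topological_tendstoD) auto
  then have "\<forall>\<^sub>F h in at (0::real). (f (z + h *\<^sub>R v) - f z) / h = (g (z + h *\<^sub>R v) - g z) / h"
    by eventually_elim (use eq assms(2) in auto)
  then show ?thesis using assms(4) unfolding has_directional_derivative_def by (rule Lim_transform_eventually[rotated])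
qed

lemma gateaux_derivative_cong:
  assumes "open A" "z \<in> A" "\<And>y. y \<in> A \<Longrightarrow> f y = g y" "gateaux_derivative f D z"
  shows "gateaux_derivative g D z"
  using assms(4) has_directional_derivative_cong[of A z f g, OF assms(1-3)] unfolding gateaux_derivative_def by blast

lemma AE_gateaux_on_convex:
  fixes f :: "'a::euclidean_space \<Rightarrow> real^'n"
  assumes S: "convex S" "closed S" "S \<noteq> {}" and L: "L-lipschitz_on S f"
  shows "AE z in lborel. z \<in> interior S \<longrightarrow> (\<forall>i. \<exists>D. gateaux_derivative (\<lambda>y. f y $ i) D z)"
proof -
  have "AE z in lborel. \<forall>i. \<exists>D. gateaux_derivative (\<lambda>y. f (closest_point S y) $ i) D z"
  proof -
    have "AE z in lborel. \<exists>D. gateaux_derivative (\<lambda>y. f (closest_point S y) $ i) D z" for i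
    proof (rule rademacher_gateaux)
      show "L-lipschitz_on UNIV (\<lambda>y. f (closest_point S y) $ i)"
      proof (rule lipschitz_onI)
        fix x y
        have "dist (f (closest_point S x) $ i) (f (closest_point S y) $ i) \<le> dist (f (closest_point S x)) (f (closest_point S y))"
          by (rule dist_vec_nth_le)
        also have "\<dots> \<le> L * dist x y" by (rule lipschitz_onD[OF lipschitz_extension_convex[OF S L]]) auto
        finally show "dist (f (closest_point S x) $ i) (f (closest_point S y) $ i) \<le> L * dist x y" .
      qed (rule lipschitz_on_nonneg[OF L])
    qed
    then show ?thesis by (subst AE_all_countable) auto
  qed
  then show ?thesis
  proof eventually_elim
    case (elim z)
    show ?case
    proof (intro impI allI)
      fix i assume z: "z \<in> interior S"
      obtain D where D: "gateaux_derivative (\<lambda>y. f (closest_point S y) $ i) D z" using elim by blast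
      have "gateaux_derivative (\<lambda>y. f y $ i) D z"
        by (rule gateaux_derivative_cong[OF open_interior z _ D])
           (simp add: closest_point_self[OF subsetD[OF interior_subset]])
      then show "\<exists>D. gateaux_derivative (\<lambda>y. f y $ i) D z" by blast
    qed
  qed
qed

context planning_data
begin

lemma time_space_lipschitz:
  assumes Q: "1 \<le> Q" and R: "0 \<le> R" and evo: "tame_evolution a B Q U"
  shows "(Q + Q1 Q * (1 + R))-lipschitz_on ({a..B} \<times> cball x0 R) (\<lambda>(t, x). U t x)"
proof (rule lipschitz_onI)
  have tm: "tame Q (U t)" if "a \<le> t" "t \<le> B" for t using evo that by (simp add: tame_evolution_def)
  have time: "norm (U t' x - U t x) \<le> Q1 Q * ((t' - t) * (1 + norm (x - x0)))" if "a \<le> t" "t \<le> t'" "t' \<le> B" for t t' x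
    using evo that by (simp add: tame_evolution_def)
  have q1: "1 \<le> Q1 Q" using Q_facts[OF Q] by simp
  then show "0 \<le> Q + Q1 Q * (1 + R)" using Q R by simp
  fix z z' assume "z \<in> {a..B} \<times> cball x0 R" "z' \<in> {a..B} \<times> cball x0 R"
  then obtain t x t' x' where z: "z = (t, x)" "z' = (t', x')" "a \<le> t" "t \<le> B" "a \<le> t'" "t' \<le> B"
    "norm (x - x0) \<le> R" "norm (x' - x0) \<le> R" by (auto simp: dist_norm norm_minus_commute)
  have "norm (U t x' - U t' x') \<le> Q1 Q * (\<bar>t - t'\<bar> * (1 + norm (x' - x0)))"
  proof (cases "t \<le> t'")
    case True
    then show ?thesis using time[of t t' x'] z by (simp add: norm_minus_commute)
  next
    case False
    then show ?thesis using time[of t' t x'] z by simp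
  qed
  also have "\<dots> \<le> Q1 Q * (\<bar>t - t'\<bar> * (1 + R))" using q1 z by (intro mult_left_mono) auto
  finally have 1: "norm (U t x' - U t' x') \<le> Q1 Q * (\<bar>t - t'\<bar> * (1 + R))" .
  have "norm (U t x - U t' x') \<le> norm (U t x - U t x') + norm (U t x' - U t' x')"
    using norm_triangle_ineq[of "U t x - U t x'" "U t x' - U t' x'"] by simp
  also have "\<dots> \<le> Q * norm (x - x') + Q1 Q * (\<bar>t - t'\<bar> * (1 + R))"
    using tame_lip[OF tm[OF z(3,4)]] 1 by (intro add_mono)
  also have "\<dots> \<le> Q * dist z z' + Q1 Q * (dist z z' * (1 + R))"
  proof (intro add_mono mult_left_mono mult_right_mono)
    show "norm (x - x') \<le> dist z z'" using dist_snd_le[of z z'] by (simp add: z dist_norm)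
    show "\<bar>t - t'\<bar> \<le> dist z z'" using dist_fst_le[of z z'] by (simp add: z dist_real_def)
  qed (use Q q1 R in auto)
  finally show "dist (case z of (t, x) \<Rightarrow> U t x) (case z' of (t, x) \<Rightarrow> U t x) \<le> (Q + Q1 Q * (1 + R)) * dist z z'"
    by (simp add: z dist_norm algebra_simps)
qed

end

lemma partial_derivative_in_time:
  fixes U :: "real \<Rightarrow> 'a \<Rightarrow> real^'n"
  assumes dd: "\<And>i. ((\<lambda>s. U s x $ i) has_real_derivative (d $ i)) (at t)"
  shows "((\<lambda>s. U s x) has_vector_derivative d) (at t)"
  unfolding has_vector_derivative_def
proof (rule has_derivative_componentwise_within[THEN iffD2], rule ballI)
  fix b :: "real^'n" assume "b \<in> Basis"
  then obtain i u where iu: "b = axis i u" "u \<in> (Basis :: real set)" unfolding Basis_vec_def by blast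
  then have e: "y \<bullet> b = y $ i" for y by (simp add: inner_axis)
  have "((\<lambda>s. U s x $ i) has_derivative (\<lambda>h. d $ i * h)) (at t)"
    using dd[of i] unfolding has_field_derivative_def .
  moreover have "(\<lambda>h. d $ i * h) = (\<lambda>h. (h *\<^sub>R d) $ i)" by (rule ext) (simp add: mult.commute)
  ultimately show "((\<lambda>s. U s x \<bullet> b) has_derivative (\<lambda>h. (h *\<^sub>R d) \<bullet> b)) (at t)" unfolding e by (simp only:)
qed

lemma partial_derivative_in_space:
  assumes "has_directional_derivative (\<lambda>(t, x). U t x $ i) (0, v) (t, x) l"
  shows "((\<lambda>h. U t (x + h *\<^sub>R v) $ i) has_real_derivative l) (at 0)"
proof -
  have e: "(t, x) + h *\<^sub>R (0, v) = (t, x + h *\<^sub>R v)" for h :: real by simp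
  have "((\<lambda>h. (U t (x + h *\<^sub>R v) $ i - U t x $ i) / h) \<longlongrightarrow> l) (at 0)"
    using assms unfolding has_directional_derivative_def e prod.case .
  moreover have "x + 0 *\<^sub>R v = x" by simp
  ultimately show ?thesis unfolding DERIV_def add_0 by (simp only:)
qed

text \<open>Linearity of the derivative in the direction is what connects the derivative along the
  characteristic, which is known, with the partial derivatives in the equation.\<close>
lemma master_equation_from_gateaux:
  fixes F G :: "(real^'n) \<times> (real^'n) \<Rightarrow> real^'n" and U :: "real \<Rightarrow> real^'n \<Rightarrow> real^'n"
  assumes D: "\<And>i. gateaux_derivative (\<lambda>(t, x). U t x $ i) (D i) (t, x)"
    and T': "frechet_derivative T (at x) = A"
    and lim: "((\<lambda>h. (1 / h) *\<^sub>R (U (t + h) (x + h *\<^sub>R F (x, U t x)) - U t x)) \<longlongrightarrow>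
       G (x, U t x) - lam *\<^sub>R U t x + lam *\<^sub>R adjoint A (U t (T x))) (at_right 0)"
  shows "master_equation_at F G lam T U t x"
proof -
  have lin: "linear (D i)" and dd: "has_directional_derivative (\<lambda>(t, x). U t x $ i) v (t, x) (D i v)" for i v
    using D[of i] unfolding gateaux_derivative_def by blast+
  define f where "f = F (x, U t x)"
  define Ut where "Ut = (\<chi> i. D i (1, 0))"
  define J :: "real^'n^'n" where "J = (\<chi> i j. D i (0, axis j 1))"
  have time: "((\<lambda>s. U s x) has_vector_derivative Ut) (at t)"
  proof (rule partial_derivative_in_time)
    fix i
    have e: "(t, x) + h *\<^sub>R (1, 0) = (t + h, x)" for h :: real by simp
    have "((\<lambda>h. (U (t + h) x $ i - U t x $ i) / h) \<longlongrightarrow> D i (1, 0)) (at 0)"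
      using dd[of i "(1, 0)"] unfolding has_directional_derivative_def e prod.case .
    moreover have "Ut $ i = D i (1, 0)" unfolding Ut_def by (rule vec_lambda_beta)
    ultimately show "((\<lambda>s. U s x $ i) has_real_derivative Ut $ i) (at t)" unfolding DERIV_def by (simp only:)
  qed
  have space: "((\<lambda>h. U t (x + h *\<^sub>R axis j 1) $ i) has_real_derivative J $ i $ j) (at 0)" for i j
  proof -
    have "J $ i $ j = D i (0, axis j 1)" unfolding J_def by (simp only: vec_lambda_beta)
    then show ?thesis using partial_derivative_in_space[OF dd[of i "(0, axis j 1)"]] by (simp only:)
  qed
  have key: "D i (1, f) = (G (x, U t x) - lam *\<^sub>R U t x + lam *\<^sub>R adjoint A (U t (T x))) $ i" for i
  proof (rule tendsto_unique)
    show "at_right (0::real) \<noteq> bot" by simp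
    have "((\<lambda>h. (U (t + h) (x + h *\<^sub>R f) $ i - U t x $ i) / h) \<longlongrightarrow> D i (1, f)) (at 0)"
      using dd[of i "(1, f)"] by (simp add: has_directional_derivative_def)
    then show "((\<lambda>h. (U (t + h) (x + h *\<^sub>R f) $ i - U t x $ i) / h) \<longlongrightarrow> D i (1, f)) (at_right 0)"
      by (rule filterlim_mono) (auto simp: at_le)
    show "((\<lambda>h. (U (t + h) (x + h *\<^sub>R f) $ i - U t x $ i) / h) \<longlongrightarrow>
      (G (x, U t x) - lam *\<^sub>R U t x + lam *\<^sub>R adjoint A (U t (T x))) $ i) (at_right 0)"
      using tendsto_vec_nth[OF lim, of i] by (simp add: f_def)
  qed
  have expand: "D i (1, f) = D i (1, 0) + (\<Sum>j\<in>UNIV. f $ j * J $ i $ j)" for i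
  proof -
    have lin2: "linear (\<lambda>y. D i (0, y))"
      using linear_compose[of "\<lambda>y. (0, y)" "D i", OF _ lin] by (simp add: o_def linear_iff)
    have "D i (1, f) = D i ((1, 0) + (0, f))" by simp
    also have "\<dots> = D i (1, 0) + D i (0, f)" by (rule linear_add[OF lin])
    also have "D i (0, f) = D i (0, \<Sum>j\<in>UNIV. f $ j *\<^sub>R axis j 1)"
      using basis_expansion[of f] by (simp add: scalar_mult_eq_scaleR)
    also have "\<dots> = (\<Sum>j\<in>UNIV. f $ j *\<^sub>R D i (0, axis j 1))"
      by (simp add: linear_sum[OF lin2] linear_scale[OF lin2])
    finally show ?thesis by (simp add: J_def)
  qed
  have "Ut + (\<chi> i. \<Sum>j\<in>UNIV. f $ j * J $ i $ j) + lam *\<^sub>R (U t x - adjoint A (U t (T x))) = G (x, U t x)"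
    unfolding vec_eq_iff
  proof
    fix i
    have "Ut $ i + (\<Sum>j\<in>UNIV. f $ j * J $ i $ j) = D i (1, f)" by (simp add: Ut_def expand)
    then show "(Ut + (\<chi> i. \<Sum>j\<in>UNIV. f $ j * J $ i $ j) + lam *\<^sub>R (U t x - adjoint A (U t (T x)))) $ i = G (x, U t x) $ i"
      using key[of i] by (simp add: algebra_simps)
  qed
  then show ?thesis unfolding master_equation_at_def T' using time space by (auto simp: f_def)
qed

theorem theorem2:
  fixes F G :: "(real^'n) \<times> (real^'n) \<Rightarrow> real^'n"
    and T :: "real^'n \<Rightarrow> real^'n"
    and x0 :: "real^'n"
    and lam \<alpha> :: real
  assumes "lam \<ge> 0"
    and "globally_lipschitz F"
    and "globally_lipschitz G"
    and "monotone_operator (\<lambda>z. (G z, F z))"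
    and "\<alpha> > 0"
    and "strongly_monotone_snd \<alpha> G F"
    and "affine_map T"
  shows "\<exists>U. planning_solution F G lam T x0 U"
proof -
  obtain A b where A: "linear A" and T: "\<And>x. T x = A x + b" using assms(7) by (auto simp: affine_map_def)
  obtain C where "planning_data F G A (adjoint A) T x0 lam (min \<alpha> 1) C"
    using planning_data_from_hypotheses[OF assms(1,2,3,5,6) A T] by blast
  then interpret P: planning_data F G A "adjoint A" T x0 lam "min \<alpha> 1" C .
  obtain U where U: "\<And>a B. 0 < a \<Longrightarrow> \<exists>Q\<ge>1. P.tame_evolution a B Q U"
    and anchor: "\<And>t x. 0 < t \<Longrightarrow> t < P.s1 \<Longrightarrow> norm (x - x0) \<le> P.K * t * (P.H + norm (U t x))"
    by (rule P.scheme_limit) (rule that; assumption)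
  have box: "\<exists>L. L-lipschitz_on ({a..B} \<times> cball x0 R) (\<lambda>(t, x). U t x)" if aR: "0 < a" "0 \<le> R" for a B R
  proof -
    obtain Q where Q: "1 \<le> Q" "P.tame_evolution a B Q U" using U[OF aR(1), of B] by blast
    have "(Q + P.Q1 Q * (1 + R))-lipschitz_on ({a..B} \<times> cball x0 R) (\<lambda>(t, x). U t x)"
      by (rule P.time_space_lipschitz[OF Q(1) aR(2) Q(2)])
    then show ?thesis by (rule exI)
  qed
  have loc: "locally_lipschitz_on ({0<..} \<times> UNIV) (\<lambda>(t, x). U t x)"
    unfolding locally_lipschitz_on_def
  proof
    fix z :: "real \<times> (real^'n)" assume "z \<in> {0<..} \<times> UNIV"
    then obtain t x where z: "z = (t, x)" "0 < t" by auto
    obtain L where L: "L-lipschitz_on ({t/2..2*t} \<times> cball x0 (norm (x - x0) + t/2)) (\<lambda>(t, x). U t x)"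
      using box[of "t/2" "norm (x - x0) + t/2" "2*t"] z by auto
    have "ball z (t/2) \<inter> ({0<..} \<times> UNIV) \<subseteq> {t/2..2*t} \<times> cball x0 (norm (x - x0) + t/2)"
    proof
      fix y assume y: "y \<in> ball z (t/2) \<inter> ({0<..} \<times> UNIV)"
      have "dist (fst z) (fst y) < t/2" "dist (snd z) (snd y) < t/2"
        using y dist_fst_le[of z y] dist_snd_le[of z y] by auto
      then have "\<bar>t - fst y\<bar> < t/2" "norm (x - snd y) < t/2" by (auto simp: z dist_norm)
      moreover have "dist x0 (snd y) \<le> norm (x - x0) + norm (x - snd y)"
        using dist_triangle[of x0 "snd y" x] by (simp add: dist_norm norm_minus_commute)
      moreover have "t / 2 \<le> fst y" "fst y \<le> 2 * t" using \<open>\<bar>t - fst y\<bar> < t/2\<close> z(2) unfolding abs_less_iff by linarith+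
      ultimately have "fst y \<in> {t/2..2*t}" "snd y \<in> cball x0 (norm (x - x0) + t/2)" by auto
      then show "y \<in> {t/2..2*t} \<times> cball x0 (norm (x - x0) + t/2)" by (simp add: mem_Times_iff)
    qed
    then have "L-lipschitz_on (ball z (t/2) \<inter> ({0<..} \<times> UNIV)) (\<lambda>(t, x). U t x)"
      using lipschitz_on_subset[OF L] by blast
    then show "\<exists>e>0. \<exists>L. L-lipschitz_on (ball z e \<inter> ({0<..} \<times> UNIV)) (\<lambda>(t, x). U t x)" using z by (intro exI[of _ "t/2"]) auto
  qed
  have "AE z in lborel. \<forall>n::nat. z \<in> interior ({1 / real (Suc n)..real (Suc n)} \<times> cball x0 (real (Suc n))) \<longrightarrow>
     (\<forall>i. \<exists>D. gateaux_derivative (\<lambda>z. (case z of (t, x) \<Rightarrow> U t x) $ i) D z)"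
    unfolding AE_all_countable
  proof
    fix n :: nat
    let ?S = "{1 / real (Suc n)..real (Suc n)} \<times> cball x0 (real (Suc n))"
    have "1 / real (Suc n) \<le> real (Suc n)" by (simp add: field_simps)
    then have ne: "?S \<noteq> {}" by auto
    obtain L where "L-lipschitz_on ?S (\<lambda>(t, x). U t x)" using box[of "1 / real (Suc n)" "real (Suc n)"] by auto
    then show "AE z in lborel. z \<in> interior ?S \<longrightarrow> (\<forall>i. \<exists>D. gateaux_derivative (\<lambda>z. (case z of (t, x) \<Rightarrow> U t x) $ i) D z)"
      by (intro AE_gateaux_on_convex ne) (auto intro: convex_Times closed_Times)
  qed
  then have ae: "AE z in lborel. fst z > 0 \<longrightarrow> master_equation_at F G lam T U (fst z) (snd z)"
  proof eventually_elim
    case (elim z)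
    show ?case
    proof
      assume z0: "fst z > 0"
      obtain t x where z: "z = (t, x)" by (cases z)
      have t: "0 < t" using z0 z by simp
      obtain n :: nat where n: "max (1 / t) (max t (norm (x - x0))) < real n" using reals_Archimedean2 by blast
      have "1 / real (Suc n) < t"
      proof -
        have "1 / t < real (Suc n)" using n by simp
        then show ?thesis using t by (simp add: field_simps)
      qed
      then have "z \<in> {1 / real (Suc n)<..<real (Suc n)} \<times> ball x0 (real (Suc n))"
        using n by (auto simp: z dist_norm norm_minus_commute)
      moreover have "{1 / real (Suc n)<..<real (Suc n)} \<times> ball x0 (real (Suc n))
         \<subseteq> interior ({1 / real (Suc n)..real (Suc n)} \<times> cball x0 (real (Suc n)))"
        by (rule interior_maximal) (auto intro: open_Times)
      ultimately have "\<forall>i. \<exists>D. gateaux_derivative (\<lambda>z. (case z of (t, x) \<Rightarrow> U t x) $ i) D z" using elim by blast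
      then obtain D where "\<And>i. gateaux_derivative (\<lambda>z. (case z of (t, x) \<Rightarrow> U t x) $ i) (D i) z" by metis
      then have D: "gateaux_derivative (\<lambda>(t, x). U t x $ i) (D i) (t, x)" for i by (simp add: z case_prod_beta')
      have T': "frechet_derivative T (at x) = A"
      proof -
        have "bounded_linear A" using A by (simp add: linear_conv_bounded_linear)
        then have "((\<lambda>x. A x + b) has_derivative A) (at x)"
          by (intro has_derivative_add_const bounded_linear_imp_has_derivative)
        moreover have "T = (\<lambda>x. A x + b)" by (rule ext) (rule T)
        ultimately have "(T has_derivative A) (at x)" by simp
        then show ?thesis by (rule frechet_derivative_at[symmetric])
      qed
      have "((\<lambda>h. (1 / h) *\<^sub>R (U (t + h) (x + h *\<^sub>R F (x, U t x)) - U t x)) \<longlongrightarrow> P.rhs (U t) x) (at_right 0)"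
      proof -
        let ?q = "\<lambda>h. (1 / h) *\<^sub>R (U (t + h) (x + h *\<^sub>R F (x, U t x)) - U t x) - P.rhs (U t) x"
        obtain Q where evo: "P.tame_evolution t (t + 1/2) Q U" using U[OF t, of "t + 1/2"] by blast
        have Q: "norm (P.defect U t h x) \<le> P.Q3 Q * (h\<^sup>2 * (1 + norm (x - x0)))" if "0 < h" "h \<le> 1/2" for h
          using evo that by (simp add: P.tame_evolution_def)
        have "(?q \<longlongrightarrow> 0) (at_right 0)"
        proof (rule Lim_null_comparison)
          have "((\<lambda>h::real. P.Q3 Q * (h * (1 + norm (x - x0)))) \<longlongrightarrow> P.Q3 Q * (0 * (1 + norm (x - x0)))) (at_right 0)"
            by (intro tendsto_intros)
          then show "((\<lambda>h::real. P.Q3 Q * (h * (1 + norm (x - x0)))) \<longlongrightarrow> 0) (at_right 0)" by simp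
          have "\<forall>\<^sub>F h in at_right (0::real). h \<in> {0<..<1/2}" by (rule eventually_at_right_real) simp
          then show "\<forall>\<^sub>F h in at_right 0. norm (?q h) \<le> P.Q3 Q * (h * (1 + norm (x - x0)))"
          proof eventually_elim
            case (elim h)
            have "?q h = (1 / h) *\<^sub>R P.defect U t h x" using elim by (simp add: P.defect_def algebra_simps)
            then have "norm (?q h) = (1 / h) * norm (P.defect U t h x)" using elim by simp
            also have "\<dots> \<le> (1 / h) * (P.Q3 Q * (h\<^sup>2 * (1 + norm (x - x0))))" using elim by (intro mult_left_mono Q) auto
            also have "\<dots> = P.Q3 Q * (h * (1 + norm (x - x0)))" using elim by (simp add: power2_eq_square)
            finally show ?case .
          qed
        qed
        then show ?thesis by (rule LIM_zero_cancel)
      qed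
      then have "master_equation_at F G lam T U t x"
        unfolding P.rhs_def by (rule master_equation_from_gateaux[where D=D, OF D T'])
      then show "master_equation_at F G lam T U (fst z) (snd z)" by (simp add: z)
    qed
  qed
  have gr: "graph_converges_at_0 U (point_operator x0)"
    unfolding graph_converges_at_0_def graph_converges_def
  proof (intro allI impI)
    fix t :: "nat \<Rightarrow> real" and X Y x y
    assume t: "\<forall>n. 0 < t n" "t \<longlonglongrightarrow> 0" and Y: "\<forall>n. Y n \<in> {U (t n) (X n)}" and X: "X \<longlonglongrightarrow> x" and Yl: "Y \<longlonglongrightarrow> y"
    have "norm (x - x0) \<le> P.K * 0 * (P.H + norm y)"
    proof (rule tendsto_le[OF sequentially_bot])
      show "(\<lambda>n. norm (X n - x0)) \<longlonglongrightarrow> norm (x - x0)" by (intro tendsto_intros X)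
      show "(\<lambda>n. P.K * t n * (P.H + norm (Y n))) \<longlonglongrightarrow> P.K * 0 * (P.H + norm y)" by (intro tendsto_intros t Yl)
      have "\<forall>\<^sub>F n in sequentially. t n < P.s1" using t(2) P.anchor_constants(3) by (rule order_tendstoD)
      then show "\<forall>\<^sub>F n in sequentially. norm (X n - x0) \<le> P.K * t n * (P.H + norm (Y n))"
        by eventually_elim (use anchor t(1) Y in auto)
    qed
    then show "y \<in> point_operator x0 x" by (simp add: point_operator_def)
  qed
  show ?thesis
  proof (rule exI)
    show "planning_solution F G lam T x0 U"
      unfolding planning_solution_def master_equation_solution_def by (intro conjI loc ae gr)
  qed
qed

end
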